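(* Let $u$ be a (real-valued) harmonic function in the unit disc $\mathbb D$, and let $h$ be one of the functions specified in (a)--(d) below. Suppose that $$\lim_{z\in \Omega^h(\varphi),\,z\to e^{i\varphi}}u(z)=0 \qquad\text{for every } \varphi\in [0,2\pi].$$ (a) If $h(t)=0$ for all $t$ and $$M_r(u)=o((1-r)^{-2}),\qquad r\to 1-,$$ then $u=0$. (b) If $h(t)=ct^3$ with $c>0$, and $$\log^+M_r(u)=o((1-r)^{-1}),\qquad r\to 1-,$$ then $u=0$. (c) If $h(t)=ct$ with $c>0$, and $$\log^+M_r(u)=o\bigl((1-r)^{-\pi/(2\arctan (1/c))}\bigr),\qquad r\to 1-,$$ then $u=0$. (d) If $h(t)=t^\gamma$ with $0<\gamma<1$, and $$\log^+\log^+M_r(u)=o((1-r)^{\gamma-1}),\qquad r\to 1-,$$ then $u=0$.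
   Context: $\mathbb D=\{z\in\mathbb C:|z|<1\}$. For a real-valued continuous function $u$ on $\mathbb D$ and $0<r<1$, $M_r(u)=\max_{0\le\theta\le 2\pi}u(re^{i\theta})$ (no absolute value). $\log^+ s=\max(\log s,0)$ for $s>0$ and $\log^+ s=0$ for $s\le 0$. Approach regions: for a non-decreasing continuous function $h:[0,1]\to[0,\infty)$ with $h(0)=0$ (an approach function), put $\Delta^h=\{x+iy:|x|\le h(y),\,0<y<1\}\subset\mathbb C_+=\{x+iy\in\mathbb C:y>0\}$. For $\varphi\in[0,2\pi]$ let $f_\varphi(z)=e^{i\varphi}\frac{i-z}{i+z}$, which maps $\mathbb C_+$ conformally onto $\mathbb D$ and sends $0$ to $e^{i\varphi}$. Put $\Omega^h(\varphi)=f_\varphi(\Delta^h)$. *)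

theory Defs
  imports "HOL-Analysis.Analysis" "HOL-Library.Landau_Symbols"
begin

text \<open>
  Harmonic means twice continuously differentiable with vanishing Laplacian. The functions
  \<open>ux\<close>, \<open>uy\<close>, \<open>uxx\<close>, \dots are the partial derivatives of \<open>u\<close> with respect to \<open>x = Re z\<close> and
  \<open>y = Im z\<close>, which are uniquely determined on an open set; nothing is required of \<open>u\<close> outside \<open>S\<close>.
\<close>

definition harmonic_on :: "(complex \<Rightarrow> real) \<Rightarrow> complex set \<Rightarrow> bool" (infixl "harmonic'_on" 50)
  where "u harmonic_on S \<longleftrightarrow> open S \<and>
    (\<exists>ux uy uxx uxy uyx uyy :: complex \<Rightarrow> real.
      (\<forall>z\<in>S. (u has_derivative (\<lambda>w. ux z * Re w + uy z * Im w)) (at z)) \<and>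
      (\<forall>z\<in>S. (ux has_derivative (\<lambda>w. uxx z * Re w + uxy z * Im w)) (at z)) \<and>
      (\<forall>z\<in>S. (uy has_derivative (\<lambda>w. uyx z * Re w + uyy z * Im w)) (at z)) \<and>
      continuous_on S uxx \<and> continuous_on S uxy \<and> continuous_on S uyx \<and> continuous_on S uyy \<and>
      (\<forall>z\<in>S. uxx z + uyy z = 0))"

text \<open>
  For \<open>u\<close> continuous on the disc and \<open>0 < r < 1\<close> the supremum is attained, so it is the
  maximum over the circle of radius \<open>r\<close>.
\<close>

definition circle_max :: "(complex \<Rightarrow> real) \<Rightarrow> real \<Rightarrow> real"
  where "circle_max u r = (SUP \<theta>\<in>{0..2 * pi}. u (complex_of_real r * cis \<theta>))"

text \<open>The case distinction is needed because \<open>ln\<close> is total: the value at \<open>s \<le> 0\<close> is prescribed.\<close>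

definition log_plus :: "real \<Rightarrow> real"
  where "log_plus s = (if s > 0 then max (ln s) 0 else 0)"

definition approach_region :: "(real \<Rightarrow> real) \<Rightarrow> complex set"
  where "approach_region h = {z. \<bar>Re z\<bar> \<le> h (Im z) \<and> 0 < Im z \<and> Im z < 1}"

definition half_plane_to_disc :: "real \<Rightarrow> complex \<Rightarrow> complex"
  where "half_plane_to_disc \<phi> z = cis \<phi> * ((\<i> - z) / (\<i> + z))"

definition disc_approach_region :: "(real \<Rightarrow> real) \<Rightarrow> real \<Rightarrow> complex set"
  where "disc_approach_region h \<phi> = half_plane_to_disc \<phi> ` approach_region h"

definition zero_limits_along :: "(real \<Rightarrow> real) \<Rightarrow> (complex \<Rightarrow> real) \<Rightarrow> bool"
  where "zero_limits_along h u \<longleftrightarrow>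
    (\<forall>\<phi>\<in>{0..2 * pi}. (u \<longlongrightarrow> 0) (at (cis \<phi>) within disc_approach_region h \<phi>))"

end

theory Submission
  imports Defs "HOL-Complex_Analysis.Complex_Analysis" "HOL-Real_Asymp.Real_Asymp"
begin

text \<open>
  Write \<open>u = Re f\<close> with \<open>f\<close> holomorphic and lift \<open>u\<close> to \<open>U \<zeta> = u (exp (\<i> * \<zeta>))\<close> on the upper half plane.
  Let \<open>E\<close> be the closed set of boundary points without a neighbourhood on which \<open>U\<close> tends to \<open>0\<close>.
  If \<open>E\<close> is not empty, Baire's theorem gives an interval that meets \<open>E\<close> and a height below which
  \<open>\<bar>U\<bar> \<le> 1\<close> on the vertical segments over \<open>E\<close>. Over a complementary interval \<open>(a, b)\<close> of \<open>E\<close> the function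
  \<open>U\<close> vanishes on the real axis, and the Phragmen-Lindeloef principle bounds \<open>U\<close> there as soon as
  \<open>U = o(\<bar>\<zeta> - a\<bar>\<^sup>-\<^sup>2)\<close> at the corner \<open>a\<close>, and likewise at \<open>b\<close>. So \<open>U\<close> is bounded near a point of \<open>E\<close>, and
  a second application of Baire's theorem, now with \<open>\<epsilon>\<close> in place of \<open>1\<close>, shows that \<open>U\<close> tends to \<open>0\<close>
  there: a contradiction. Hence \<open>E\<close> is empty and \<open>u = 0\<close> by the maximum principle.

  In case (a) the estimate at the corner is the growth condition, moved from the interior to the
  corner by a barrier. As this condition is one sided, it bounds \<open>U\<close> only from above at first;
  Harnack's inequality then gives \<open>U \<ge> - C / Im \<zeta>\<close>, which suffices for the lower bound.

  In the other cases, \<open>f'\<close> is at most a power of the distance to the corner on a curve inside the approach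
  region. Since \<open>u\<close> vanishes on the boundary on the other side of this curve, \<open>f'\<close> extends by reflection to the
  domain between the curve and its mirror image, and the growth condition is exactly the one which
  the Phragmen-Lindeloef principle allows for \<open>log \<bar>f'\<bar>\<close> in this domain. So \<open>f'\<close> is at most
  a power of the distance, and integration gives the estimate for \<open>u\<close> at the corner.
\<close>

subsection \<open>Harmonic functions as real parts\<close>

text \<open>The exponent 2 comes from the right angle between a vertical segment over
  \<open>E\<close> and the real axis: \<open>\<i> / z\<^sup>2\<close> has positive real part in a
  quadrant, and smaller growth is harmless. There are two reasons to work with \<open>f'\<close>. A
  bound for \<open>u\<close> on a disc controls \<open>f'\<close> at the centre but not the
  conjugate function, and \<open>log \<bar>f'\<bar>\<close> is subharmonic, so \<open>f'\<close> may
  be compared with \<open>exp\<close> of a positive harmonic function. The regions fix the rates. In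
  (b) the discs inside the region have radius of order \<open>t ^ 3\<close>; smallness of
  \<open>u\<close> gives \<open>f' = o(1 / t ^ 3)\<close>, which integrates to just the
  \<open>o(1 / t ^ 2)\<close> required, and the domain is a half plane, with rate
  \<open>1 / t\<close>. In (c) the domain is nearly a sector of opening
  \<open>2 * arctan (1 / c)\<close>, whose critical power is \<open>pi\<close> over the opening. In
  (d) it is a cusp of width about \<open>x powr (1 / \<gamma>)\<close>; its map to a half plane is
  nearly \<open>exp\<close> of a multiple of \<open>x powr (1 - 1 / \<gamma>)\<close>, which is
  \<open>y powr (\<gamma> - 1)\<close> on the edge. The growth conditions see only the distance to
  the circle, so each has to be converted into one in the distance to the corner.\<close>

lemma mixed_difference_mvt:
  fixes u ux uxy :: "complex \<Rightarrow> real"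
  assumes h: "h > 0"
    and sub: "\<And>s t. 0 \<le> s \<Longrightarrow> s \<le> h \<Longrightarrow> 0 \<le> t \<Longrightarrow> t \<le> h \<Longrightarrow> Complex (a + s) (b + t) \<in> S"
    and u: "\<And>z. z \<in> S \<Longrightarrow> (u has_derivative (\<lambda>w. ux z * Re w + uy z * Im w)) (at z)"
    and ux: "\<And>z. z \<in> S \<Longrightarrow> (ux has_derivative (\<lambda>w. uxx z * Re w + uxy z * Im w)) (at z)"
  obtains s t where "0 \<le> s" "s \<le> h" "0 \<le> t" "t \<le> h"
    "u (Complex (a + h) (b + h)) - u (Complex (a + h) b) - u (Complex a (b + h)) + u (Complex a b)
      = h\<^sup>2 * uxy (Complex (a + s) (b + t))"
proof -
  define p where "p s = u (Complex (a + s) (b + h)) - u (Complex (a + s) b)" for s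
  have dC1: "((\<lambda>s. Complex (a + s) c) has_derivative (\<lambda>d. of_real d)) (at s within T)" for c s T
  proof -
    have "(\<lambda>s. Complex (a + s) c) = (\<lambda>s. of_real s + Complex a c)"
      by (auto simp: complex_eq_iff)
    then show ?thesis by (auto intro!: derivative_eq_intros)
  qed
  have dC2: "((\<lambda>t. Complex c (b + t)) has_derivative (\<lambda>d. \<i> * of_real d)) (at s within T)" for c s T
  proof -
    have "(\<lambda>t. Complex c (b + t)) = (\<lambda>t. \<i> * of_real t + Complex c b)"
      by (auto simp: complex_eq_iff)
    then show ?thesis by (auto intro!: derivative_eq_intros)
  qed
  have dp: "(p has_derivative (\<lambda>d. d * (ux (Complex (a + s) (b + h)) - ux (Complex (a + s) b)))) (at s)"
    if "0 \<le> s" "s \<le> h" for s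
  proof -
    have "Complex (a + s) (b + h) \<in> S" "Complex (a + s) b \<in> S"
      using sub[of s h] sub[of s 0] that h by auto
    then have "((\<lambda>s. u (Complex (a + s) (b + h))) has_derivative (\<lambda>d. ux (Complex (a + s) (b + h)) * d)) (at s)"
      "((\<lambda>s. u (Complex (a + s) b)) has_derivative (\<lambda>d. ux (Complex (a + s) b) * d)) (at s)"
      using has_derivative_compose[OF dC1 u, of s "b + h" UNIV]
        has_derivative_compose[OF dC1 u, of s "b" UNIV] by auto
    from has_derivative_diff[OF this] show ?thesis
      unfolding p_def by (simp add: algebra_simps)
  qed
  have "\<exists>s\<in>{0<..<h}. p h - p 0 = (h - 0) * (ux (Complex (a + s) (b + h)) - ux (Complex (a + s) b))"
    by (rule mvt[OF h])
      (auto intro!: continuous_at_imp_continuous_on has_derivative_continuous[OF dp] dp)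
  then obtain s where s: "0 < s" "s < h"
    "p h - p 0 = h * (ux (Complex (a + s) (b + h)) - ux (Complex (a + s) b))" by auto
  have dq: "((\<lambda>t. ux (Complex (a + s) (b + t))) has_derivative (\<lambda>d. d * uxy (Complex (a + s) (b + t)))) (at t)"
    if "0 \<le> t" "t \<le> h" for t
  proof -
    have "Complex (a + s) (b + t) \<in> S" using sub[of s t] that s by auto
    then show ?thesis using has_derivative_compose[OF dC2 ux, of "a + s" t UNIV]
      by (simp add: mult.commute)
  qed
  have "\<exists>t\<in>{0<..<h}. ux (Complex (a + s) (b + h)) - ux (Complex (a + s) (b + 0)) = (h - 0) * uxy (Complex (a + s) (b + t))"
    by (rule mvt[OF h])
      (auto intro!: continuous_at_imp_continuous_on has_derivative_continuous[OF dq] dq)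
  then obtain t where t: "0 < t" "t < h"
    "ux (Complex (a + s) (b + h)) - ux (Complex (a + s) b) = h * uxy (Complex (a + s) (b + t))" by auto
  show ?thesis
    by (rule that[of s t]) (use s t in \<open>auto simp: p_def power2_eq_square\<close>)
qed

text \<open>Clairaut's theorem. The second difference over a square is the same for both orders of
  the coordinates, and each order turns it into \<open>h\<^sup>2\<close> times a mixed derivative at
  some point of the square; continuity of both then forces equality at the corner
  \<open>z\<close>.\<close>

lemma mixed_partials_eq:
  fixes u ux uy uxx uxy uyx uyy :: "complex \<Rightarrow> real"
  assumes S: "open S" "z \<in> S"
    and u: "\<And>z. z \<in> S \<Longrightarrow> (u has_derivative (\<lambda>w. ux z * Re w + uy z * Im w)) (at z)"
    and ux: "\<And>z. z \<in> S \<Longrightarrow> (ux has_derivative (\<lambda>w. uxx z * Re w + uxy z * Im w)) (at z)"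
    and uy: "\<And>z. z \<in> S \<Longrightarrow> (uy has_derivative (\<lambda>w. uyx z * Re w + uyy z * Im w)) (at z)"
    and c: "continuous_on S uxy" "continuous_on S uyx"
  shows "uxy z = uyx z"
proof (rule ccontr)
  assume ne: "uxy z \<noteq> uyx z"
  define e where "e = \<bar>uxy z - uyx z\<bar> / 2"
  have e: "e > 0" using ne by (simp add: e_def)
  have cz: "isCont uxy z" "isCont uyx z" using c S by (auto simp: continuous_on_eq_continuous_at)
  then obtain d1 d2 where d: "d1 > 0" "d2 > 0"
    "\<And>w. dist w z < d1 \<Longrightarrow> dist (uxy w) (uxy z) < e" "\<And>w. dist w z < d2 \<Longrightarrow> dist (uyx w) (uyx z) < e"
    using e unfolding continuous_at_eps_delta by metis
  obtain d3 where d3: "d3 > 0" "ball z d3 \<subseteq> S" using S open_contains_ball by blast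
  \<comment> \<open>A square of side \<open>h\<close> stays within distance \<open>2 * h\<close> of
    its corner, and \<open>2 * h\<close> is at most half of each admissible radius.\<close>
  define h where "h = Min {d1, d2, d3} / 4"
  have h: "h > 0" "2 * h < d1" "2 * h < d2" "2 * h < d3" using d d3 by (auto simp: h_def)
  have near: "dist (Complex (Re z + s) (Im z + t)) z < 2 * h \<or> dist (Complex (Re z + s) (Im z + t)) z = 2*h"
    if "0 \<le> s" "s \<le> h" "0 \<le> t" "t \<le> h" for s t
  proof -
    have "dist (Complex (Re z + s) (Im z + t)) z = cmod (Complex s t)"
      by (metis Complex_eq complex_surj dist_norm add_diff_cancel_left' complex_add complex.collapse)
    also have "\<dots> \<le> s + t" using that cmod_le[of "Complex s t"] by auto
    finally show ?thesis using that by linarith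
  qed
  have sub: "Complex (Re z + s) (Im z + t) \<in> S" if "0 \<le> s" "s \<le> h" "0 \<le> t" "t \<le> h" for s t
    using near[OF that] d3 h by (auto simp: subset_iff dist_commute)
  obtain s t where st: "0 \<le> s" "s \<le> h" "0 \<le> t" "t \<le> h"
    "u (Complex (Re z + h) (Im z + h)) - u (Complex (Re z + h) (Im z)) - u (Complex (Re z) (Im z + h)) + u (Complex (Re z) (Im z))
      = h\<^sup>2 * uxy (Complex (Re z + s) (Im z + t))"
    by (rule mixed_difference_mvt[OF h(1) sub u ux])
  \<comment> \<open>transposing the coordinates turns the other mixed partial into the first one\<close>
  define T where "T = (\<lambda>w. Complex (Im w) (Re w))"
  have TT: "T (T w) = w" "T (Complex x y) = Complex y x" for w x y by (auto simp: T_def complex_eq_iff)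
  have dT: "(T has_derivative T) (at w)" for w
  proof -
    have "T = (\<lambda>w. \<i> * cnj w)" by (auto simp: T_def complex_eq_iff)
    then show ?thesis by (metis bounded_linear_cnj bounded_linear_const_mult bounded_linear_imp_has_derivative)
  qed
  have u': "((\<lambda>w. u (T w)) has_derivative (\<lambda>w. uy (T z) * Re w + ux (T z) * Im w)) (at z)" if "z \<in> T ` S" for z
  proof -
    have "T z \<in> S" using that by (auto simp: TT)
    from has_derivative_compose[OF dT u[OF this]] show ?thesis by (simp add: T_def algebra_simps)
  qed
  have uy': "((\<lambda>w. uy (T w)) has_derivative (\<lambda>w. uyy (T z) * Re w + uyx (T z) * Im w)) (at z)" if "z \<in> T ` S" for z
  proof -
    have "T z \<in> S" using that by (auto simp: TT)
    from has_derivative_compose[OF dT uy[OF this]] show ?thesis by (simp add: T_def algebra_simps)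
  qed
  have sub': "Complex (Im z + s) (Re z + t) \<in> T ` S" if "0 \<le> s" "s \<le> h" "0 \<le> t" "t \<le> h" for s t
    using sub[OF that(3,4,1,2)] image_eqI[of "Complex (Im z + s) (Re z + t)" T] TT by metis
  obtain s' t' where st': "0 \<le> s'" "s' \<le> h" "0 \<le> t'" "t' \<le> h"
    "u (T (Complex (Im z + h) (Re z + h))) - u (T (Complex (Im z + h) (Re z))) - u (T (Complex (Im z) (Re z + h))) + u (T (Complex (Im z) (Re z)))
      = h\<^sup>2 * uyx (T (Complex (Im z + s') (Re z + t')))"
    by (rule mixed_difference_mvt[OF h(1) sub' u' uy'])
  have "h\<^sup>2 * uxy (Complex (Re z + s) (Im z + t)) = h\<^sup>2 * uyx (Complex (Re z + t') (Im z + s'))"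
    using st(5) st'(5) unfolding TT by linarith
  then have "uxy (Complex (Re z + s) (Im z + t)) = uyx (Complex (Re z + t') (Im z + s'))"
    using h by simp
  moreover have "dist (uxy (Complex (Re z + s) (Im z + t))) (uxy z) < e"
    using d(3) near[OF st(1-4)] h by auto
  moreover have "dist (uyx (Complex (Re z + t') (Im z + s'))) (uyx z) < e"
    using d(4) near[OF st'(3,4,1,2)] h by auto
  moreover have "dist (uxy z) (uyx z) = 2 * e" by (simp add: e_def dist_real_def)
  ultimately show False using dist_triangle3[of "uxy z" "uyx z" "uxy (Complex (Re z + s) (Im z + t))"]
    by simp
qed

lemma harmonic_on_ball_imp_Re_holomorphic:
  assumes "u harmonic_on ball a r"
  obtains f where "f holomorphic_on ball a r" "\<And>z. z \<in> ball a r \<Longrightarrow> u z = Re (f z)"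
proof -
  let ?S = "ball a r"
  obtain ux uy uxx uxy uyx uyy where
    u: "\<And>z. z \<in> ?S \<Longrightarrow> (u has_derivative (\<lambda>w. ux z * Re w + uy z * Im w)) (at z)"
    and ux: "\<And>z. z \<in> ?S \<Longrightarrow> (ux has_derivative (\<lambda>w. uxx z * Re w + uxy z * Im w)) (at z)"
    and uy: "\<And>z. z \<in> ?S \<Longrightarrow> (uy has_derivative (\<lambda>w. uyx z * Re w + uyy z * Im w)) (at z)"
    and c: "continuous_on ?S uxy" "continuous_on ?S uyx"
    and lap: "\<And>z. z \<in> ?S \<Longrightarrow> uxx z + uyy z = 0"
    using assms unfolding harmonic_on_def by blast
  \<comment> \<open>The derivative that \<open>f\<close> must have. Equality of the mixed
    derivatives and the Laplace equation are the Cauchy-Riemann equations for \<open>p\<close>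
    itself.\<close>
  define p where "p z = of_real (ux z) - \<i> * of_real (uy z)" for z
  have dp: "(p has_field_derivative (of_real (uxx z) - \<i> * of_real (uyx z))) (at z)" if z: "z \<in> ?S" for z
  proof -
    have eq: "uxy z = uyx z" using mixed_partials_eq[OF open_ball z u ux uy c] .
    have "uyy z = - uxx z" using lap[OF z] by linarith
    have d: "(p has_derivative (\<lambda>w. of_real (uxx z * Re w + uxy z * Im w) - \<i> * of_real (uyx z * Re w + uyy z * Im w))) (at z)"
      unfolding p_def using ux[OF z] uy[OF z]
      by (intro has_derivative_diff has_derivative_mult_right has_derivative_of_real)
    show ?thesis
      unfolding has_field_derivative_def
      by (rule has_derivative_eq_rhs[OF d]) (auto simp: fun_eq_iff complex_eq_iff eq \<open>uyy z = - uxx z\<close>)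
  qed
  have "p holomorphic_on ?S"
    by (rule holomorphic_onI) (use dp has_field_derivative_at_within field_differentiable_def in blast)
  then obtain f where f: "\<And>z. z \<in> ?S \<Longrightarrow> (f has_field_derivative p z) (at z within ?S)"
    using holomorphic_convex_primitive'[OF convex_ball open_ball] by blast
  have f': "(f has_field_derivative p z) (at z)" if "z \<in> ?S" for z
    using f[OF that] at_within_open[OF that open_ball] by simp
  have "((\<lambda>z. u z - Re (f z)) has_derivative (\<lambda>w. 0)) (at z within ?S)" if z: "z \<in> ?S" for z
  proof -
    have "((\<lambda>z. Re (f z)) has_derivative (\<lambda>w. Re (p z * w))) (at z)"
      using f'[OF z] unfolding has_field_derivative_def by (rule has_derivative_Re)
    from has_derivative_diff[OF u[OF z] this]
    have "((\<lambda>z. u z - Re (f z)) has_derivative (\<lambda>w. 0)) (at z)"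
      by (rule has_derivative_eq_rhs) (auto simp: p_def fun_eq_iff)
    then show ?thesis by (rule has_derivative_at_withinI)
  qed
  from has_derivative_zero_constant[OF convex_ball this]
  obtain k where k: "\<And>z. z \<in> ?S \<Longrightarrow> u z - Re (f z) = k" by auto
  show ?thesis
  proof (rule that[of "\<lambda>z. f z + of_real k"])
    show "(\<lambda>z. f z + of_real k) holomorphic_on ?S"
      proof (intro holomorphic_intros holomorphic_onI)
      fix z assume "z \<in> ?S"
      then show "f field_differentiable at z within ?S" using f field_differentiable_def by blast
    qed
    show "u z = Re (f z + of_real k)" if "z \<in> ?S" for z using k[OF that] by auto
  qed
qed

subsection \<open>The Phragmen-Lindeloef principle\<close>

text \<open>No boundary values are assumed, only limits superior. The set \<open>K\<close> where the
  modulus is at least its value at the supposed counterexample is closed: a limit of its points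
  outside \<open>D\<close> would be a frontier point, near which the modulus is at most
  \<open>M + e < m\<close>. So the modulus attains a maximum inside \<open>D\<close>.\<close>

lemma norm_le_if_limsup_frontier_le:
  fixes G :: "complex \<Rightarrow> complex"
  assumes D: "open D" "bounded D" and G: "G holomorphic_on D"
    and bd: "\<And>\<xi> e. \<xi> \<in> frontier D \<Longrightarrow> e > 0 \<Longrightarrow> \<forall>\<^sub>F z in at \<xi> within D. norm (G z) \<le> M + e"
    and z0: "z0 \<in> D"
  shows "norm (G z0) \<le> M"
proof (rule ccontr)
  assume "\<not> norm (G z0) \<le> M"
  define m where "m = norm (G z0)"
  define e where "e = (m - M) / 2"
  have e: "e > 0" "M + e < m" using \<open>\<not> norm (G z0) \<le> M\<close> by (auto simp: e_def m_def field_simps)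
  have cont: "continuous_on D G" using G by (rule holomorphic_on_imp_continuous_on)
  define K where "K = {z \<in> D. m \<le> norm (G z)}"
  have "closed K"
  unfolding closed_sequential_limits
  proof (intro allI impI)
    fix s l assume "(\<forall>n. s n \<in> K) \<and> s \<longlonglongrightarrow> l"
    then have s: "\<forall>n. s n \<in> K" and l: "s \<longlonglongrightarrow> l" by auto
    have lc: "l \<in> closure D"
      using s l unfolding closure_sequential by (intro exI[of _ s]) (auto simp: K_def)
    have lD: "l \<in> D"
    proof (rule ccontr)
      assume "l \<notin> D"
      then have "l \<in> frontier D" using lc D by (simp add: frontier_def interior_open)
      then have "\<forall>\<^sub>F z in at l within D. norm (G z) \<le> M + e" using bd e by blast
      moreover have "filterlim s (at l within D) sequentially"
        using s l \<open>l \<notin> D\<close> by (auto simp: filterlim_at K_def intro!: always_eventually)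
      ultimately have "\<forall>\<^sub>F n in sequentially. norm (G (s n)) \<le> M + e"
        by (rule eventually_compose_filterlim)
      then obtain n where "norm (G (s n)) \<le> M + e"
        using eventually_happens trivial_limit_sequentially by blast
      moreover have "m \<le> norm (G (s n))" using s by (simp add: K_def)
      ultimately show False using e by linarith
    qed
    have "(\<lambda>n. norm (G (s n))) \<longlonglongrightarrow> norm (G l)"
    proof (rule tendsto_norm)
      show "(\<lambda>n. G (s n)) \<longlonglongrightarrow> G l"
        using continuous_on_tendsto_compose[OF cont l lD] s by (auto simp: K_def)
    qed
    then have "m \<le> norm (G l)"
      using s by (intro LIMSEQ_le_const) (auto simp: K_def)
    with lD show "l \<in> K" by (simp add: K_def)
  qed
  moreover have "bounded K" using D by (rule_tac bounded_subset[OF D(2)]) (auto simp: K_def)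
  ultimately have K: "compact K" by (simp add: compact_eq_bounded_closed)
  have contK: "continuous_on K (\<lambda>z. norm (G z))"
    using cont by (intro continuous_intros) (auto simp: K_def intro: continuous_on_subset)
  have "z0 \<in> K" using z0 by (simp add: K_def m_def)
  then obtain z1 where z1: "z1 \<in> K" "\<And>z. z \<in> K \<Longrightarrow> norm (G z) \<le> norm (G z1)"
    using continuous_attains_sup[OF K _ contK] by blast
  have max: "norm (G z) \<le> norm (G z1)" if "z \<in> D" for z
    using z1 that by (cases "z \<in> K") (auto simp: K_def)
  \<comment> \<open>a maximum point of largest real part contradicts the maximum modulus principle, without connectedness\<close>
  define L where "L = {z \<in> K. norm (G z) = norm (G z1)}"
  have "compact L"
  proof -
    have "closed (K \<inter> (\<lambda>z. norm (G z)) -` {norm (G z1)})"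
      using continuous_closed_preimage[OF contK compact_imp_closed[OF K] closed_singleton] .
    moreover have "L = K \<inter> (K \<inter> (\<lambda>z. norm (G z)) -` {norm (G z1)})" by (auto simp: L_def)
    ultimately show ?thesis using compact_Int_closed[OF K] by metis
  qed
  moreover have "z1 \<in> L" using z1 by (simp add: L_def)
  ultimately obtain z2 where z2: "z2 \<in> L" "\<And>z. z \<in> L \<Longrightarrow> Re z \<le> Re z2"
    using continuous_attains_sup[of L Re] continuous_on_Re[OF continuous_on_id, of L] by auto
  have z2D: "z2 \<in> D" "norm (G z2) = norm (G z1)" using z2 by (auto simp: L_def K_def)
  obtain r where r: "r > 0" "ball z2 r \<subseteq> D" using D z2D open_contains_ball by blast
  have "G constant_on ball z2 r"
  proof (rule maximum_modulus_principle[where U = "ball z2 r" and \<xi> = z2])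
    show "G holomorphic_on ball z2 r" using G r holomorphic_on_subset by blast
  qed (use r max z2D in auto)
  then have const: "G z = G z2" if "z \<in> ball z2 r" for z
    using that r unfolding constant_on_def by (metis centre_in_ball)
  define z3 where "z3 = z2 + of_real (r / 2)"
  have "z3 \<in> ball z2 r" using r by (simp add: z3_def dist_norm)
  then have "G z3 = G z2" "z3 \<in> D" using const[of z3] r(2) by blast+
  then have "z3 \<in> L" using z1(1) z2D by (simp add: L_def K_def)
  then show False using z2(2)[of z3] r by (simp add: z3_def)
qed

text \<open>The real part of \<open>F\<close> is the logarithm of the modulus of
  \<open>exp (F z)\<close>; \<open>e'\<close> is the slack before exponentiation that becomes
  \<open>e\<close> after it.\<close>

lemma Re_le_if_limsup_frontier_le:
  assumes D: "open D" "bounded D" and F: "F holomorphic_on D"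
    and bd: "\<And>\<xi> e. \<xi> \<in> frontier D \<Longrightarrow> e > 0 \<Longrightarrow> \<forall>\<^sub>F z in at \<xi> within D. Re (F z) \<le> M + e"
    and z0: "z0 \<in> D"
  shows "Re (F z0) \<le> M"
proof -
  have "norm (exp (F z0)) \<le> exp M"
  proof (rule norm_le_if_limsup_frontier_le[OF D, where G = "\<lambda>z. exp (F z)"])
    show "(\<lambda>z. exp (F z)) holomorphic_on D" using F by (intro holomorphic_intros)
    fix \<xi> and e :: real assume \<xi>: "\<xi> \<in> frontier D" and e: "e > 0"
    define e' where "e' = ln (exp M + e) - M"
    have pos: "exp M + e > 0" using e by (simp add: add_pos_pos)
    have "ln (exp M + e) > ln (exp M)" using e pos by (subst ln_less_cancel_iff) auto
    then have "e' > 0" by (simp add: e'_def)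
    from bd[OF \<xi> this] show "\<forall>\<^sub>F z in at \<xi> within D. norm (exp (F z)) \<le> exp M + e"
    proof eventually_elim
      case (elim z)
      then have "exp (Re (F z)) \<le> exp (ln (exp M + e))" by (simp add: e'_def)
      then show ?case using pos by simp
    qed
  qed fact
  then show ?thesis by simp
qed

section \<open>The arctangent as harmonic measure of a half circle\<close>

lemma Re_Arctan_nonneg:
  assumes "Re w > 0"
  shows "Re (Arctan w) \<ge> 0"
proof -
  define q where "q = (1 - \<i> * w) / (1 + \<i> * w)"
  have ne: "1 + \<i> * w \<noteq> 0" using assms by (auto simp: complex_eq_iff)
  have im: "Im q < 0"
  proof -
    have "Im ((1 - \<i> * w) * cnj (1 + \<i> * w)) = - 2 * Re w" by (simp add: algebra_simps)
    moreover have "q = (1 - \<i> * w) * cnj (1 + \<i> * w) / of_real ((norm (1 + \<i> * w))\<^sup>2)"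
      unfolding q_def by (subst complex_div_cnj) simp
    ultimately have "Im q = - 2 * Re w / (norm (1 + \<i> * w))\<^sup>2" by (simp only: Im_divide_of_real)
    then show ?thesis using assms ne by (simp add: divide_less_0_iff)
  qed
  have "Im (Ln q) < 0" using Im_Ln_pos_le[of q] Im_Ln_le_pi[of q] im by fastforce
  then show ?thesis by (simp add: Arctan_def q_def)
qed

text \<open>\<open>Arctan\<close> is \<open>\<i> / 2\<close> times \<open>Ln\<close> of a Moebius
  map, so its real part is \<open>- 1 / 2\<close> times an argument. The map takes the right half
  plane to the lower half plane and the unit half circle to the negative imaginary axis, where the
  argument is \<open>- pi / 2\<close>.\<close>

lemma Re_Arctan_unit_circle:
  assumes "Re w > 0" "norm w = 1"
  shows "Re (Arctan w) = pi / 4"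
proof -
  define q where "q = (1 - \<i> * w) / (1 + \<i> * w)"
  have ne: "1 + \<i> * w \<noteq> 0" using assms by (auto simp: complex_eq_iff)
  have q: "q = (1 - \<i> * w) * cnj (1 + \<i> * w) / of_real ((norm (1 + \<i> * w))\<^sup>2)"
    unfolding q_def by (subst complex_div_cnj) simp
  have "Im ((1 - \<i> * w) * cnj (1 + \<i> * w)) = - 2 * Re w" by (simp add: algebra_simps)
  then have im: "Im q = - 2 * Re w / (norm (1 + \<i> * w))\<^sup>2" using q by (simp only: Im_divide_of_real)
  have "Re ((1 - \<i> * w) * cnj (1 + \<i> * w)) = 1 - (norm w)\<^sup>2"
    by (simp add: algebra_simps cmod_power2, simp add: power2_eq_square)
  then have re: "Re q = 0" using q assms(2) by (simp only: Re_divide_of_real) simp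
  have im': "Im q < 0" using im assms ne by (simp add: divide_less_0_iff)
  have "q = of_real (- Im q) * (- \<i>)" using re by (simp add: complex_eq_iff)
  then have "Ln q = Ln (of_real (- Im q) * (- \<i>))" by simp
  also have "\<dots> = Ln (of_real (- Im q)) + Ln (- \<i>)"
    by (rule Ln_times_of_real) (use im' in auto)
  finally have "Im (Ln q) = Im (Ln (of_real (- Im q))) + Im (Ln (- \<i>))"
    by (metis plus_complex.simps(2))
  moreover have "Im (Ln (of_real (- Im q))) = 0" by (rule Im_Ln_of_real) (use im' in auto)
  ultimately have "Im (Ln q) = - (pi / 2)" by simp
  then show ?thesis by (simp add: Arctan_def q_def)
qed

lemma Arctan_scaled_tendsto: "((\<lambda>R. of_real R * Arctan (a / of_real R)) \<longlongrightarrow> a) at_top"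
proof (cases "a = 0")
  case False
  have "(Arctan has_field_derivative inverse (1 + 0\<^sup>2)) (at 0)" by (rule has_field_derivative_Arctan) auto
  then have "((\<lambda>h. Arctan h / h) \<longlongrightarrow> 1) (at 0)" by (simp add: has_field_derivative_iff)
  moreover have "filterlim (\<lambda>R. a / of_real R) (at 0) at_top"
  proof (rule filterlim_atI)
    show "((\<lambda>R. a / of_real R) \<longlongrightarrow> 0) at_top"
      by (intro tendsto_divide_0[OF tendsto_const] filterlim_of_real_at_infinity)
    show "\<forall>\<^sub>F R in at_top. a / of_real R \<noteq> 0" using eventually_gt_at_top[of 0] by eventually_elim (use False in auto)
  qed
  ultimately have "((\<lambda>R. Arctan (a / of_real R) / (a / of_real R)) \<longlongrightarrow> 1) at_top"
    by (rule filterlim_compose)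
  then have "((\<lambda>R. a * (Arctan (a / of_real R) / (a / of_real R))) \<longlongrightarrow> a * 1) at_top"
    by (intro tendsto_intros)
  then show ?thesis using False by (simp add: mult.commute)
qed auto

text \<open>
  Cut off where \<open>\<Phi>\<close> exceeds \<open>R\<close> in modulus. There \<open>Re (Arctan (\<Phi> / R))\<close> is the harmonic measure of
  a half circle, up to the factor \<open>pi / 4\<close>; it is of size \<open>1 / R\<close> at a fixed point.
\<close>

theorem Phragmen_Lindeloef:
  fixes G \<Phi> :: "complex \<Rightarrow> complex"
  assumes D: "open D" "bounded D" and G: "G holomorphic_on D" and P: "\<Phi> holomorphic_on D"
    and pos: "\<And>z. z \<in> D \<Longrightarrow> Re (\<Phi> z) > 0"
    and bd: "\<And>\<xi>. \<xi> \<in> frontier D \<Longrightarrow>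
      (\<forall>e>0. \<forall>\<^sub>F z in at \<xi> within D. norm (G z) \<le> 1 + e) \<or>
      (filterlim \<Phi> at_infinity (at \<xi> within D) \<and>
        (\<forall>e>0. \<forall>\<^sub>F z in at \<xi> within D. norm (G z) \<le> exp (e * norm (\<Phi> z))))"
    and z0: "z0 \<in> D"
  shows "norm (G z0) \<le> 1"
proof -
  \<comment> \<open>Compactness merges the conditions at the single frontier points into one
    estimate in terms of the size of \<Phi>. A violating sequence accumulates at a frontier point,
    because \<Phi> is unbounded along it; if the first alternative holds there,
    \<open>1 + e \<le> exp e\<close> contradicts the violation as soon as \<Phi> exceeds 1 in
    modulus.\<close>
  have far: "\<exists>R0. \<forall>z\<in>D. R0 \<le> norm (\<Phi> z) \<longrightarrow> norm (G z) \<le> exp (e * norm (\<Phi> z))" if e: "e > 0" for e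
  proof (rule ccontr)
    assume "\<not> ?thesis"
    then have "\<forall>n::nat. \<exists>z. z \<in> D \<and> real n \<le> norm (\<Phi> z) \<and> norm (G z) > exp (e * norm (\<Phi> z))"
      by (meson not_le)
    then obtain s where s: "\<And>n. s n \<in> D" "\<And>n. real n \<le> norm (\<Phi> (s n))"
      "\<And>n. norm (G (s n)) > exp (e * norm (\<Phi> (s n)))" by metis
    have "compact (closure D)" using D by (simp add: compact_closure)
    then obtain l r where l: "l \<in> closure D" "strict_mono r" "(s \<circ> r) \<longlonglongrightarrow> l"
      using s(1) closure_subset unfolding compact_def by (metis subsetD)
    have big: "filterlim (\<lambda>n. norm (\<Phi> (s (r n)))) at_top sequentially"
    proof (rule filterlim_at_top_mono[OF filterlim_real_sequentially])
      show "\<forall>\<^sub>F n in sequentially. real n \<le> norm (\<Phi> (s (r n)))"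
        using s(2) l(2) by (intro always_eventually allI) (meson of_nat_mono order_trans seq_suble)
    qed
    have "l \<notin> D"
    proof
      assume "l \<in> D"
      then have "(\<lambda>n. \<Phi> (s (r n))) \<longlonglongrightarrow> \<Phi> l"
        using continuous_on_tendsto_compose[OF holomorphic_on_imp_continuous_on[OF P], of "s \<circ> r" l] l s(1)
        by (auto simp: o_def)
      then have "(\<lambda>n. norm (\<Phi> (s (r n)))) \<longlonglongrightarrow> norm (\<Phi> l)" by (rule tendsto_norm)
      with big show False
        using not_tendsto_and_filterlim_at_infinity[of sequentially "\<lambda>n. norm (\<Phi> (s (r n)))"]
        by (auto intro: filterlim_at_top_imp_at_infinity)
    qed
    then have lf: "l \<in> frontier D" using l D by (simp add: frontier_def interior_open)
    have lim: "filterlim (s \<circ> r) (at l within D) sequentially"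
      using s l \<open>l \<notin> D\<close> by (auto simp: filterlim_at intro!: always_eventually)
    have "\<forall>\<^sub>F n in sequentially. norm (G ((s \<circ> r) n)) \<le> exp (e * norm (\<Phi> ((s \<circ> r) n)))"
      using bd[OF lf]
    proof
      assume *: "\<forall>e>0. \<forall>\<^sub>F z in at l within D. norm (G z) \<le> 1 + e"
      have "\<forall>\<^sub>F z in at l within D. norm (G z) \<le> 1 + e" using * e by blast
      then have "\<forall>\<^sub>F n in sequentially. norm (G ((s \<circ> r) n)) \<le> 1 + e"
        using lim by (rule eventually_compose_filterlim)
      moreover have "\<forall>\<^sub>F n in sequentially. norm (\<Phi> (s (r n))) \<ge> 1"
        using big by (simp add: filterlim_at_top)
      ultimately show ?thesis
      proof eventually_elim
        case (elim n)
        have "1 + e \<le> exp e" by (rule exp_ge_add_one_self)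
        also have "\<dots> \<le> exp (e * norm (\<Phi> (s (r n))))" using elim e by simp
        finally show ?case using elim by simp
      qed
    next
      assume "filterlim \<Phi> at_infinity (at l within D) \<and>
        (\<forall>e>0. \<forall>\<^sub>F z in at l within D. norm (G z) \<le> exp (e * norm (\<Phi> z)))"
      then have "\<forall>\<^sub>F z in at l within D. norm (G z) \<le> exp (e * norm (\<Phi> z))" using e by blast
      then show ?thesis using lim by (rule eventually_compose_filterlim)
    qed
    then obtain n where "norm (G ((s \<circ> r) n)) \<le> exp (e * norm (\<Phi> ((s \<circ> r) n)))"
      using eventually_happens trivial_limit_sequentially by blast
    then show False using s(3)[of "r n"] by simp
  qed
  have cP: "continuous_on D \<Phi>" and cG: "continuous_on D G"
    using P G by (auto intro: holomorphic_on_imp_continuous_on)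
  have est: "norm (G z0) \<le> exp (4 / pi * e * norm (\<Phi> z0))" if e: "e > 0" for e
  proof -
    obtain R0 where R0: "\<And>z. z \<in> D \<Longrightarrow> R0 \<le> norm (\<Phi> z) \<Longrightarrow> norm (G z) \<le> exp (e * norm (\<Phi> z))"
      using far[OF e] by blast
    have step: "norm (G z0) \<le> exp (Re (4 / pi * e * (R * Arctan (\<Phi> z0 / R))))"
      if R: "R \<ge> R0" "R > 0" "R > norm (\<Phi> z0)" for R
    proof -
      define E where "E = {z \<in> D. norm (\<Phi> z) < R}"
      \<comment> \<open>\<open>Re (Arctan w)\<close> is \<open>pi / 4\<close> where \<Phi> has
        modulus \<open>R\<close>, so this factor makes \<open>Re (A z)\<close> equal to
        \<open>e * R\<close> there, which is just what the estimate of \<open>G\<close>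
        requires.\<close>
      define A where "A z = complex_of_real (4 / pi * e * R) * Arctan (\<Phi> z / of_real R)" for z
      have A: "A holomorphic_on D"
      proof -
        have "(Arctan \<circ> (\<lambda>z. \<Phi> z / of_real R)) holomorphic_on D"
        proof (rule holomorphic_on_compose)
          show "(\<lambda>z. \<Phi> z / of_real R) holomorphic_on D" using P R by (intro holomorphic_intros) auto
          show "Arctan holomorphic_on (\<lambda>z. \<Phi> z / complex_of_real R) ` D"
            using pos R by (intro holomorphic_on_Arctan) force
        qed
        then show ?thesis unfolding A_def o_def by (intro holomorphic_intros)
      qed
      have Anon: "Re (A z) \<ge> 0" if "z \<in> D" for z
      proof -
        have "Re (Arctan (\<Phi> z / of_real R)) \<ge> 0"
          using pos[OF that] R by (intro Re_Arctan_nonneg) simp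
        then show ?thesis unfolding A_def using e R by simp
      qed
      have "openin (top_of_set D) (D \<inter> (\<lambda>z. norm (\<Phi> z)) -` {..<R})"
        by (rule continuous_openin_preimage_gen) (auto intro: continuous_intros cP)
      moreover have "E = D \<inter> (\<lambda>z. norm (\<Phi> z)) -` {..<R}" by (auto simp: E_def)
      ultimately have E: "open E" using D openin_open_trans by metis
      have "bounded E" using D(2) by (rule bounded_subset) (auto simp: E_def)
      have "norm (G z0 * exp (- A z0)) \<le> 1"
      proof (rule norm_le_if_limsup_frontier_le[OF E \<open>bounded E\<close>, where G = "\<lambda>z. G z * exp (- A z)"])
        show "(\<lambda>z. G z * exp (- A z)) holomorphic_on E"
          using G A by (intro holomorphic_intros) (auto simp: E_def intro: holomorphic_on_subset)
        show "z0 \<in> E" using z0 R by (simp add: E_def)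
        fix \<xi> and \<delta> :: real assume \<xi>: "\<xi> \<in> frontier E" and \<delta>: "\<delta> > 0"
        have \<xi>E: "\<xi> \<notin> E" "\<xi> \<in> closure E" using \<xi> E by (auto simp: frontier_def interior_open)
        have ED: "E \<subseteq> D" by (auto simp: E_def)
        show "\<forall>\<^sub>F z in at \<xi> within E. norm (G z * exp (- A z)) \<le> 1 + \<delta>"
        proof (cases "\<xi> \<in> D")
          case True
          have "isCont (\<lambda>z. norm (\<Phi> z)) \<xi>" using cP D True
            by (intro continuous_intros) (auto simp: continuous_on_eq_continuous_at)
          then have l1: "((\<lambda>z. norm (\<Phi> z)) \<longlongrightarrow> norm (\<Phi> \<xi>)) (at \<xi> within E)"
            unfolding isCont_def by (rule tendsto_within_subset) auto
          have nb: "at \<xi> within E \<noteq> bot" using \<xi>E by (auto simp: trivial_limit_within closure_def)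
          have "norm (\<Phi> \<xi>) \<le> R"
            by (rule tendsto_upperbound[OF l1 _ nb])
              (auto simp: eventually_at_filter E_def)
          then have PR: "norm (\<Phi> \<xi>) = R" using \<xi>E True by (auto simp: E_def)
          have "Re (Arctan (\<Phi> \<xi> / of_real R)) = pi / 4"
            using pos[OF True] R PR by (intro Re_Arctan_unit_circle) (auto simp: norm_divide)
          moreover have "Re (A \<xi>) = 4 / pi * e * R * Re (Arctan (\<Phi> \<xi> / of_real R))"
            unfolding A_def by simp
          ultimately have ReA: "Re (A \<xi>) = e * R" by (simp only:) simp
          have "norm (G \<xi>) \<le> exp (e * R)" using R0[OF True] PR R by simp
          moreover have "norm (G \<xi> * exp (- A \<xi>)) = norm (G \<xi>) / exp (e * R)"
            by (simp add: norm_mult exp_minus norm_inverse divide_inverse ReA)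
          ultimately have le1: "norm (G \<xi> * exp (- A \<xi>)) \<le> 1" by simp
          have "isCont (\<lambda>z. G z * exp (- A z)) \<xi>"
          proof -
            have "isCont G \<xi>" "isCont A \<xi>"
              using cG holomorphic_on_imp_continuous_on[OF A] D(1) True continuous_on_eq_continuous_at by blast+
            then show ?thesis by (intro continuous_intros)
          qed
          then have "((\<lambda>z. norm (G z * exp (- A z))) \<longlongrightarrow> norm (G \<xi> * exp (- A \<xi>))) (at \<xi> within E)"
            unfolding isCont_def by (intro tendsto_norm) (rule tendsto_within_subset, auto)
          then have "\<forall>\<^sub>F z in at \<xi> within E. norm (G z * exp (- A z)) < 1 + \<delta>"
            by (rule order_tendstoD(2)) (use \<delta> le1 in linarith)
          then show ?thesis by eventually_elim simp
        next
          case False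
          have "\<xi> \<in> frontier D"
            using \<xi>E False closure_mono[OF ED] D by (auto simp: frontier_def interior_open)
          from bd[OF this] have "\<forall>\<^sub>F z in at \<xi> within E. norm (G z) \<le> 1 + \<delta>"
          proof
            assume "\<forall>e>0. \<forall>\<^sub>F z in at \<xi> within D. norm (G z) \<le> 1 + e"
            then have "\<forall>\<^sub>F z in at \<xi> within D. norm (G z) \<le> 1 + \<delta>" using \<delta> by blast
            then show ?thesis by (rule filter_leD[OF at_le[OF ED]])
          next
            \<comment> \<open>Near such a point \<Phi> is at least \<open>R\<close> in modulus, so
              no point of \<open>E\<close> is close to it and the claim holds vacuously.\<close>
            assume "filterlim \<Phi> at_infinity (at \<xi> within D) \<and>
              (\<forall>e>0. \<forall>\<^sub>F z in at \<xi> within D. norm (G z) \<le> exp (e * norm (\<Phi> z)))"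
            then have "\<forall>\<^sub>F z in at \<xi> within D. R \<le> norm (\<Phi> z)"
              using R by (auto simp: filterlim_at_infinity[OF order_refl])
            then have "\<forall>\<^sub>F z in at \<xi> within E. R \<le> norm (\<Phi> z)"
              by (rule filter_leD[OF at_le[OF ED]])
            moreover have "\<forall>\<^sub>F z in at \<xi> within E. z \<in> E" by (simp add: eventually_at_filter)
            ultimately show ?thesis by eventually_elim (auto simp: E_def)
          qed
          moreover have "\<forall>\<^sub>F z in at \<xi> within E. z \<in> E" by (simp add: eventually_at_filter)
          ultimately show ?thesis
          proof eventually_elim
            case (elim z)
            have "exp (- Re (A z)) \<le> 1" using Anon elim ED by force
            then show ?case
              using mult_mono[of "norm (G z)" "1 + \<delta>" "exp (- Re (A z))" 1] elim \<delta> by (simp add: norm_mult)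
          qed
        qed
      qed
      then have "norm (G z0) / exp (Re (A z0)) \<le> 1"
        by (simp add: norm_mult exp_minus norm_inverse divide_inverse)
      then have "norm (G z0) \<le> exp (Re (A z0))" by simp
      also have "A z0 = 4 / pi * e * (R * Arctan (\<Phi> z0 / R))" by (simp add: A_def)
      finally show ?thesis .
    qed
    \<comment> \<open>As \<open>R\<close> grows, the barrier at the fixed point \<open>z0\<close>
      tends to a multiple of \<open>e * \<Phi> z0\<close>, and this vanishes with \<open>e\<close>
      afterwards.\<close>
    have "((\<lambda>R::real. exp (Re (4 / pi * e * (R * Arctan (\<Phi> z0 / R))))) \<longlongrightarrow> exp (Re (4 / pi * e * \<Phi> z0))) at_top"
      by (intro tendsto_intros Arctan_scaled_tendsto)
    then have "norm (G z0) \<le> exp (Re (4 / pi * e * \<Phi> z0))"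
    proof (rule tendsto_lowerbound)
      show "\<forall>\<^sub>F R in at_top. norm (G z0) \<le> exp (Re (4 / pi * e * (complex_of_real R * Arctan (\<Phi> z0 / R))))"
        using eventually_ge_at_top[of R0] eventually_gt_at_top[of 0] eventually_gt_at_top[of "norm (\<Phi> z0)"]
        by eventually_elim (rule step)
    qed simp
    also have "\<dots> \<le> exp (4 / pi * e * norm (\<Phi> z0))"
      using e complex_Re_le_cmod[of "\<Phi> z0"] by (simp add: divide_right_mono)
    finally show ?thesis .
  qed
  have "((\<lambda>e. exp (4 / pi * e * norm (\<Phi> z0))) \<longlongrightarrow> exp (4 / pi * 0 * norm (\<Phi> z0))) (at_right 0)"
    by (intro tendsto_intros)
  then have "norm (G z0) \<le> exp (4 / pi * 0 * norm (\<Phi> z0))"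
  proof (rule tendsto_lowerbound)
    show "\<forall>\<^sub>F e in at_right 0. norm (G z0) \<le> exp (4 / pi * e * norm (\<Phi> z0))"
      using eventually_at_right_less[of 0] by eventually_elim (rule est)
  qed simp
  then show ?thesis by simp
qed

subsection \<open>Harnack estimates and bounds over a complementary interval\<close>

abbreviation upper :: "complex set" where "upper \<equiv> {z. 0 < Im z}"

lemma open_upper: "open upper"
  by (simp add: open_halfspace_Im_gt)

text \<open>\<open>q\<close> is \<open>F\<close> followed by the Moebius map of the right half plane
  to the disc that sends \<open>F z0\<close> to 0, so Schwarz's lemma applies to it. The derivative
  bound involves only the real part at the centre; this is how \<open>u\<close> alone comes to
  control \<open>f'\<close>.\<close>

lemma Schwarz_half_plane:
  assumes F: "F holomorphic_on ball z0 R" and R: "R > 0"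
    and pos: "\<And>z. z \<in> ball z0 R \<Longrightarrow> Re (F z) > 0"
  shows "z \<in> ball z0 R \<Longrightarrow> norm (F z - F z0) \<le> dist z0 z / R * norm (F z + cnj (F z0))"
    and "norm (deriv F z0) \<le> 2 * Re (F z0) / R"
proof -
  define q where "q \<zeta> = (F (z0 + of_real R * \<zeta>) - F z0) / (F (z0 + of_real R * \<zeta>) + cnj (F z0))" for \<zeta>
  have inb: "z0 + of_real R * \<zeta> \<in> ball z0 R" if "norm \<zeta> < 1" for \<zeta>
    using that R by (simp add: dist_norm norm_mult)
  have z0: "Re (F z0) > 0" using pos R by simp
  have ne: "F (z0 + of_real R * \<zeta>) + cnj (F z0) \<noteq> 0" if "norm \<zeta> < 1" for \<zeta>
    using pos[OF inb[OF that]] z0 by (auto simp: complex_eq_iff)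
  have Fh: "(\<lambda>\<zeta>. F (z0 + of_real R * \<zeta>)) holomorphic_on ball 0 1"
  proof -
    have "(F \<circ> (\<lambda>\<zeta>. z0 + of_real R * \<zeta>)) holomorphic_on ball 0 1"
    proof (rule holomorphic_on_compose)
      show "(\<lambda>\<zeta>. z0 + of_real R * \<zeta>) holomorphic_on ball 0 1" by (intro holomorphic_intros)
      show "F holomorphic_on (\<lambda>\<zeta>. z0 + of_real R * \<zeta>) ` ball 0 1"
        by (rule holomorphic_on_subset[OF F]) (use inb in auto)
    qed
    then show ?thesis by (simp add: o_def)
  qed
  have qh: "q holomorphic_on ball 0 1"
    unfolding q_def using ne by (intro holomorphic_intros Fh) auto
  have q0: "q 0 = 0" by (simp add: q_def)
  have q1: "norm (q \<zeta>) < 1" if "norm \<zeta> < 1" for \<zeta>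
  proof -
    define A where "A = F (z0 + of_real R * \<zeta>)"
    have A: "Re A > 0" using pos[OF inb[OF that]] by (simp add: A_def)
    have "(norm (A - F z0))\<^sup>2 < (norm (A + cnj (F z0)))\<^sup>2"
      using A z0 unfolding cmod_power2 by (simp add: power2_eq_square algebra_simps)
    then have "norm (A - F z0) < norm (A + cnj (F z0))" by (rule power2_less_imp_less) simp
    then show ?thesis using ne[OF that] by (simp add: q_def A_def norm_divide)
  qed
  note S = Schwarz_Lemma[OF qh q0 q1]
  show "norm (F z - F z0) \<le> dist z0 z / R * norm (F z + cnj (F z0))" if z: "z \<in> ball z0 R"
  proof -
    define \<zeta> where "\<zeta> = (z - z0) / of_real R"
    have \<zeta>: "z0 + of_real R * \<zeta> = z" "norm \<zeta> = dist z0 z / R"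
      using R by (auto simp: \<zeta>_def norm_divide dist_norm norm_minus_commute)
    have \<zeta>1: "norm \<zeta> < 1" using z R \<zeta> by simp
    have "norm (q \<zeta>) \<le> norm \<zeta>" using S(1)[OF _ \<zeta>1] by blast
    then show ?thesis using ne[OF \<zeta>1] by (simp add: q_def \<zeta> norm_divide divide_le_eq)
  qed
  have "norm (deriv q 0) \<le> 1" using S(2)[of 0] by simp
  moreover have "(q has_field_derivative of_real R * deriv F z0 / (2 * of_real (Re (F z0)))) (at 0)"
  proof -
    have "(F has_field_derivative deriv F z0) (at (z0 + of_real R * 0))"
      using F R by (simp add: holomorphic_derivI[of _ "ball z0 R"])
    then have dF: "((\<lambda>\<zeta>. F (z0 + of_real R * \<zeta>)) has_field_derivative deriv F z0 * of_real R) (at 0)"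
      by (rule DERIV_chain2) (auto intro!: derivative_eq_intros)
    have "F z0 + cnj (F z0) = 2 * of_real (Re (F z0))" by (simp add: complex_add_cnj)
    then show ?thesis
      unfolding q_def using z0
      by (intro DERIV_cong[OF DERIV_divide[OF DERIV_diff[OF dF DERIV_const] DERIV_add[OF dF DERIV_const]]]) auto
  qed
  then have "deriv q 0 = of_real R * deriv F z0 / (2 * of_real (Re (F z0)))" by (rule DERIV_imp_deriv)
  ultimately show "norm (deriv F z0) \<le> 2 * Re (F z0) / R"
    using R z0 by (simp add: norm_mult norm_divide field_simps)
qed

lemma Harnack:
  assumes F: "F holomorphic_on ball z0 R" and R: "R > 0"
    and pos: "\<And>z. z \<in> ball z0 R \<Longrightarrow> Re (F z) > 0"
    and z: "z \<in> ball z0 R"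
  shows "Re (F z) * (R - dist z0 z) \<le> Re (F z0) * (R + dist z0 z)"
proof -
  define t where "t = dist z0 z / R"
  have t: "0 \<le> t" "t < 1" using z R by (auto simp: t_def)
  define X x Y where "X = Re (F z)" and "x = Re (F z0)" and "Y = Im (F z) - Im (F z0)"
  have pos': "X > 0" "x > 0" using pos z R by (auto simp: X_def x_def)
  have "norm (F z - F z0) \<le> t * norm (F z + cnj (F z0))"
    using Schwarz_half_plane(1)[OF F R pos z] by (simp add: t_def)
  then have "(norm (F z - F z0))\<^sup>2 \<le> (t * norm (F z + cnj (F z0)))\<^sup>2"
    by (rule power_mono) simp
  then have *: "(X - x)\<^sup>2 + Y\<^sup>2 \<le> t\<^sup>2 * ((X + x)\<^sup>2 + Y\<^sup>2)"
    unfolding power_mult_distrib cmod_power2 by (simp add: X_def x_def Y_def)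
  have "t\<^sup>2 \<le> 1" using t by (simp add: power_le_one)
  then have "t\<^sup>2 * Y\<^sup>2 \<le> Y\<^sup>2" using mult_right_mono[of "t\<^sup>2" 1 "Y\<^sup>2"] by simp
  then have "(X - x)\<^sup>2 \<le> (t * (X + x))\<^sup>2"
    using * distrib_left[of "t\<^sup>2" "(X + x)\<^sup>2" "Y\<^sup>2"] unfolding power_mult_distrib by linarith
  then have "X - x \<le> t * (X + x)"
    by (rule power2_le_imp_le) (use t pos' in simp)
  then have "X * (1 - t) \<le> x * (1 + t)" by (simp add: algebra_simps)
  then have "R * (X * (1 - t)) \<le> R * (x * (1 + t))" using R by simp
  then show ?thesis using R by (simp add: X_def x_def t_def algebra_simps)
qed

text \<open>Adding \<open>2 * M\<close> makes the real part strictly positive and at most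
  \<open>3 * M\<close>, whence the constant 6.\<close>

lemma norm_deriv_le_of_Re_bounded:
  assumes F: "F holomorphic_on ball z0 R" and R: "R > 0" and M: "M > 0"
    and b: "\<And>z. z \<in> ball z0 R \<Longrightarrow> \<bar>Re (F z)\<bar> \<le> M"
  shows "norm (deriv F z0) \<le> 6 * M / R"
proof -
  let ?G = "\<lambda>z. F z + of_real (2 * M)"
  have "norm (deriv ?G z0) \<le> 2 * Re (?G z0) / R"
  proof (rule Schwarz_half_plane(2)[OF _ R])
    show "?G holomorphic_on ball z0 R" using F by (intro holomorphic_intros)
    show "Re (F z + of_real (2 * M)) > 0" if "z \<in> ball z0 R" for z
      using b[OF that] M by (simp add: abs_le_iff)
  qed
  moreover have "deriv ?G z0 = deriv F z0"
    by (rule DERIV_imp_deriv) (use F R in \<open>auto intro!: derivative_eq_intros holomorphic_derivI\<close>)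
  moreover have "2 * Re (?G z0) / R \<le> 6 * M / R"
    using b[of z0] R by (intro divide_right_mono) (auto simp: abs_le_iff)
  ultimately show ?thesis by simp
qed

section \<open>Corner conditions and boxes over complementary intervals\<close>

lemma eventually_norm_le_of_isCont:
  assumes "isCont G \<xi>" "norm (G \<xi>) \<le> M" "e > 0"
  shows "\<forall>\<^sub>F z in at \<xi> within D. norm (G z) \<le> M + e"
proof -
  have "((\<lambda>z. norm (G z)) \<longlongrightarrow> norm (G \<xi>)) (at \<xi> within D)"
    using assms(1) unfolding isCont_def by (intro tendsto_norm) (rule tendsto_within_subset, auto)
  then have "\<forall>\<^sub>F z in at \<xi> within D. norm (G z) < M + e"
    by (rule order_tendstoD(2)) (use assms in linarith)
  then show ?thesis by eventually_elim simp
qed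

text \<open>The exponent 2 is critical for the right angle at the corner. The condition is one sided
  because in case (a) nothing else is available at first.\<close>

definition right_corner :: "(complex \<Rightarrow> real) \<Rightarrow> real \<Rightarrow> bool" where
  "right_corner U a \<longleftrightarrow> (\<forall>e>0. \<forall>\<^sub>F z in at (of_real a) within {z. a < Re z \<and> 0 < Im z}.
     U z \<le> e / (norm (z - of_real a))\<^sup>2)"

definition left_corner :: "(complex \<Rightarrow> real) \<Rightarrow> real \<Rightarrow> bool" where
  "left_corner U a \<longleftrightarrow> (\<forall>e>0. \<forall>\<^sub>F z in at (of_real a) within {z. Re z < a \<and> 0 < Im z}.
     U z \<le> e / (norm (z - of_real a))\<^sup>2)"

text \<open>Up to sign this is the horizontal derivative of the Poisson kernel: positive in the
  first quadrant, negative in the second, zero on the axes away from the origin.\<close>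

lemma Re_ii_div_square: "Re (\<i> / w\<^sup>2) = 2 * Re w * Im w / (norm w)^4"
proof -
  have "\<i> / w\<^sup>2 = \<i> * cnj (w\<^sup>2) / of_real ((norm (w\<^sup>2))\<^sup>2)"
    by (subst complex_div_cnj) simp
  then have "Re (\<i> / w\<^sup>2) = Re (\<i> * cnj (w\<^sup>2)) / (norm (w\<^sup>2))\<^sup>2" by (simp only: Re_divide_of_real)
  also have "Re (\<i> * cnj (w\<^sup>2)) = 2 * Re w * Im w" by (simp add: power2_eq_square)
  also have "(norm (w\<^sup>2))\<^sup>2 = (norm w)^4" by (simp add: norm_power flip: power_mult)
  finally show ?thesis .
qed

text \<open>Close to \<open>c\<close> the distance to \<open>d\<close> is at least
  \<open>sqrt 2\<close> times the distance to \<open>c\<close>, so the second term cancels at most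
  half of the first.\<close>

lemma dipole_at_pole:
  fixes c d :: complex
  assumes "c \<noteq> d"
  shows "\<forall>\<^sub>F z in at c within D. norm (\<i> / (z - c)\<^sup>2 - \<i> / (z - d)\<^sup>2) \<ge> 1 / 2 / (norm (z - c))\<^sup>2"
    and "filterlim (\<lambda>z. \<i> / (z - c)\<^sup>2 - \<i> / (z - d)\<^sup>2) at_infinity (at c within D)"
proof -
  have l: "((\<lambda>z. z - d) \<longlongrightarrow> c - d) (at c within D)" "((\<lambda>z. z - c) \<longlongrightarrow> c - c) (at c within D)"
    by (intro tendsto_intros)+
  have "((\<lambda>z. 2 * (norm (z - c))\<^sup>2 - (norm (z - d))\<^sup>2) \<longlongrightarrow> 2 * (norm (c - c))\<^sup>2 - (norm (c - d))\<^sup>2) (at c within D)"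
    by (intro tendsto_intros l)
  moreover have "2 * (norm (c - c))\<^sup>2 - (norm (c - d))\<^sup>2 < 0" using assms by simp
  ultimately have "\<forall>\<^sub>F z in at c within D. 2 * (norm (z - c))\<^sup>2 - (norm (z - d))\<^sup>2 < 0"
    by (rule order_tendstoD(2))
  moreover have "\<forall>\<^sub>F z in at c within D. z \<noteq> c" by (simp add: eventually_at_filter)
  ultimately show ev: "\<forall>\<^sub>F z in at c within D. norm (\<i> / (z - c)\<^sup>2 - \<i> / (z - d)\<^sup>2) \<ge> 1 / 2 / (norm (z - c))\<^sup>2"
  proof eventually_elim
    case (elim z)
    then have p: "(norm (z - c))\<^sup>2 > 0" "2 * (norm (z - c))\<^sup>2 \<le> (norm (z - d))\<^sup>2" by auto
    then have "0 < (norm (z - d))\<^sup>2" by linarith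
    then have "1 / (norm (z - d))\<^sup>2 \<le> 1 / (2 * (norm (z - c))\<^sup>2)"
      using p by (intro divide_left_mono mult_pos_pos) linarith+
    moreover have "norm (\<i> / (z - c)\<^sup>2) - norm (\<i> / (z - d)\<^sup>2) \<le> norm (\<i> / (z - c)\<^sup>2 - \<i> / (z - d)\<^sup>2)"
      by (rule norm_triangle_ineq2)
    ultimately show ?case by (simp add: norm_divide norm_power field_simps)
  qed
  have "filterlim (\<lambda>z. 1 / 2 / (norm (z - c))\<^sup>2) at_top (at c within D)"
  proof -
    have "filterlim (\<lambda>z. inverse ((norm (z - c))\<^sup>2)) at_top (at c within D)"
    proof (rule filterlim_inverse_at_top)
      show "((\<lambda>z. (norm (z - c))\<^sup>2) \<longlongrightarrow> 0) (at c within D)"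
        using tendsto_power[OF tendsto_norm[OF l(2)], of 2] by simp
      show "\<forall>\<^sub>F z in at c within D. 0 < (norm (z - c))\<^sup>2" by (simp add: eventually_at_filter)
    qed
    moreover have "(0::real) < 1 / 2" by simp
    ultimately have "filterlim (\<lambda>z. 1 / 2 * inverse ((norm (z - c))\<^sup>2)) at_top (at c within D)"
      using filterlim_tendsto_pos_mult_at_top[OF tendsto_const] by blast
    then show ?thesis by (simp only: divide_inverse[of "1 / 2 :: real"])
  qed
  then have "filterlim (\<lambda>z. norm (\<i> / (z - c)\<^sup>2 - \<i> / (z - d)\<^sup>2)) at_top (at c within D)"
    using ev by (rule filterlim_at_top_mono)
  then show "filterlim (\<lambda>z. \<i> / (z - c)\<^sup>2 - \<i> / (z - d)\<^sup>2) at_infinity (at c within D)"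
    by (rule filterlim_norm_at_top_imp_at_infinity)
qed

text \<open>The Phragmen-Lindeloef principle for \<open>exp\<close> of
  \<open>Re F - \<epsilon> - C * y / s\<close>: the linear term takes care of the top edge, and the
  other edges are controlled by \<epsilon>. \<open>P\<close> is the difference of the dipoles at the
  two lower corners; its real part is positive because the box lies to the right of \<open>a\<close>
  and to the left of \<open>b\<close>.\<close>

lemma gap_box_bound:
  assumes F: "F holomorphic_on upper" and ab: "a < b" and s: "s > 0" and eps: "\<epsilon> \<ge> 0"
    and sides: "\<And>y. 0 < y \<Longrightarrow> y \<le> s \<Longrightarrow> Re (F (Complex a y)) \<le> \<epsilon>"
      "\<And>y. 0 < y \<Longrightarrow> y \<le> s \<Longrightarrow> Re (F (Complex b y)) \<le> \<epsilon>"
    and bottom: "\<And>x e. a < x \<Longrightarrow> x < b \<Longrightarrow> e > 0 \<Longrightarrow> \<forall>\<^sub>F z in at (of_real x) within upper. Re (F z) \<le> \<epsilon> + e"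
    and top: "\<And>x. a \<le> x \<Longrightarrow> x \<le> b \<Longrightarrow> Re (F (Complex x s)) \<le> C" and C: "C \<ge> 0"
    and corners: "right_corner (\<lambda>z. Re (F z)) a" "left_corner (\<lambda>z. Re (F z)) b"
    and xy: "a < x" "x < b" "0 < y" "y < s"
  shows "Re (F (Complex x y)) \<le> \<epsilon> + C * y / s"
proof -
  define D where "D = {z. a < Re z \<and> Re z < b \<and> 0 < Im z \<and> Im z < s}"
  define G where "G z = exp (F z + \<i> * of_real (C / s) * z - of_real \<epsilon>)" for z
  define P where "P z = \<i> / (z - of_real a)\<^sup>2 - \<i> / (z - of_real b)\<^sup>2" for z :: complex
  have DU: "D \<subseteq> upper" by (auto simp: D_def)
  have "D = box (Complex a 0) (Complex b s)" by (auto simp: D_def in_box_complex_iff)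
  then have D: "open D" "bounded D" and cl: "closure D \<subseteq> cbox (Complex a 0) (Complex b s)"
    using closure_minimal[OF box_subset_cbox closed_cbox] by auto
  have normG: "norm (G z) = exp (Re (F z) - C * Im z / s - \<epsilon>)" for z
    by (simp add: G_def)
  have Gh: "G holomorphic_on upper" unfolding G_def using F by (intro holomorphic_intros)
  have "norm (G (Complex x y)) \<le> 1"
  proof (rule Phragmen_Lindeloef[OF D, where G = G and \<Phi> = P])
    show "G holomorphic_on D" using Gh DU by (rule holomorphic_on_subset)
    show "P holomorphic_on D" unfolding P_def by (intro holomorphic_intros) (auto simp: D_def)
    show "Complex x y \<in> D" using xy by (simp add: D_def)
    show "Re (P z) > 0" if z: "z \<in> D" for z
    proof -
      have "Re (\<i> / (z - of_real a)\<^sup>2) > 0" unfolding Re_ii_div_square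
        using z by (intro divide_pos_pos mult_pos_pos) (auto simp: D_def)
      moreover have "Re (\<i> / (z - of_real b)\<^sup>2) < 0" unfolding Re_ii_div_square
        using z by (intro divide_neg_pos mult_neg_pos mult_pos_neg) (auto simp: D_def)
      ultimately show ?thesis by (simp add: P_def)
    qed
    fix \<xi> assume \<xi>: "\<xi> \<in> frontier D"
    then have \<xi>D: "\<xi> \<notin> D" "a \<le> Re \<xi>" "Re \<xi> \<le> b" "0 \<le> Im \<xi>" "Im \<xi> \<le> s"
      using D cl by (auto simp: frontier_def interior_open in_cbox_complex_iff)
    let ?A = "\<forall>e>0. \<forall>\<^sub>F z in at \<xi> within D. norm (G z) \<le> 1 + e"
    let ?B = "filterlim P at_infinity (at \<xi> within D) \<and>
        (\<forall>e>0. \<forall>\<^sub>F z in at \<xi> within D. norm (G z) \<le> exp (e * norm (P z)))"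
    have evD: "\<forall>\<^sub>F z in at \<xi> within D. z \<in> D" by (simp add: eventually_at_filter)
    consider "Im \<xi> > 0" | "\<xi> = of_real a" | "\<xi> = of_real b" | "Im \<xi> = 0" "a < Re \<xi>" "Re \<xi> < b"
      using \<xi>D by (cases "Im \<xi> = 0"; cases "Re \<xi> = a"; cases "Re \<xi> = b") (auto simp: complex_eq_iff)
    then show "?A \<or> ?B"
    proof cases
      case 1
      then have "isCont G \<xi>" using Gh open_upper
        by (metis (no_types, lifting) continuous_on_eq_continuous_at holomorphic_on_imp_continuous_on mem_Collect_eq)
      moreover have "norm (G \<xi>) \<le> 1"
      proof -
        have \<xi>eq: "\<xi> = Complex (Re \<xi>) (Im \<xi>)" by simp
        have "C * Im \<xi> / s \<ge> 0" using C 1 s by simp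
        moreover consider "Re \<xi> = a" | "Re \<xi> = b" | "Im \<xi> = s" using \<xi>D 1 by (auto simp: D_def)
        then have "Re (F \<xi>) \<le> \<epsilon> + C * Im \<xi> / s"
        proof cases
          case 1 with sides(1)[of "Im \<xi>"] \<xi>eq \<xi>D \<open>Im \<xi> > 0\<close> \<open>C * Im \<xi> / s \<ge> 0\<close> show ?thesis by simp
        next
          case 2 with sides(2)[of "Im \<xi>"] \<xi>eq \<xi>D \<open>Im \<xi> > 0\<close> \<open>C * Im \<xi> / s \<ge> 0\<close> show ?thesis by simp
        next
          case 3 with top[of "Re \<xi>"] \<xi>eq \<xi>D s eps show ?thesis by simp
        qed
        then show ?thesis by (simp add: normG)
      qed
      ultimately show ?thesis using eventually_norm_le_of_isCont by blast
    next
      case 2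
      have "\<forall>\<^sub>F z in at \<xi> within D. norm (G z) \<le> exp (e * norm (P z))" if e: "e > 0" for e
      proof -
        have "\<forall>\<^sub>F z in at (of_real a) within {z. a < Re z \<and> 0 < Im z}. Re (F z) \<le> (e / 2) / (norm (z - of_real a))\<^sup>2"
          using corners(1) half_gt_zero[OF e] unfolding right_corner_def by blast
        then have "\<forall>\<^sub>F z in at \<xi> within D. Re (F z) \<le> (e / 2) / (norm (z - of_real a))\<^sup>2"
          unfolding 2 by (rule filter_leD[OF at_le, rotated]) (auto simp: D_def)
        moreover have "\<forall>\<^sub>F z in at \<xi> within D. norm (P z) \<ge> 1 / 2 / (norm (z - of_real a))\<^sup>2"
          unfolding P_def using dipole_at_pole(1)[of "of_real a" "of_real b"] ab 2 by simp
        ultimately show ?thesis using evD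
        proof eventually_elim
          case (elim z)
          have "(e / 2) / (norm (z - of_real a))\<^sup>2 \<le> e * norm (P z)"
            using mult_left_mono[OF elim(2), of e] e by simp
          moreover have "C * Im z / s \<ge> 0" using C s elim by (simp add: D_def)
          ultimately show ?case using elim eps by (simp add: normG)
        qed
      qed
      moreover have "filterlim P at_infinity (at \<xi> within D)"
        unfolding P_def using dipole_at_pole(2)[of "of_real a" "of_real b"] ab 2 by simp
      ultimately show ?thesis by blast
    next
      case 3
      have "\<forall>\<^sub>F z in at \<xi> within D. norm (G z) \<le> exp (e * norm (P z))" if e: "e > 0" for e
      proof -
        have "\<forall>\<^sub>F z in at (of_real b) within {z. Re z < b \<and> 0 < Im z}. Re (F z) \<le> (e / 2) / (norm (z - of_real b))\<^sup>2"
          using corners(2) half_gt_zero[OF e] unfolding left_corner_def by blast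
        then have "\<forall>\<^sub>F z in at \<xi> within D. Re (F z) \<le> (e / 2) / (norm (z - of_real b))\<^sup>2"
          unfolding 3 by (rule filter_leD[OF at_le, rotated]) (auto simp: D_def)
        moreover have "\<forall>\<^sub>F z in at \<xi> within D. norm (P z) \<ge> 1 / 2 / (norm (z - of_real b))\<^sup>2"
          unfolding P_def using dipole_at_pole(1)[of "of_real b" "of_real a"] ab 3
          by (simp add: norm_minus_commute)
        ultimately show ?thesis using evD
        proof eventually_elim
          case (elim z)
          have "(e / 2) / (norm (z - of_real b))\<^sup>2 \<le> e * norm (P z)"
            using mult_left_mono[OF elim(2), of e] e by simp
          moreover have "C * Im z / s \<ge> 0" using C s elim by (simp add: D_def)
          ultimately show ?case using elim eps by (simp add: normG)
        qed
      qed
      moreover have "filterlim P at_infinity (at \<xi> within D)"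
      proof -
        have "filterlim (\<lambda>z. norm (\<i> / (z - of_real b)\<^sup>2 - \<i> / (z - of_real a)\<^sup>2)) at_top (at (of_real b) within D)"
          using dipole_at_pole(2)[of "of_real b" "of_real a"] ab
          by (intro filterlim_at_infinity_imp_norm_at_top) auto
        then have "filterlim (\<lambda>z. norm (P z)) at_top (at \<xi> within D)"
          unfolding 3 P_def by (simp add: norm_minus_commute)
        then show ?thesis by (rule filterlim_norm_at_top_imp_at_infinity)
      qed
      ultimately show ?thesis by blast
    next
      case 4
      have "?A"
      proof (intro allI impI)
        fix e :: real assume e: "e > 0"
        define e' where "e' = ln (1 + e)"
        have "e' > 0" using e by (simp add: e'_def)
        then have "\<forall>\<^sub>F z in at (of_real (Re \<xi>)) within upper. Re (F z) \<le> \<epsilon> + e'" using bottom 4 by blast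
        moreover have "\<xi> = of_real (Re \<xi>)" using 4 by (simp add: complex_eq_iff)
        ultimately have "\<forall>\<^sub>F z in at \<xi> within upper. Re (F z) \<le> \<epsilon> + e'" by simp
        then have "\<forall>\<^sub>F z in at \<xi> within D. Re (F z) \<le> \<epsilon> + e'"
          by (rule filter_leD[OF at_le[OF DU]])
        then show "\<forall>\<^sub>F z in at \<xi> within D. norm (G z) \<le> 1 + e" using evD
        proof eventually_elim
          case (elim z)
          have "C * Im z / s \<ge> 0" using C s elim by (simp add: D_def)
          then have "norm (G z) \<le> exp e'" using elim by (simp add: normG)
          then show ?case using e by (simp add: e'_def)
        qed
      qed
      then show ?thesis by blast
    qed
  qed
  then show ?thesis by (simp add: normG)
qed

text \<open>Over a point outside \<open>K\<close> the box over its complementary interval applies.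
  As \<open>p\<close> and \<open>q\<close> belong to \<open>K\<close>, this interval has end points
  in \<open>K\<close> between them, and the vertical segments over these are controlled. Over a
  point of \<open>K\<close> the assumption \<open>vert\<close> is already stronger.\<close>

lemma box_bound:
  assumes F: "F holomorphic_on upper" and s: "s > 0" and eps: "\<epsilon> \<ge> 0" and C: "C \<ge> 0"
    and K: "closed K" "p \<in> K" "q \<in> K"
    and vert: "\<And>x y. x \<in> K \<Longrightarrow> p \<le> x \<Longrightarrow> x \<le> q \<Longrightarrow> 0 < y \<Longrightarrow> y \<le> s \<Longrightarrow> Re (F (Complex x y)) \<le> \<epsilon>"
    and bottom: "\<And>x e. x \<notin> K \<Longrightarrow> p < x \<Longrightarrow> x < q \<Longrightarrow> e > 0 \<Longrightarrow>
      \<forall>\<^sub>F z in at (of_real x) within upper. Re (F z) \<le> \<epsilon> + e"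
    and top: "\<And>x. p \<le> x \<Longrightarrow> x \<le> q \<Longrightarrow> Re (F (Complex x s)) \<le> C"
    and corners: "\<And>a b. p \<le> a \<Longrightarrow> a < b \<Longrightarrow> b \<le> q \<Longrightarrow> {a<..<b} \<inter> K = {} \<Longrightarrow>
      right_corner (\<lambda>z. Re (F z)) a \<and> left_corner (\<lambda>z. Re (F z)) b"
    and xy: "p \<le> x" "x \<le> q" "0 < y" "y < s"
  shows "Re (F (Complex x y)) \<le> \<epsilon> + C * y / s"
proof (cases "x \<in> K")
  case True
  have "C * y / s \<ge> 0" using C xy s by simp
  then show ?thesis using vert[of x y] True xy by simp
next
  case False
  define a where "a = Sup (K \<inter> {p..x})"
  define b where "b = Inf (K \<inter> {x..q})"
  have a: "a \<in> K \<inter> {p..x}" unfolding a_def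
    using K xy by (intro closed_contains_Sup) (auto intro!: bdd_aboveI[of _ x])
  have b: "b \<in> K \<inter> {x..q}" unfolding b_def
    using K xy by (intro closed_contains_Inf) (auto intro!: bdd_belowI[of _ x])
  have axb: "a < x" "x < b" using a b False by (auto simp: less_le)
  have gap: "t \<notin> K" if t: "a < t" "t < b" for t
  proof
    assume "t \<in> K"
    show False
    proof (cases "t \<le> x")
      case True
      then have "t \<le> a" unfolding a_def
        using \<open>t \<in> K\<close> t a by (intro cSup_upper) (auto intro!: bdd_aboveI[of _ x])
      then show ?thesis using t by simp
    next
      case False
      then have "b \<le> t" unfolding b_def
        using \<open>t \<in> K\<close> t b by (intro cInf_lower) (auto intro!: bdd_belowI[of _ x])
      then show ?thesis using t by simp
    qed
  qed
  have "{a<..<b} \<inter> K = {}" using gap by auto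
  then have c: "right_corner (\<lambda>z. Re (F z)) a \<and> left_corner (\<lambda>z. Re (F z)) b"
    using corners[of a b] a b axb by auto
  show ?thesis
    by (rule gap_box_bound[OF F, where a = a and b = b])
      (use a b axb gap xy s eps C c in \<open>auto intro!: vert bottom top\<close>)
qed

subsection \<open>The exceptional set\<close>

text \<open>If no \<open>S n\<close> contained a relatively open piece of \<open>E\<close> inside
  \<open>V\<close>, every \<open>T - S n\<close> would be relatively open and dense in
  \<open>T\<close>, and their empty intersection would be dense in a set containing
  \<open>x0\<close>. The closure of \<open>E \<inter> V\<close> is used because Baire's theorem
  wants a closed set; points of \<open>E \<inter> V\<close> itself then supply the ball inside
  \<open>V\<close>.\<close>

lemma Baire_closed_cover:
  fixes E :: "'a::{real_normed_vector,heine_borel} set"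
  assumes E: "closed E" and O: "open V" "x0 \<in> E" "x0 \<in> V"
    and S: "\<And>n::nat. closed (S n)" "E \<subseteq> (\<Union>n. S n)"
  obtains n x d where "d > 0" "x \<in> E" "ball x d \<subseteq> V" "E \<inter> ball x d \<subseteq> S n"
proof (rule ccontr)
  assume "\<not> thesis"
  with that have no: False if "d > 0" "x \<in> E" "ball x d \<subseteq> V" "E \<inter> ball x d \<subseteq> S n" for n x d
    using that by blast
  define T where "T = closure (E \<inter> V)"
  have TE: "T \<subseteq> E" unfolding T_def using E by (intro closure_minimal) auto
  have "T \<subseteq> closure (\<Inter>(range (\<lambda>n. T - S n)))"
  proof (rule Baire)
    show "closed T" by (simp add: T_def)
    show "countable (range (\<lambda>n. T - S n))" by simp
    fix X assume "X \<in> range (\<lambda>n. T - S n)"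
    then obtain n where X: "X = T - S n" by blast
    have "X = T \<inter> - S n" using X by auto
    then have op: "openin (top_of_set T) X"
      using S(1)[of n] by (auto simp: openin_open open_Compl)
    have "T \<subseteq> closure X"
    proof
      fix y assume y: "y \<in> T"
      show "y \<in> closure X"
      proof (rule ccontr)
        assume "y \<notin> closure X"
        then have "open (- closure X)" "y \<in> - closure X" by auto
        then obtain d where d: "d > 0" "ball y d \<subseteq> - closure X" using open_contains_ball by blast
        then have dX: "ball y d \<inter> X = {}" using closure_subset by fastforce
        have "y \<in> closure (E \<inter> V)" using y by (simp add: T_def)
        then obtain x where x: "x \<in> E" "x \<in> V" "dist x y < d" using d(1)
          by (metis IntD1 IntD2 closure_approachable)
        have "open (V \<inter> ball y d)" "x \<in> V \<inter> ball y d" using O(1) x by (auto simp: dist_commute)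
        then obtain r where r: "r > 0" "ball x r \<subseteq> V \<inter> ball y d" using open_contains_ball by blast
        have "E \<inter> ball x r \<subseteq> S n"
        proof
          fix z assume z: "z \<in> E \<inter> ball x r"
          then have "z \<in> T" unfolding T_def using r closure_subset by blast
          then show "z \<in> S n" using z r dX X by blast
        qed
        then show False using no[of r x n] r x by blast
      qed
    qed
    with op show "openin (top_of_set T) X \<and> T \<subseteq> closure X" by blast
  qed
  moreover have "\<Inter>(range (\<lambda>n. T - S n)) = {}" using TE S(2) by auto
  moreover have "x0 \<in> T" using O closure_subset[of "E \<inter> V"] by (auto simp: T_def)
  ultimately show False by (metis closure_empty empty_iff subsetD)
qed

abbreviation boundary_zero :: "(complex \<Rightarrow> real) \<Rightarrow> real \<Rightarrow> bool" where
  "boundary_zero U t \<equiv> (U \<longlongrightarrow> 0) (at (of_real t) within upper)"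

lemma isCont_Re_upper:
  assumes "F holomorphic_on upper" "Im z > 0"
  shows "isCont (\<lambda>z. Re (F z)) z"
proof -
  have "isCont F z"
    using holomorphic_on_imp_continuous_on[OF assms(1)] assms(2) open_upper
    by (auto simp: continuous_on_eq_continuous_at)
  then show ?thesis by (rule continuous_Re)
qed

lemma closed_vertical_bound:
  assumes "F holomorphic_on upper"
  shows "closed {x. \<forall>y. 0 < y \<and> y \<le> s \<longrightarrow> \<bar>Re (F (Complex x y))\<bar> \<le> \<epsilon>}"
proof -
  have "{x. \<forall>y. 0 < y \<and> y \<le> s \<longrightarrow> \<bar>Re (F (Complex x y))\<bar> \<le> \<epsilon>} =
    (\<Inter>y\<in>{0<..s}. {x. \<bar>Re (F (Complex x y))\<bar> \<le> \<epsilon>})" by auto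
  moreover have "closed {x. \<bar>Re (F (Complex x y))\<bar> \<le> \<epsilon>}" if "y > 0" for y
  proof (intro closed_Collect_le continuous_at_imp_continuous_on ballI continuous_rabs continuous_const)
    fix x
    have c: "isCont (\<lambda>x. Complex x y) x" by (simp add: isCont_def tendsto_Complex)
    have "isCont (\<lambda>z. Re (F z)) (Complex x y)" using assms that by (intro isCont_Re_upper) auto
    from isCont_o2[OF c this] show "isCont (\<lambda>x. Re (F (Complex x y))) x" .
  qed
  ultimately show ?thesis by auto
qed

lemma tendsto_imp_limsup_le:
  fixes U :: "'a \<Rightarrow> real"
  assumes "(U \<longlongrightarrow> 0) A" "\<epsilon> \<ge> 0" "e > 0"
  shows "\<forall>\<^sub>F z in A. \<bar>U z\<bar> \<le> \<epsilon> + e"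
proof -
  have "\<forall>\<^sub>F z in A. dist (U z) 0 < \<epsilon> + e" using assms by (intro tendstoD) auto
  then show ?thesis by eventually_elim (simp add: dist_real_def)
qed

text \<open>Two abscissas at once, for the two sides of a box.\<close>

lemma vertical_bound_two:
  fixes F :: "complex \<Rightarrow> complex"
  assumes "\<And>x. ((\<lambda>y. Re (F (Complex x y))) \<longlongrightarrow> 0) (at_right 0)" and "\<epsilon> > 0"
  obtains s where "s > 0" "\<And>y. 0 < y \<Longrightarrow> y \<le> s \<Longrightarrow> \<bar>Re (F (Complex p y))\<bar> \<le> \<epsilon> \<and> \<bar>Re (F (Complex q y))\<bar> \<le> \<epsilon>"
proof -
  have "\<forall>\<^sub>F y in at_right 0. dist (Re (F (Complex p y))) 0 < \<epsilon> \<and> dist (Re (F (Complex q y))) 0 < \<epsilon>"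
    using assms by (intro eventually_conj tendstoD)
  then obtain b where b: "b > 0" "\<And>y. 0 < y \<Longrightarrow> y < b \<Longrightarrow> dist (Re (F (Complex p y))) 0 < \<epsilon> \<and> dist (Re (F (Complex q y))) 0 < \<epsilon>"
    by (auto simp: eventually_at_right_field)
  show ?thesis
  proof (rule that[of "b / 2"])
    show "\<bar>Re (F (Complex p y))\<bar> \<le> \<epsilon> \<and> \<bar>Re (F (Complex q y))\<bar> \<le> \<epsilon>" if "0 < y" "y \<le> b / 2" for y
      using b(2)[of y] b(1) that by (simp add: dist_real_def)
  qed (use b in simp)
qed

lemma corners_if_bounded:
  assumes b: "\<forall>\<^sub>F z in at (of_real a) within upper. U z \<le> C"
  shows "right_corner U a" "left_corner U a"
proof -
  have ev: "\<forall>\<^sub>F z in at (of_real a) within upper. U z \<le> e / (norm (z - of_real a))\<^sup>2" if e: "e > 0" for e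
  proof -
    have "((\<lambda>z. \<bar>C\<bar> * (norm (z - of_real a))\<^sup>2) \<longlongrightarrow> \<bar>C\<bar> * (norm (of_real a - of_real a :: complex))\<^sup>2) (at (of_real a) within upper)"
      by (intro tendsto_intros)
    then have "\<forall>\<^sub>F z in at (of_real a) within upper. \<bar>C\<bar> * (norm (z - of_real a))\<^sup>2 < e"
      by (rule order_tendstoD(2)) (use e in simp)
    moreover have "\<forall>\<^sub>F z in at (of_real a) within upper. z \<noteq> of_real a" by (simp add: eventually_at_filter)
    ultimately show ?thesis using b
    proof eventually_elim
      case (elim z)
      then have "\<bar>C\<bar> \<le> e / (norm (z - of_real a))\<^sup>2" by (simp add: field_simps)
      then show ?case using elim by linarith
    qed
  qed
  show "right_corner U a" unfolding right_corner_def
    by (intro allI impI filter_leD[OF at_le ev]) auto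
  show "left_corner U a" unfolding left_corner_def
    by (intro allI impI filter_leD[OF at_le ev]) auto
qed

text \<open>Boundedness makes every corner condition trivial, so the box estimate is available for
  any \<epsilon>. Over an interval whose exceptional points carry segments of height
  \<open>s\<close> with \<open>\<bar>U\<bar> \<le> \<epsilon>\<close> it gives the bound
  \<open>\<epsilon> + C' * u / s\<close> at height \<open>u\<close>, and its limit at the real axis
  is \<epsilon>: no point of the interval was exceptional for this \<epsilon>.\<close>

lemma bounded_imp_boundary_zero:
  assumes F: "F holomorphic_on upper"
    and vert: "\<And>x. ((\<lambda>y. Re (F (Complex x y))) \<longlongrightarrow> 0) (at_right 0)"
    and bdd: "\<And>x y. p < x \<Longrightarrow> x < q \<Longrightarrow> 0 < y \<Longrightarrow> y < s0 \<Longrightarrow> \<bar>Re (F (Complex x y))\<bar> \<le> C"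
    and s0: "s0 > 0" and t: "p < t" "t < q"
  shows "boundary_zero (\<lambda>z. Re (F z)) t"
proof -
  define C' where "C' = \<bar>C\<bar>"
  have C': "C' \<ge> 0" "\<And>x y. p < x \<Longrightarrow> x < q \<Longrightarrow> 0 < y \<Longrightarrow> y < s0 \<Longrightarrow> \<bar>Re (F (Complex x y))\<bar> \<le> C'"
    using bdd by (force simp: C'_def)+
  define lims where "lims \<epsilon> t' \<longleftrightarrow> (\<forall>e>0. \<forall>\<^sub>F z in at (of_real t') within upper. \<bar>Re (F z)\<bar> \<le> \<epsilon> + e)" for \<epsilon> t'
  have all: "lims \<epsilon> t" if eps: "\<epsilon> > 0" for \<epsilon>
  proof -
    \<comment> \<open>The interior is taken so that the complement is closed, as Baire's theorem
      requires.\<close>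
    define good where "good = interior {t. lims \<epsilon> t}"
    have "open good" by (simp add: good_def)
    then have E: "closed (- good)" by (simp add: closed_Compl)
    have "t \<in> good"
    proof (rule ccontr)
      assume "t \<notin> good"
      define S where "S n = {x. \<forall>y. 0 < y \<and> y \<le> 1 / real (Suc n) \<longrightarrow> \<bar>Re (F (Complex x y))\<bar> \<le> \<epsilon>}" for n
      have S: "closed (S n)" for n unfolding S_def by (rule closed_vertical_bound[OF F])
      have cov: "- good \<subseteq> (\<Union>n. S n)"
      proof
        fix x
        obtain s where s: "s > 0" "\<And>y. 0 < y \<Longrightarrow> y \<le> s \<Longrightarrow> \<bar>Re (F (Complex x y))\<bar> \<le> \<epsilon> \<and> \<bar>Re (F (Complex x y))\<bar> \<le> \<epsilon>"
          using vertical_bound_two[OF vert eps] by blast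
        obtain n where "1 / real (Suc n) < s" using nat_approx_posE[OF s(1)] by blast
        then have "x \<in> S n" unfolding S_def using s(2) by auto
        then show "x \<in> (\<Union>n. S n)" by blast
      qed
      have tV: "t \<in> - good" "t \<in> {p<..<q}" using \<open>t \<notin> good\<close> t by auto
      obtain n x d where x: "d > 0" "x \<in> - good" "ball x d \<subseteq> {p<..<q}" "- good \<inter> ball x d \<subseteq> S n"
        using Baire_closed_cover[OF E open_greaterThanLessThan tV S cov] by metis
      define p' q' where "p' = x - d / 2" and "q' = x + d / 2"
      have pq: "p' < x" "x < q'" using x by (auto simp: p'_def q'_def)
      have in_ball: "y \<in> ball x d" if "p' \<le> y" "y \<le> q'" for y
        using that x(1) by (auto simp: p'_def q'_def dist_real_def)
      have in_pq: "p < y" "y < q" if "p' \<le> y" "y \<le> q'" for y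
        using in_ball[OF that] x(3) by auto
      obtain s1 where s1: "s1 > 0" "\<And>y. 0 < y \<Longrightarrow> y \<le> s1 \<Longrightarrow> \<bar>Re (F (Complex p' y))\<bar> \<le> \<epsilon> \<and> \<bar>Re (F (Complex q' y))\<bar> \<le> \<epsilon>"
        using vertical_bound_two[OF vert eps] by blast
      define s where "s = min (min s1 (1 / real (Suc n))) (s0 / 2)"
      have s: "s > 0" "s \<le> s1" "s \<le> 1 / real (Suc n)" "s < s0" using s1 s0 by (auto simp: s_def)
      \<comment> \<open>The vertical segments over \<open>p'\<close> and \<open>q'\<close> are
        bounded as well; adjoining these points gives the outermost boxes a controlled side.\<close>
      define K where "K = - good \<union> {p', q'}"
      have K: "closed K" "p' \<in> K" "q' \<in> K" using E by (auto simp: K_def)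
      have vK: "\<bar>Re (F (Complex y u))\<bar> \<le> \<epsilon>" if "y \<in> K" "p' \<le> y" "y \<le> q'" "0 < u" "u \<le> s" for y u
      proof (cases "y \<in> - good")
        case True
        then have "y \<in> S n" using x(4) in_ball[OF that(2,3)] by blast
        then show ?thesis using that s unfolding S_def by auto
      next
        case False
        then show ?thesis using that s1(2)[of u] s by (auto simp: K_def)
      qed
      have lim: "\<forall>\<^sub>F z in at (of_real y) within upper. \<bar>Re (F z)\<bar> \<le> \<epsilon> + e" if "y \<notin> K" "e > 0" for y e
      proof -
        have "y \<in> good" using that by (auto simp: K_def)
        then have "lims \<epsilon> y" using interior_subset by (auto simp: good_def)
        then show ?thesis using that by (simp add: lims_def)
      qed
      have near: "\<forall>\<^sub>F z in at (of_real y) within upper. \<bar>Re (F z)\<bar> \<le> C'" if "p' \<le> y" "y \<le> q'" for y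
      proof -
        have "((\<lambda>z. Re z) \<longlongrightarrow> Re (of_real y)) (at (of_real y) within upper)"
          "((\<lambda>z. Im z) \<longlongrightarrow> Im (of_real y)) (at (of_real y) within upper)"
          by (intro tendsto_intros)+
        then have "\<forall>\<^sub>F z in at (of_real y) within upper. p < Re z"
          "\<forall>\<^sub>F z in at (of_real y) within upper. Re z < q"
          "\<forall>\<^sub>F z in at (of_real y) within upper. Im z < s0"
          using in_pq[OF that] s0 by (auto intro: order_tendstoD)
        moreover have "\<forall>\<^sub>F z in at (of_real y) within upper. Im z > 0" by (simp add: eventually_at_filter)
        ultimately show ?thesis
        proof eventually_elim
          case (elim z)
          then show ?case using C'(2)[of "Re z" "Im z"] by simp
        qed
      qed
      have main: "\<bar>Re (F (Complex y u))\<bar> \<le> \<epsilon> + C' * u / s" if y: "p' \<le> y" "y \<le> q'" "0 < u" "u < s" for y u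
      proof -
        have "Re (F (Complex y u)) \<le> \<epsilon> + C' * u / s"
        proof (rule box_bound[OF F s(1) _ C'(1) K])
          show "Re (F (Complex x s)) \<le> C'" if "p' \<le> x" "x \<le> q'" for x
            using C'(2)[of x s] in_pq[OF that] s by (simp add: abs_le_iff)
          show "\<forall>\<^sub>F z in at (of_real x) within upper. Re (F z) \<le> \<epsilon> + e" if "x \<notin> K" "e > 0" for x e
            using lim[OF that] by eventually_elim simp
          show "right_corner (\<lambda>z. Re (F z)) a \<and> left_corner (\<lambda>z. Re (F z)) b"
            if "p' \<le> a" "a < b" "b \<le> q'" for a b
            using that by (intro conjI corners_if_bounded[where C = C'] eventually_mono[OF near]) auto
          show "Re (F (Complex x y)) \<le> \<epsilon>" if "x \<in> K" "p' \<le> x" "x \<le> q'" "0 < y" "y \<le> s" for x y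
            using vK[OF that] by simp
        qed (use y eps in auto)
        moreover have "Re (- F (Complex y u)) \<le> \<epsilon> + C' * u / s"
        proof (rule box_bound[OF _ s(1) _ C'(1) K])
          show "(\<lambda>z. - F z) holomorphic_on upper" using F by (intro holomorphic_intros)
          show "Re (- F (Complex x s)) \<le> C'" if "p' \<le> x" "x \<le> q'" for x
            using C'(2)[of x s] in_pq[OF that] s by (simp add: abs_le_iff)
          show "\<forall>\<^sub>F z in at (of_real x) within upper. Re (- F z) \<le> \<epsilon> + e" if "x \<notin> K" "e > 0" for x e
            using lim[OF that] by eventually_elim simp
          show "right_corner (\<lambda>z. Re (- F z)) a \<and> left_corner (\<lambda>z. Re (- F z)) b"
            if "p' \<le> a" "a < b" "b \<le> q'" for a b
            using that by (intro conjI corners_if_bounded[where C = C'] eventually_mono[OF near]) auto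
          show "Re (- F (Complex x y)) \<le> \<epsilon>" if "x \<in> K" "p' \<le> x" "x \<le> q'" "0 < y" "y \<le> s" for x y
            using vK[OF that] by simp
        qed (use y eps in auto)
        ultimately show ?thesis by simp
      qed
      have "lims \<epsilon> y" if "p' < y" "y < q'" for y unfolding lims_def
      proof (intro allI impI)
        fix e :: real assume e: "e > 0"
        have "((\<lambda>z. Re z) \<longlongrightarrow> Re (of_real y)) (at (of_real y) within upper)"
          "((\<lambda>z. Im z) \<longlongrightarrow> Im (of_real y)) (at (of_real y) within upper)"
          "((\<lambda>z. C' * Im z / s) \<longlongrightarrow> C' * Im (of_real y) / s) (at (of_real y) within upper)"
          using s by (intro tendsto_intros; simp)+
        then have "\<forall>\<^sub>F z in at (of_real y) within upper. p' < Re z"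
          "\<forall>\<^sub>F z in at (of_real y) within upper. Re z < q'"
          "\<forall>\<^sub>F z in at (of_real y) within upper. Im z < s"
          "\<forall>\<^sub>F z in at (of_real y) within upper. C' * Im z / s < e"
          using that s e by (auto intro: order_tendstoD)
        moreover have "\<forall>\<^sub>F z in at (of_real y) within upper. Im z > 0" by (simp add: eventually_at_filter)
        ultimately show "\<forall>\<^sub>F z in at (of_real y) within upper. \<bar>Re (F z)\<bar> \<le> \<epsilon> + e"
        proof eventually_elim
          case (elim z)
          then show ?case using main[of "Re z" "Im z"] by simp
        qed
      qed
      then have "{p'<..<q'} \<subseteq> good" unfolding good_def by (intro interior_maximal) auto
      then have "x \<in> good" using pq by auto
      then show False using x by simp
    qed
    then show ?thesis using interior_subset by (auto simp: good_def)
  qed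
  show ?thesis
  proof (rule tendstoI)
    fix e :: real assume e: "e > 0"
    have e4: "e / 4 > 0" using e by simp
    then have "lims (e/4) t" by (rule all)
    then have "\<forall>\<^sub>F z in at (of_real t) within upper. \<bar>Re (F z)\<bar> \<le> e/4 + e/4" unfolding lims_def using e4 by blast
    then show "\<forall>\<^sub>F z in at (of_real t) within upper. dist (Re (F z)) 0 < e"
      by eventually_elim (use e in \<open>simp add: dist_real_def\<close>)
  qed
qed

text \<open>The complement is the exceptional set \<open>E\<close>; the interior makes it
  closed.\<close>

definition vanishing_set :: "(complex \<Rightarrow> real) \<Rightarrow> real set" where
  "vanishing_set U = interior {t. boundary_zero U t}"

lemma open_vanishing_set: "open (vanishing_set U)"
  by (simp add: vanishing_set_def)

lemma vanishing_set_imp_boundary_zero: "x \<in> vanishing_set U \<Longrightarrow> boundary_zero U x"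
  using interior_subset by (auto simp: vanishing_set_def)

lemma vertical_bound_on_exceptional_set:
  assumes F: "F holomorphic_on upper"
    and vert: "\<And>x. ((\<lambda>y. Re (F (Complex x y))) \<longlongrightarrow> 0) (at_right 0)"
    and x0: "x0 \<notin> vanishing_set (\<lambda>z. Re (F z))"
  obtains p x q s where "p < x" "x < q" "x \<notin> vanishing_set (\<lambda>z. Re (F z))" "s > 0"
    "\<And>t y. t \<notin> vanishing_set (\<lambda>z. Re (F z)) \<Longrightarrow> p \<le> t \<Longrightarrow> t \<le> q \<Longrightarrow> 0 < y \<Longrightarrow> y \<le> s \<Longrightarrow> \<bar>Re (F (Complex t y))\<bar> \<le> 1"
proof -
  let ?G = "vanishing_set (\<lambda>z. Re (F z))"
  define S where "S n = {x. \<forall>y. 0 < y \<and> y \<le> 1 / real (Suc n) \<longrightarrow> \<bar>Re (F (Complex x y))\<bar> \<le> 1}" for n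
  have S: "closed (S n)" for n unfolding S_def by (rule closed_vertical_bound[OF F])
  have cov: "- ?G \<subseteq> (\<Union>n. S n)"
  proof
    fix x
    obtain s where s: "s > 0" "\<And>y. 0 < y \<Longrightarrow> y \<le> s \<Longrightarrow> \<bar>Re (F (Complex x y))\<bar> \<le> 1 \<and> \<bar>Re (F (Complex x y))\<bar> \<le> 1"
      using vertical_bound_two[OF vert zero_less_one] by blast
    obtain n where "1 / real (Suc n) < s" using nat_approx_posE[OF s(1)] by blast
    then have "x \<in> S n" unfolding S_def using s(2) by auto
    then show "x \<in> (\<Union>n. S n)" by blast
  qed
  have E: "closed (- ?G)" using open_vanishing_set by (simp add: closed_Compl)
  have "x0 \<in> - ?G" using x0 by simp
  from Baire_closed_cover[OF E open_UNIV this UNIV_I S cov]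
  obtain n x d where x: "d > 0" "x \<in> - ?G" "- ?G \<inter> ball x d \<subseteq> S n" by metis
  show ?thesis
  \<comment> \<open>Half the radius, so that the closed interval stays inside the ball.\<close>
  proof (rule that[of "x - d / 2" x "x + d / 2" "1 / real (Suc n)"])
    fix t y assume t: "t \<notin> ?G" "x - d / 2 \<le> t" "t \<le> x + d / 2" "0 < y" "y \<le> 1 / real (Suc n)"
    then have "t \<in> S n" using x by (auto simp: dist_real_def)
    then show "\<bar>Re (F (Complex t y))\<bar> \<le> 1" using t unfolding S_def by auto
  qed (use x in auto)
qed

lemma Re_bounded_on_segment:
  assumes F: "F holomorphic_on upper" and s: "s > 0"
  obtains C where "C \<ge> 0" "\<And>x. p \<le> x \<Longrightarrow> x \<le> q \<Longrightarrow> \<bar>Re (F (Complex x s))\<bar> \<le> C"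
proof -
  have "continuous_on {p..q} (\<lambda>x. \<bar>Re (F (Complex x s))\<bar>)"
  proof (intro continuous_at_imp_continuous_on ballI continuous_rabs)
    fix x
    have c: "isCont (\<lambda>x. Complex x s) x" by (simp add: isCont_def tendsto_Complex)
    have "isCont (\<lambda>z. Re (F z)) (Complex x s)" using assms by (intro isCont_Re_upper) auto
    from isCont_o2[OF c this] show "isCont (\<lambda>x. Re (F (Complex x s))) x" .
  qed
  then have "bounded ((\<lambda>x. \<bar>Re (F (Complex x s))\<bar>) ` {p..q})"
    by (intro compact_imp_bounded compact_continuous_image) auto
  then obtain B where B: "\<forall>x\<in>{p..q}. \<bar>Re (F (Complex x s))\<bar> \<le> B"
    unfolding bounded_iff by auto
  show ?thesis
  proof (rule that[of "\<bar>B\<bar>"])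
    fix x assume "p \<le> x" "x \<le> q"
    then have "\<bar>Re (F (Complex x s))\<bar> \<le> B" using B by simp
    then show "\<bar>Re (F (Complex x s))\<bar> \<le> \<bar>B\<bar>" by linarith
  qed simp
qed

text \<open>An upper bound only, so that \<open>F\<close> and \<open>- F\<close> can be treated one
  after the other with different corner estimates. \<open>G\<close> is a separate name because both
  functions have the same vanishing set.\<close>

lemma exceptional_box_bound:
  assumes F: "F holomorphic_on upper"
    and vert: "\<And>x. ((\<lambda>y. Re (F (Complex x y))) \<longlongrightarrow> 0) (at_right 0)"
    and G: "G = vanishing_set (\<lambda>z. Re (F z))" and pq: "p < q" and s0: "s0 > 0"
    and K: "\<And>t y. t \<notin> G \<Longrightarrow> p \<le> t \<Longrightarrow> t \<le> q \<Longrightarrow> 0 < y \<Longrightarrow> y \<le> s0 \<Longrightarrow> \<bar>Re (F (Complex t y))\<bar> \<le> 1"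
    and corners: "\<And>a b. p \<le> a \<Longrightarrow> a < b \<Longrightarrow> b \<le> q \<Longrightarrow> {a<..<b} \<subseteq> G \<Longrightarrow>
      right_corner (\<lambda>z. Re (F z)) a \<and> left_corner (\<lambda>z. Re (F z)) b"
  obtains s C where "s > 0" "\<And>x y. p \<le> x \<Longrightarrow> x \<le> q \<Longrightarrow> 0 < y \<Longrightarrow> y < s \<Longrightarrow> Re (F (Complex x y)) \<le> C"
proof -
  obtain s1 where s1: "s1 > 0" "\<And>y. 0 < y \<Longrightarrow> y \<le> s1 \<Longrightarrow> \<bar>Re (F (Complex p y))\<bar> \<le> 1 \<and> \<bar>Re (F (Complex q y))\<bar> \<le> 1"
    using vertical_bound_two[OF vert zero_less_one] by blast
  define s where "s = min s0 s1"
  have s: "s > 0" "s \<le> s0" "s \<le> s1" using s0 s1 by (auto simp: s_def)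
  obtain C where C: "C \<ge> 0" "\<And>x. p \<le> x \<Longrightarrow> x \<le> q \<Longrightarrow> \<bar>Re (F (Complex x s))\<bar> \<le> C"
    using Re_bounded_on_segment[OF F s(1)] by metis
  have KK: "closed (- G \<union> {p, q})" using open_vanishing_set by (simp add: G closed_Compl closed_Un)
  show ?thesis
  proof (rule that[of s "1 + C"])
    fix x y assume xy: "p \<le> x" "x \<le> q" "0 < y" "y < s"
    have "Re (F (Complex x y)) \<le> 1 + C * y / s"
    proof (rule box_bound[OF F s(1) _ C(1) KK])
      show "Re (F (Complex x y)) \<le> 1" if "x \<in> - G \<union> {p, q}" "p \<le> x" "x \<le> q" "0 < y" "y \<le> s" for x y
        using that K[of x y] s1(2)[of y] s by (auto simp: abs_le_iff)
      show "\<forall>\<^sub>F z in at (of_real x) within upper. Re (F z) \<le> 1 + e" if "x \<notin> - G \<union> {p, q}" "e > 0" for x e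
      proof -
        have "boundary_zero (\<lambda>z. Re (F z)) x" using that G vanishing_set_imp_boundary_zero by auto
        then have "\<forall>\<^sub>F z in at (of_real x) within upper. \<bar>Re (F z)\<bar> \<le> 1 + e"
          by (rule tendsto_imp_limsup_le) (use that in auto)
        then show ?thesis by eventually_elim simp
      qed
      show "Re (F (Complex x s)) \<le> C" if "p \<le> x" "x \<le> q" for x using C(2)[OF that] by simp
      show "right_corner (\<lambda>z. Re (F z)) a \<and> left_corner (\<lambda>z. Re (F z)) b"
        if "p \<le> a" "a < b" "b \<le> q" "{a<..<b} \<inter> (- G \<union> {p, q}) = {}" for a b
        using that by (intro corners) auto
    qed (use xy in auto)
    also have "C * y / s \<le> C * 1"
      using xy C(1) s by (simp add: field_simps mult_left_mono)
    finally show "Re (F (Complex x y)) \<le> 1 + C" by simp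
  qed (use s in simp)
qed

lemma vanishing_set_uminus: "vanishing_set (\<lambda>z. Re (- F z)) = vanishing_set (\<lambda>z. Re (F z))"
proof -
  have "boundary_zero (\<lambda>z. Re (- F z)) t = boundary_zero (\<lambda>z. Re (F z)) t" for t
    using tendsto_minus_cancel_left[of "\<lambda>z. Re (F z)" 0 "at (of_real t) within upper"] by simp
  then show ?thesis by (simp add: vanishing_set_def)
qed

text \<open>For the cases where both signs satisfy the corner condition at once. Upper bounds for
  \<open>F\<close> and \<open>- F\<close> make \<open>U\<close> bounded over an interval around an
  exceptional point \<open>x\<close>; the vanishing on this interval then puts \<open>x\<close> into
  the interior after all.\<close>

theorem vanishing_everywhere_two_sided:
  assumes F: "F holomorphic_on upper"
    and vert: "\<And>x. ((\<lambda>y. Re (F (Complex x y))) \<longlongrightarrow> 0) (at_right 0)"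
    and corners: "\<And>a b. a < b \<Longrightarrow> (\<And>t. a < t \<Longrightarrow> t < b \<Longrightarrow> boundary_zero (\<lambda>z. Re (F z)) t) \<Longrightarrow>
      right_corner (\<lambda>z. Re (F z)) a \<and> left_corner (\<lambda>z. Re (F z)) b \<and>
      right_corner (\<lambda>z. Re (- F z)) a \<and> left_corner (\<lambda>z. Re (- F z)) b"
  shows "boundary_zero (\<lambda>z. Re (F z)) t"
proof -
  let ?G = "vanishing_set (\<lambda>z. Re (F z))"
  have "t \<in> ?G"
  proof (rule ccontr)
    assume "t \<notin> ?G"
    then obtain p x q s0 where x: "p < x" "x < q" "x \<notin> ?G" "s0 > 0" and
      K: "\<And>t y. t \<notin> ?G \<Longrightarrow> p \<le> t \<Longrightarrow> t \<le> q \<Longrightarrow> 0 < y \<Longrightarrow> y \<le> s0 \<Longrightarrow> \<bar>Re (F (Complex t y))\<bar> \<le> 1"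
      using vertical_bound_on_exceptional_set[OF F vert] by metis
    have pq: "p < q" using x by simp
    have c: "right_corner (\<lambda>z. Re (F z)) a \<and> left_corner (\<lambda>z. Re (F z)) b \<and>
      right_corner (\<lambda>z. Re (- F z)) a \<and> left_corner (\<lambda>z. Re (- F z)) b"
      if "a < b" "{a<..<b} \<subseteq> ?G" for a b
      using that by (intro corners vanishing_set_imp_boundary_zero) auto
    obtain s C where s: "s > 0" "\<And>x y. p \<le> x \<Longrightarrow> x \<le> q \<Longrightarrow> 0 < y \<Longrightarrow> y < s \<Longrightarrow> Re (F (Complex x y)) \<le> C"
      by (rule exceptional_box_bound[OF F vert refl pq x(4) K]) (use c in auto)
    have F': "(\<lambda>z. - F z) holomorphic_on upper" using F by (intro holomorphic_intros)
    have vert': "((\<lambda>y. Re (- F (Complex x y))) \<longlongrightarrow> 0) (at_right 0)" for x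
      using tendsto_minus[OF vert[of x]] by simp
    have K': "\<bar>Re (- F (Complex t y))\<bar> \<le> 1" if "t \<notin> ?G" "p \<le> t" "t \<le> q" "0 < y" "y \<le> s0" for t y
      using K[OF that] by simp
    obtain s' C' where s': "s' > 0" "\<And>x y. p \<le> x \<Longrightarrow> x \<le> q \<Longrightarrow> 0 < y \<Longrightarrow> y < s' \<Longrightarrow> Re (- F (Complex x y)) \<le> C'"
      by (rule exceptional_box_bound[OF F' vert' vanishing_set_uminus[symmetric] pq x(4) K']) (use c in auto)
    have "boundary_zero (\<lambda>z. Re (F z)) u" if u: "p < u" "u < q" for u
    proof (rule bounded_imp_boundary_zero[OF F vert _ _ u])
      show "min s s' > 0" using s s' by simp
      show "\<bar>Re (F (Complex x y))\<bar> \<le> max C C'" if "p < x" "x < q" "0 < y" "y < min s s'" for x y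
        using s(2)[of x y] s'(2)[of x y] that by (auto simp: abs_le_iff)
    qed
    then have "{p<..<q} \<subseteq> ?G" unfolding vanishing_set_def by (intro interior_maximal) auto
    then have "x \<in> ?G" using x by auto
    then show False using x by blast
  qed
  then show ?thesis by (rule vanishing_set_imp_boundary_zero)
qed

subsection \<open>Corners under a growth condition\<close>

lemma eventually_Re_le_of_isCont:
  assumes "isCont F \<xi>" "Re (F \<xi>) \<le> M" "e > 0"
  shows "\<forall>\<^sub>F z in at \<xi> within D. Re (F z) \<le> M + e"
proof -
  have "((\<lambda>z. Re (F z)) \<longlongrightarrow> Re (F \<xi>)) (at \<xi> within D)"
    using assms(1) unfolding isCont_def by (intro tendsto_Re) (rule tendsto_within_subset, auto)
  then have "\<forall>\<^sub>F z in at \<xi> within D. Re (F z) < M + e"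
    by (rule order_tendstoD(2)) (use assms in linarith)
  then show ?thesis by eventually_elim simp
qed

lemma isCont_upper: "F holomorphic_on upper \<Longrightarrow> Im z > 0 \<Longrightarrow> isCont F z"
  using holomorphic_on_imp_continuous_on[of F upper] open_upper
  by (auto simp: continuous_on_eq_continuous_at)

text \<open>Near the real axis the limit superior gives the bound, higher up compactness.\<close>

lemma vertical_edge_bounded:
  assumes F: "F holomorphic_on upper"
    and lim: "\<forall>\<^sub>F z in at (of_real t) within upper. Re (F z) \<le> 1"
  obtains C where "C \<ge> 0" "\<And>y. 0 < y \<Longrightarrow> y \<le> m \<Longrightarrow> Re (F (Complex t y)) \<le> C"
proof -
  obtain d where d: "d > 0" "\<And>z. z \<in> upper \<Longrightarrow> z \<noteq> of_real t \<Longrightarrow> dist z (of_real t) < d \<Longrightarrow> Re (F z) \<le> 1"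
    using lim unfolding eventually_at by blast
  have "continuous_on {d/2..m} (\<lambda>y. Re (F (Complex t y)))"
  proof (intro continuous_at_imp_continuous_on ballI)
    fix y assume "y \<in> {d/2..m}"
    then have "y > 0" using d by simp
    have c: "isCont (\<lambda>y. Complex t y) y" by (simp add: isCont_def tendsto_Complex)
    have "isCont (\<lambda>z. Re (F z)) (Complex t y)" using F \<open>y > 0\<close> by (intro isCont_Re_upper) auto
    from isCont_o2[OF c this] show "isCont (\<lambda>x. Re (F (Complex t x))) y" .
  qed
  then have "bounded ((\<lambda>y. Re (F (Complex t y))) ` {d/2..m})"
    by (intro compact_imp_bounded compact_continuous_image) auto
  then obtain B where B: "\<forall>y\<in>{d/2..m}. \<bar>Re (F (Complex t y))\<bar> \<le> B"
    unfolding bounded_iff by auto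
  show ?thesis
  proof (rule that[of "max 1 B"])
    fix y assume y: "0 < y" "y \<le> m"
    show "Re (F (Complex t y)) \<le> max 1 B"
    proof (cases "y < d / 2")
      case True
      have "dist (Complex t y) (of_real t) < d"
        using True y d by (simp add: dist_norm complex_of_real_def complex_diff cmod_def)
      moreover have "Complex t y \<noteq> of_real t" using y by (simp add: complex_eq_iff)
      ultimately show ?thesis using d(2)[of "Complex t y"] y by auto
    next
      case False
      then have "\<bar>Re (F (Complex t y))\<bar> \<le> B" using B y by simp
      then show ?thesis by (auto simp: le_max_iff_disj abs_le_iff)
    qed
  qed simp
qed

lemma Re_inverse_square: "Re (1 / w\<^sup>2) = ((Re w)\<^sup>2 - (Im w)\<^sup>2) / ((Re w)\<^sup>2 + (Im w)\<^sup>2)\<^sup>2"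
proof -
  have "1 / w\<^sup>2 = 1 * cnj (w\<^sup>2) / of_real ((norm (w\<^sup>2))\<^sup>2)"
    by (subst complex_div_cnj) simp
  then have "Re (1 / w\<^sup>2) = Re (cnj (w\<^sup>2)) / (norm (w\<^sup>2))\<^sup>2" by (simp only: Re_divide_of_real mult_1)
  also have "Re (cnj (w\<^sup>2)) = (Re w)\<^sup>2 - (Im w)\<^sup>2" by (simp add: power2_eq_square)
  also have "(norm (w\<^sup>2))\<^sup>2 = ((Re w)\<^sup>2 + (Im w)\<^sup>2)\<^sup>2" by (simp add: norm_power cmod_power2)
  finally show ?thesis .
qed

text \<open>The barrier \<open>9 * e * Re (1 / (z - c)\<^sup>2)\<close> is nonnegative in the wedge
  and dominates \<open>e / (Im z)\<^sup>2\<close> on its slanted edge. The vertex \<open>c\<close>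
  is moved by \<delta> into the interval where \<open>U\<close> has upper limit at most 0, so it is
  an ordinary boundary point; \<delta> tends to 0 afterwards.\<close>

lemma wedge_bound_shifted:
  assumes F: "F holomorphic_on upper" and ab: "0 < \<delta>" "\<delta> < d" "a + d < b" and e: "e \<ge> 0"
    and zero: "\<And>t e. a < t \<Longrightarrow> t < b \<Longrightarrow> e > 0 \<Longrightarrow> \<forall>\<^sub>F z in at (of_real t) within upper. Re (F z) \<le> e"
    and growth: "\<And>z. a < Re z \<Longrightarrow> Re z < a + d \<Longrightarrow> 0 < Im z \<Longrightarrow> Im z < d \<Longrightarrow> Re (F z) \<le> e / (Im z)\<^sup>2"
    and C: "C \<ge> 0" "\<And>y. 0 < y \<Longrightarrow> y \<le> d \<Longrightarrow> Re (F (Complex (a + d) y)) \<le> C"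
    and z: "a + \<delta> < Re z" "Re z < a + d" "0 < Im z" "Im z < (Re z - a - \<delta>) / 2"
  shows "Re (F z) \<le> C + 9 * e * Re (1 / (z - of_real (a + \<delta>))\<^sup>2)"
proof -
  define W where "W = {z. a + \<delta> < Re z \<and> Re z < a + d \<and> 0 < Im z \<and> Im z < (Re z - a - \<delta>) / 2}"
  define c where "c = complex_of_real (a + \<delta>)"
  define G where "G z = F z - of_real (9 * e) * (1 / (z - c)\<^sup>2)" for z
  have WU: "W \<subseteq> upper" by (auto simp: W_def)
  have "W = {z. a + \<delta> < Re z} \<inter> {z. Re z < a + d} \<inter> {z. 0 < Im z} \<inter> {z. Im z < (Re z - a - \<delta>) / 2}"
    by (auto simp: W_def)
  also have "open \<dots>" by (intro open_Int open_Collect_less continuous_intros; simp)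
  finally have W: "open W" .
  have "W \<subseteq> cbox (Complex (a + \<delta>) 0) (Complex (a + d) d)"
    using ab by (auto simp: W_def in_cbox_complex_iff)
  then have bW: "bounded W" by (rule bounded_subset[OF bounded_cbox])
  have "closed ({z. a + \<delta> \<le> Re z} \<inter> {z. Re z \<le> a + d} \<inter> {z. 0 \<le> Im z} \<inter> {z. Im z \<le> (Re z - a - \<delta>) / 2})"
    by (intro closed_Int closed_Collect_le continuous_intros; simp)
  then have cl: "closure W \<subseteq> {z. a + \<delta> \<le> Re z} \<inter> {z. Re z \<le> a + d} \<inter> {z. 0 \<le> Im z} \<inter> {z. Im z \<le> (Re z - a - \<delta>) / 2}"
    by (intro closure_minimal) (auto simp: W_def)
  have ReB: "Re (1 / (w - c)\<^sup>2) \<ge> 0" if "a + \<delta> \<le> Re w" "0 \<le> Im w" "Im w \<le> (Re w - a - \<delta>) / 2" for w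
  proof -
    have "\<bar>Im (w - c)\<bar> \<le> \<bar>Re (w - c)\<bar>" using that by (simp add: c_def)
    then have "(Im (w - c))\<^sup>2 \<le> (Re (w - c))\<^sup>2" by (simp only: abs_le_square_iff)
    then show ?thesis unfolding Re_inverse_square by simp
  qed
  have ReG: "Re (G w) = Re (F w) - 9 * e * Re (1 / (w - c)\<^sup>2)" for w
    by (simp only: G_def minus_complex.simps Re_complex_of_real times_complex.simps Im_complex_of_real mult_zero_left diff_zero)
  have "z \<noteq> c" if "Im z > 0" for z using that by (auto simp: c_def)
  then have Gh: "G holomorphic_on upper" unfolding G_def
    by (intro holomorphic_intros F) auto
  have "Re (G z) \<le> C"
  proof (rule Re_le_if_limsup_frontier_le[OF W bW, where F = G])
    show "G holomorphic_on W" using Gh WU by (rule holomorphic_on_subset)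
    show "z \<in> W" using z by (simp add: W_def)
    fix \<xi> e' assume \<xi>: "\<xi> \<in> frontier W" and e': "(e'::real) > 0"
    then have f: "\<xi> \<notin> W" "a + \<delta> \<le> Re \<xi>" "Re \<xi> \<le> a + d" "0 \<le> Im \<xi>" "Im \<xi> \<le> (Re \<xi> - a - \<delta>) / 2"
      using W cl by (auto simp: frontier_def interior_open)
    show "\<forall>\<^sub>F z in at \<xi> within W. Re (G z) \<le> C + e'"
    proof (cases "Im \<xi> = 0")
      case True
      then have "\<xi> = of_real (Re \<xi>)" by (simp add: complex_eq_iff)
      moreover have "\<forall>\<^sub>F z in at (of_real (Re \<xi>)) within upper. Re (F z) \<le> e'"
        using zero[of "Re \<xi>" e'] f ab e' by simp
      ultimately have "\<forall>\<^sub>F z in at \<xi> within upper. Re (F z) \<le> e'" by simp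
      then have "\<forall>\<^sub>F z in at \<xi> within W. Re (F z) \<le> e'" by (rule filter_leD[OF at_le[OF WU]])
      moreover have "\<forall>\<^sub>F z in at \<xi> within W. z \<in> W" by (simp add: eventually_at_filter)
      ultimately show ?thesis
      proof eventually_elim
        case (elim z)
        have "Re (1 / (z - c)\<^sup>2) \<ge> 0" using elim by (intro ReB) (auto simp: W_def)
        then have "9 * e * Re (1 / (z - c)\<^sup>2) \<ge> 0" using e by simp
        then show ?case using elim C unfolding ReG by linarith
      qed
    next
      case False
      then have im: "Im \<xi> > 0" using f by simp
      have B0: "9 * e * Re (1 / (\<xi> - c)\<^sup>2) \<ge> 0" using ReB[of \<xi>] f e by simp
      have "Re (F \<xi>) \<le> C + 9 * e * Re (1 / (\<xi> - c)\<^sup>2)"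
      proof (cases "Re \<xi> = a + d")
        case True
        have "Re (F (Complex (a + d) (Im \<xi>))) \<le> C"
          using True f im ab by (intro C) auto
        moreover have "Complex (a + d) (Im \<xi>) = \<xi>" using True by (simp add: complex_eq_iff)
        ultimately show ?thesis using B0 by simp
      next
        case False
        \<comment> \<open>On this edge \<open>Re (1 / (\<xi> - c)\<^sup>2)\<close> is
          \<open>3 / 25\<close> times \<open>1 / (Im \<xi>)\<^sup>2\<close>, and 9 is the least
          integer whose product with \<open>3 / 25\<close> exceeds 1.\<close>
        then have s: "Re \<xi> - a - \<delta> = 2 * Im \<xi>" using f im by (auto simp: W_def)
        have "Re (1 / (\<xi> - c)\<^sup>2) = ((2 * Im \<xi>)\<^sup>2 - (Im \<xi>)\<^sup>2) / ((2 * Im \<xi>)\<^sup>2 + (Im \<xi>)\<^sup>2)\<^sup>2"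
          unfolding Re_inverse_square using s by (simp add: c_def algebra_simps)
        also have "\<dots> = 3 / (25 * (Im \<xi>)\<^sup>2)"
          using im by (simp add: power_mult_distrib power2_eq_square field_simps)
        finally have "9 * e * Re (1 / (\<xi> - c)\<^sup>2) = 27 / 25 * (e / (Im \<xi>)\<^sup>2)" by simp
        moreover have "Re (F \<xi>) \<le> e / (Im \<xi>)\<^sup>2" using False f ab im by (intro growth) auto
        moreover have "e / (Im \<xi>)\<^sup>2 \<ge> 0" using e by simp
        ultimately show ?thesis using C by linarith
      qed
      then have "Re (G \<xi>) \<le> C" unfolding ReG by simp
      then show ?thesis by (intro eventually_Re_le_of_isCont isCont_upper Gh im e')
    qed
  qed
  then show ?thesis unfolding ReG c_def by simp
qed

text \<open>Below the line of slope \<open>1 / 2\<close> through \<open>a\<close> the wedge estimate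
  applies, with \<delta> tending to 0. Above it the squared distance to \<open>a\<close> is at most
  \<open>5 * (Im z)\<^sup>2\<close>, so the growth condition is already one in the distance to the
  corner.\<close>

lemma right_corner_of_growth:
  assumes F: "F holomorphic_on upper" and ab: "a < b"
    and zero: "\<And>t e. a < t \<Longrightarrow> t < b \<Longrightarrow> e > 0 \<Longrightarrow> \<forall>\<^sub>F z in at (of_real t) within upper. Re (F z) \<le> e"
    and growth: "\<And>e. e > 0 \<Longrightarrow> \<exists>d>0. \<forall>z. a < Re z \<and> Re z < a + d \<and> 0 < Im z \<and> Im z < d \<longrightarrow> Re (F z) \<le> e / (Im z)\<^sup>2"
  shows "right_corner (\<lambda>z. Re (F z)) a"
  unfolding right_corner_def
proof (intro allI impI)
  fix e :: real assume e: "e > 0"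
  \<comment> \<open>This serves both regions: \<open>9 * e1 \<le> e / 2\<close> in the wedge, where
    the other half absorbs \<open>C\<close>, and \<open>5 * e1 \<le> e\<close> above it.\<close>
  define e1 where "e1 = e / 20"
  have e1: "e1 > 0" using e by (simp add: e1_def)
  obtain d0 where d0: "d0 > 0" "\<And>z. a < Re z \<Longrightarrow> Re z < a + d0 \<Longrightarrow> 0 < Im z \<Longrightarrow> Im z < d0 \<Longrightarrow> Re (F z) \<le> e1 / (Im z)\<^sup>2"
    using growth[OF e1] by blast
  define d where "d = min d0 ((b - a) / 2)"
  have d: "d > 0" "d \<le> d0" "a + d < b" using d0 ab by (auto simp: d_def min_def field_simps)
  have "\<forall>\<^sub>F z in at (of_real (a + d)) within upper. Re (F z) \<le> 1" using d by (intro zero) auto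
  from vertical_edge_bounded[OF F this, of d]
  obtain C where C: "C \<ge> 0" "\<And>y. 0 < y \<Longrightarrow> y \<le> d \<Longrightarrow> Re (F (Complex (a + d) y)) \<le> C" by metis
  have wedge: "Re (F z) \<le> C + 9 * e1 / (norm (z - of_real a))\<^sup>2"
    if z: "a < Re z" "Re z < a + d" "0 < Im z" "Im z < (Re z - a) / 2" for z
  proof -
    have ne: "z - of_real (a + 0) \<noteq> 0" using z by (auto simp: complex_eq_iff)
    have "((\<lambda>\<delta>. C + 9 * e1 * Re (1 / (z - of_real (a + \<delta>))\<^sup>2)) \<longlongrightarrow> C + 9 * e1 * Re (1 / (z - of_real (a + 0))\<^sup>2)) (at_right 0)"
      using ne by (intro tendsto_intros) auto
    then have "Re (F z) \<le> C + 9 * e1 * Re (1 / (z - of_real (a + 0))\<^sup>2)"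
    proof (rule tendsto_lowerbound)
      have "\<forall>\<^sub>F \<delta> in at_right 0. \<delta> < Re z - a - 2 * Im z"
        using z by (intro eventually_at_rightI[of 0 "Re z - a - 2 * Im z"]) auto
      moreover have "\<forall>\<^sub>F \<delta> in at_right 0. (0::real) < \<delta>" by (rule eventually_at_right_less)
      ultimately show "\<forall>\<^sub>F \<delta> in at_right 0. Re (F z) \<le> C + 9 * e1 * Re (1 / (z - of_real (a + \<delta>))\<^sup>2)"
      proof eventually_elim
        case (elim \<delta>)
        show ?case
          by (rule wedge_bound_shifted[OF F _ _ d(3) _ zero _ C]) (use elim z d e1 d0 in auto)
      qed
    qed simp
    also have "Re (1 / (z - of_real (a + 0))\<^sup>2) \<le> 1 / (norm (z - of_real a))\<^sup>2"
      using complex_Re_le_cmod[of "1 / (z - of_real (a + 0))\<^sup>2"] by (simp add: norm_divide norm_power)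
    finally show ?thesis using e1 by (simp add: mult_left_mono)
  qed
  have l: "((\<lambda>z. Re z) \<longlongrightarrow> Re (of_real a)) (at (of_real a) within {z. a < Re z \<and> 0 < Im z})"
    "((\<lambda>z. Im z) \<longlongrightarrow> Im (of_real a)) (at (of_real a) within {z. a < Re z \<and> 0 < Im z})"
    "((\<lambda>z. C * (norm (z - of_real a))\<^sup>2) \<longlongrightarrow> C * (norm (of_real a - of_real a :: complex))\<^sup>2) (at (of_real a) within {z. a < Re z \<and> 0 < Im z})"
    by (intro tendsto_intros)+
  have "\<forall>\<^sub>F z in at (of_real a) within {z. a < Re z \<and> 0 < Im z}. Re z < a + d"
    by (rule order_tendstoD(2)[OF l(1)]) (use d in simp)
  moreover have "\<forall>\<^sub>F z in at (of_real a) within {z. a < Re z \<and> 0 < Im z}. Im z < d"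
    by (rule order_tendstoD(2)[OF l(2)]) (use d in simp)
  moreover have "\<forall>\<^sub>F z in at (of_real a) within {z. a < Re z \<and> 0 < Im z}. C * (norm (z - of_real a))\<^sup>2 < e / 2"
    by (rule order_tendstoD(2)[OF l(3)]) (use e in simp)
  moreover have "\<forall>\<^sub>F z in at (of_real a) within {z. a < Re z \<and> 0 < Im z}. a < Re z \<and> 0 < Im z"
    by (simp add: eventually_at_filter)
  ultimately show "\<forall>\<^sub>F z in at (of_real a) within {z. a < Re z \<and> 0 < Im z}. Re (F z) \<le> e / (norm (z - of_real a))\<^sup>2"
  proof eventually_elim
    case (elim z)
    define N where "N = (norm (z - of_real a))\<^sup>2"
    have N: "N = (Re z - a)\<^sup>2 + (Im z)\<^sup>2" by (simp add: N_def cmod_power2)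
    have N0: "N > 0" unfolding N using elim by (intro add_nonneg_pos) auto
    show ?case unfolding N_def[symmetric]
    proof (cases "Im z < (Re z - a) / 2")
      case True
      then have "Re (F z) \<le> C + 9 * e1 / N" using wedge elim by (simp add: N_def)
      also have "C \<le> (e / 2) / N" using elim N0 by (simp add: N_def[symmetric] field_simps)
      also have "(e / 2) / N + 9 * e1 / N \<le> e / N" using N0 e by (simp add: e1_def field_simps)
      finally show "Re (F z) \<le> e / N" by simp
    next
      case False
      have "(Re z - a)\<^sup>2 \<le> (2 * Im z)\<^sup>2" using False elim by (intro power_mono) auto
      then have "N \<le> 5 * (Im z)\<^sup>2" by (simp add: N power_mult_distrib)
      then have "5 / N \<ge> 1 / (Im z)\<^sup>2" using N0 elim by (simp add: field_simps)
      then have "e1 * (1 / (Im z)\<^sup>2) \<le> e1 * (5 / N)" using e1 by (intro mult_left_mono) auto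
      moreover have "Re (F z) \<le> e1 / (Im z)\<^sup>2" using elim d by (intro d0) auto
      moreover have "e1 * (5 / N) \<le> e / N" using N0 e by (simp add: e1_def field_simps)
      ultimately show "Re (F z) \<le> e / N" by simp
    qed
  qed
qed

text \<open>Reflection in the imaginary axis, with an outer conjugation that restores holomorphy. It
  exchanges left and right corners.\<close>

definition mirror :: "(complex \<Rightarrow> complex) \<Rightarrow> complex \<Rightarrow> complex" where
  "mirror F z = cnj (F (- cnj z))"

lemma Re_mirror [simp]: "Re (mirror F z) = Re (F (- cnj z))"
  by (simp add: mirror_def)

lemma mirror_holomorphic:
  assumes "F holomorphic_on upper"
  shows "mirror F holomorphic_on upper"
proof -
  have "(cnj \<circ> F \<circ> cnj) field_differentiable at z" if "Im z < 0" for z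
  proof (rule field_differentiable_cnj_cnj)
    show "F field_differentiable at (cnj z)"
      using holomorphic_on_imp_differentiable_at[OF assms open_upper] that by simp
  qed
  then have "(cnj \<circ> F \<circ> cnj) holomorphic_on {z. Im z < 0}"
    by (auto simp: holomorphic_on_def field_differentiable_at_within)
  then have "(cnj \<circ> F \<circ> cnj \<circ> uminus) holomorphic_on upper"
    by (rule holomorphic_on_compose_gen[rotated]) (auto intro: holomorphic_intros)
  moreover have "cnj \<circ> F \<circ> cnj \<circ> uminus = mirror F" by (auto simp: mirror_def)
  ultimately show ?thesis by simp
qed

lemma filterlim_mirror:
  assumes "\<And>z. z \<in> S \<Longrightarrow> - cnj z \<in> T"
  shows "filterlim (\<lambda>z. - cnj z) (at (- cnj c) within T) (at c within S)"
  unfolding filterlim_at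
proof
  show "((\<lambda>z. - cnj z) \<longlongrightarrow> - cnj c) (at c within S)" by (intro tendsto_intros)
  show "\<forall>\<^sub>F z in at c within S. - cnj z \<in> T \<and> - cnj z \<noteq> - cnj c"
    using assms by (auto simp: eventually_at_filter)
qed

lemma left_corner_of_mirror:
  assumes "right_corner (\<lambda>z. U (- cnj z)) (- b)"
  shows "left_corner U b"
  unfolding left_corner_def
proof (intro allI impI)
  fix e :: real assume e: "e > 0"
  have "filterlim (\<lambda>z. - cnj z) (at (- cnj (of_real b)) within {z. - b < Re z \<and> 0 < Im z}) (at (of_real b) within {z. Re z < b \<and> 0 < Im z})"
    by (rule filterlim_mirror) auto
  moreover have "\<forall>\<^sub>F z in at (- cnj (of_real b)) within {z. - b < Re z \<and> 0 < Im z}. U (- cnj z) \<le> e / (norm (z - of_real (- b)))\<^sup>2"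
    using assms e unfolding right_corner_def by simp
  ultimately have "\<forall>\<^sub>F z in at (of_real b) within {z. Re z < b \<and> 0 < Im z}. U (- cnj (- cnj z)) \<le> e / (norm (- cnj z - of_real (- b)))\<^sup>2"
    by (rule eventually_compose_filterlim[rotated])
  moreover have "norm (- cnj z - of_real (- b)) = norm (z - of_real b)" for z
  proof -
    have "- cnj z - of_real (- b) = - cnj (z - of_real b)" by simp
    then show ?thesis by (metis complex_mod_cnj norm_minus_cancel)
  qed
  ultimately show "\<forall>\<^sub>F z in at (of_real b) within {z. Re z < b \<and> 0 < Im z}. U z \<le> e / (norm (z - of_real b))\<^sup>2"
    by simp
qed

lemma left_corner_of_growth:
  assumes F: "F holomorphic_on upper" and ab: "a < b"
    and zero: "\<And>t e. a < t \<Longrightarrow> t < b \<Longrightarrow> e > 0 \<Longrightarrow> \<forall>\<^sub>F z in at (of_real t) within upper. Re (F z) \<le> e"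
    and growth: "\<And>e. e > 0 \<Longrightarrow> \<exists>d>0. \<forall>z. b - d < Re z \<and> Re z < b \<and> 0 < Im z \<and> Im z < d \<longrightarrow> Re (F z) \<le> e / (Im z)\<^sup>2"
  shows "left_corner (\<lambda>z. Re (F z)) b"
proof (rule left_corner_of_mirror)
  have "right_corner (\<lambda>z. Re (mirror F z)) (- b)"
  proof (rule right_corner_of_growth[OF mirror_holomorphic[OF F]])
    show "- b < - a" using ab by simp
    show "\<forall>\<^sub>F z in at (of_real t) within upper. Re (mirror F z) \<le> e" if "- b < t" "t < - a" "e > 0" for t e
    proof -
      have "filterlim (\<lambda>z. - cnj z) (at (- cnj (of_real t)) within upper) (at (of_real t) within upper)"
        by (rule filterlim_mirror) auto
      moreover have "\<forall>\<^sub>F z in at (of_real (- t)) within upper. Re (F z) \<le> e" using that by (intro zero) auto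
      then have "\<forall>\<^sub>F z in at (- cnj (of_real t)) within upper. Re (F z) \<le> e" by simp
      ultimately show ?thesis
        using eventually_compose_filterlim by fastforce
    qed
    fix e :: real assume "e > 0"
    then obtain d where "d > 0" "\<And>z. b - d < Re z \<and> Re z < b \<and> 0 < Im z \<and> Im z < d \<longrightarrow> Re (F z) \<le> e / (Im z)\<^sup>2"
      using growth by blast
    from this(1) this(2)[of "- cnj _"]
    show "\<exists>d>0. \<forall>z. - b < Re z \<and> Re z < - b + d \<and> 0 < Im z \<and> Im z < d \<longrightarrow> Re (mirror F z) \<le> e / (Im z)\<^sup>2"
      by (intro exI[of _ d]) auto
  qed
  then show "right_corner (\<lambda>z. Re (F (- cnj z))) (- b)" by simp
qed

text \<open>Harnack's inequality for \<open>C1 - F\<close> on the disc with centre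
  \<open>Complex x r\<close> that touches the real axis at \<open>x\<close>. The point at height
  \<open>y\<close> has distance \<open>y\<close> from its circle, which yields the factor
  \<open>1 / y\<close>.\<close>

lemma lower_bound_of_upper_bound:
  assumes F: "F holomorphic_on upper" and pq: "p < p'" "q' < q" and s: "s > 0"
    and up: "\<And>x y. p \<le> x \<Longrightarrow> x \<le> q \<Longrightarrow> 0 < y \<Longrightarrow> y < s \<Longrightarrow> Re (F (Complex x y)) \<le> C"
  obtains r B where "r > 0" "\<And>x y. p' \<le> x \<Longrightarrow> x \<le> q' \<Longrightarrow> 0 < y \<Longrightarrow> y < r \<Longrightarrow> - Re (F (Complex x y)) \<le> B / y"
proof -
  define r where "r = min (min (p' - p) (q - q')) (s / 2)"
  have r: "r > 0" "r \<le> p' - p" "r \<le> q - q'" "2 * r \<le> s" using pq s by (auto simp: r_def min_def)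
  obtain B where B: "B \<ge> 0" "\<And>x. p' \<le> x \<Longrightarrow> x \<le> q' \<Longrightarrow> \<bar>Re (F (Complex x r))\<bar> \<le> B"
    using Re_bounded_on_segment[OF F r(1)] by metis
  define C1 where "C1 = \<bar>C\<bar> + 1"
  show ?thesis
  proof (rule that[of r "2 * r * (C1 + B)"])
    fix x y assume xy: "p' \<le> x" "x \<le> q'" "0 < y" "y < r"
    define c where "c = Complex x r"
    have inb: "p \<le> Re z \<and> Re z \<le> q \<and> 0 < Im z \<and> Im z < s" if "z \<in> ball c r" for z
    proof -
      have "\<bar>Re (z - c)\<bar> < r" "\<bar>Im (z - c)\<bar> < r"
        using that abs_Re_le_cmod[of "z - c"] abs_Im_le_cmod[of "z - c"] by (auto simp: dist_norm norm_minus_commute)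
      then show ?thesis using xy r by (auto simp: c_def abs_less_iff)
    qed
    have dst: "dist c (Complex x y) = r - y"
      using xy by (simp add: c_def dist_norm complex_diff cmod_def)
    have "Re (of_real C1 - F (Complex x y)) * (r - dist c (Complex x y)) \<le> Re (of_real C1 - F c) * (r + dist c (Complex x y))"
    proof (rule Harnack)
      show "(\<lambda>z. of_real C1 - F z) holomorphic_on ball c r"
        by (intro holomorphic_intros holomorphic_on_subset[OF F]) (use inb in auto)
      show "Re (of_real C1 - F z) > 0" if "z \<in> ball c r" for z
        using up[of "Re z" "Im z"] inb[OF that] by (simp add: C1_def)
      show "Complex x y \<in> ball c r" using dst xy by simp
    qed (use r in simp)
    then have "(C1 - Re (F (Complex x y))) * y \<le> (C1 - Re (F c)) * (2 * r - y)"
      unfolding dst by simp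
    also have "\<dots> \<le> (C1 + B) * (2 * r)"
      using B(2)[OF xy(1,2)] B(1) xy by (intro mult_mono) (auto simp: c_def C1_def abs_le_iff)
    finally have "C1 - Re (F (Complex x y)) \<le> 2 * r * (C1 + B) / y"
      using xy by (simp add: field_simps)
    then show "- Re (F (Complex x y)) \<le> 2 * r * (C1 + B) / y" by (simp add: C1_def)
  qed (use r in simp)
qed

theorem vanishing_everywhere_one_sided:
  assumes F: "F holomorphic_on upper"
    and vert: "\<And>x. ((\<lambda>y. Re (F (Complex x y))) \<longlongrightarrow> 0) (at_right 0)"
    and growth: "\<And>e. e > 0 \<Longrightarrow> \<exists>d>0. \<forall>z. 0 < Im z \<and> Im z < d \<longrightarrow> Re (F z) \<le> e / (Im z)\<^sup>2"
  shows "boundary_zero (\<lambda>z. Re (F z)) t"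
proof -
  let ?G = "vanishing_set (\<lambda>z. Re (F z))"
  have "t \<in> ?G"
  proof (rule ccontr)
    assume "t \<notin> ?G"
    then obtain p x q s0 where x: "p < x" "x < q" "x \<notin> ?G" "s0 > 0" and
      K: "\<And>t y. t \<notin> ?G \<Longrightarrow> p \<le> t \<Longrightarrow> t \<le> q \<Longrightarrow> 0 < y \<Longrightarrow> y \<le> s0 \<Longrightarrow> \<bar>Re (F (Complex t y))\<bar> \<le> 1"
      using vertical_bound_on_exceptional_set[OF F vert] by metis
    have pq: "p < q" using x by simp
    have lims: "\<forall>\<^sub>F z in at (of_real u) within upper. \<bar>Re (F z)\<bar> \<le> e"
      if "u \<in> ?G" "e > 0" for u e
      using tendsto_imp_limsup_le[OF vanishing_set_imp_boundary_zero[OF that(1)], of 0 e] that by simp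
    have lims1: "\<forall>\<^sub>F z in at (of_real u) within upper. Re (F z) \<le> e"
      "\<forall>\<^sub>F z in at (of_real u) within upper. Re (- F z) \<le> e" if "u \<in> ?G" "e > 0" for u e
      using lims[OF that] by (auto elim: eventually_mono)
    have c1: "right_corner (\<lambda>z. Re (F z)) a \<and> left_corner (\<lambda>z. Re (F z)) b"
      if "a < b" "{a<..<b} \<subseteq> ?G" for a b
    proof
      show "right_corner (\<lambda>z. Re (F z)) a"
      proof (rule right_corner_of_growth[OF F that(1)])
        show "\<exists>d>0. \<forall>z. a < Re z \<and> Re z < a + d \<and> 0 < Im z \<and> Im z < d \<longrightarrow> Re (F z) \<le> e / (Im z)\<^sup>2"
          if "e > 0" for e using growth[OF that] by blast
      qed (rule lims1(1); use that in auto)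
      show "left_corner (\<lambda>z. Re (F z)) b"
      proof (rule left_corner_of_growth[OF F that(1)])
        show "\<exists>d>0. \<forall>z. b - d < Re z \<and> Re z < b \<and> 0 < Im z \<and> Im z < d \<longrightarrow> Re (F z) \<le> e / (Im z)\<^sup>2"
          if "e > 0" for e using growth[OF that] by blast
      qed (rule lims1(1); use that in auto)
    qed
    obtain s C where s: "s > 0" "\<And>x y. p \<le> x \<Longrightarrow> x \<le> q \<Longrightarrow> 0 < y \<Longrightarrow> y < s \<Longrightarrow> Re (F (Complex x y)) \<le> C"
      by (rule exceptional_box_bound[OF F vert refl pq x(4) K]) (use c1 in auto)
    \<comment> \<open>The discs of Harnack's inequality need room on both sides, hence a smaller
      interval around \<open>x\<close>.\<close>
    define p' q' where "p' = (p + x) / 2" and "q' = (x + q) / 2"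
    have pq': "p < p'" "p' < x" "x < q'" "q' < q" "p' < q'" using x by (auto simp: p'_def q'_def)
    obtain r B where r: "r > 0" "\<And>x y. p' \<le> x \<Longrightarrow> x \<le> q' \<Longrightarrow> 0 < y \<Longrightarrow> y < r \<Longrightarrow> - Re (F (Complex x y)) \<le> B / y"
      by (rule lower_bound_of_upper_bound[OF F pq'(1,4) s(1), where C = C]) (use s(2) in auto)
    have F': "(\<lambda>z. - F z) holomorphic_on upper" using F by (intro holomorphic_intros)
    have vert': "((\<lambda>y. Re (- F (Complex x y))) \<longlongrightarrow> 0) (at_right 0)" for x
      using tendsto_minus[OF vert[of x]] by simp
    have K': "\<bar>Re (- F (Complex t y))\<bar> \<le> 1" if "t \<notin> ?G" "p' \<le> t" "t \<le> q'" "0 < y" "y \<le> s0" for t y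
      using K[of t y] that pq' by simp
    \<comment> \<open>The cap \<open>m\<close> keeps the strip next to a corner inside its
      complementary interval, and so between \<open>p'\<close> and \<open>q'\<close>.\<close>
    have gr': "\<exists>d>0. d \<le> m \<and> (\<forall>z. p' \<le> Re z \<and> Re z \<le> q' \<and> 0 < Im z \<and> Im z < d \<longrightarrow> Re (- F z) \<le> e / (Im z)\<^sup>2)"
      if e: "e > 0" and m: "m > 0" for e m
    proof -
      \<comment> \<open>\<open>Im z * (\<bar>B\<bar> + 1) \<le> e\<close> is what turns
        \<open>B / Im z\<close> into \<open>e / (Im z)\<^sup>2\<close>.\<close>
      define d where "d = min m (min r (e / (\<bar>B\<bar> + 1)))"
      have d: "d > 0" "d \<le> m" "d \<le> r" "d \<le> e / (\<bar>B\<bar> + 1)" using e r m by (auto simp: d_def)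
      have "Re (- F z) \<le> e / (Im z)\<^sup>2" if z: "p' \<le> Re z" "Re z \<le> q'" "0 < Im z" "Im z < d" for z
      proof -
        have "- Re (F z) \<le> B / Im z" using r(2)[of "Re z" "Im z"] z d by simp
        also have "\<dots> \<le> e / (Im z)\<^sup>2"
        proof -
          have "Im z * (\<bar>B\<bar> + 1) \<le> e"
            using mult_right_mono[of "Im z" "e / (\<bar>B\<bar> + 1)" "\<bar>B\<bar> + 1"] z d by simp
          moreover have "Im z * B \<le> Im z * (\<bar>B\<bar> + 1)" using z by (intro mult_left_mono) auto
          ultimately have "B * Im z \<le> e" by (simp add: mult.commute)
          then show ?thesis using z by (simp add: field_simps power2_eq_square)
        qed
        finally show ?thesis by simp
      qed
      then show ?thesis using d by blast
    qed
    have c2: "right_corner (\<lambda>z. Re (- F z)) a \<and> left_corner (\<lambda>z. Re (- F z)) b"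
      if ab: "p' \<le> a" "a < b" "b \<le> q'" "{a<..<b} \<subseteq> ?G" for a b
    proof
      have m: "b - a > 0" using ab by simp
      show "right_corner (\<lambda>z. Re (- F z)) a"
      proof (rule right_corner_of_growth[OF F' ab(2)])
        show "\<exists>d>0. \<forall>z. a < Re z \<and> Re z < a + d \<and> 0 < Im z \<and> Im z < d \<longrightarrow> Re (- F z) \<le> e / (Im z)\<^sup>2"
          if e: "e > 0" for e
        proof -
          obtain d where "d > 0" "d \<le> b - a" "\<forall>z. p' \<le> Re z \<and> Re z \<le> q' \<and> 0 < Im z \<and> Im z < d \<longrightarrow> Re (- F z) \<le> e / (Im z)\<^sup>2"
            using gr'[OF e m] by blast
          then show ?thesis using ab by (intro exI[of _ d]) auto
        qed
      qed (rule lims1(2); use ab in auto)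
      show "left_corner (\<lambda>z. Re (- F z)) b"
      proof (rule left_corner_of_growth[OF F' ab(2)])
        show "\<exists>d>0. \<forall>z. b - d < Re z \<and> Re z < b \<and> 0 < Im z \<and> Im z < d \<longrightarrow> Re (- F z) \<le> e / (Im z)\<^sup>2"
          if e: "e > 0" for e
        proof -
          obtain d where "d > 0" "d \<le> b - a" "\<forall>z. p' \<le> Re z \<and> Re z \<le> q' \<and> 0 < Im z \<and> Im z < d \<longrightarrow> Re (- F z) \<le> e / (Im z)\<^sup>2"
            using gr'[OF e m] by blast
          then show ?thesis using ab by (intro exI[of _ d]) auto
        qed
      qed (rule lims1(2); use ab in auto)
    qed
    obtain s' C' where s': "s' > 0" "\<And>x y. p' \<le> x \<Longrightarrow> x \<le> q' \<Longrightarrow> 0 < y \<Longrightarrow> y < s' \<Longrightarrow> Re (- F (Complex x y)) \<le> C'"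
      by (rule exceptional_box_bound[OF F' vert' vanishing_set_uminus[symmetric] pq'(5) x(4) K']) (use c2 in auto)
    have "boundary_zero (\<lambda>z. Re (F z)) u" if u: "p' < u" "u < q'" for u
    proof (rule bounded_imp_boundary_zero[OF F vert _ _ u])
      show "min s s' > 0" using s s' by simp
      show "\<bar>Re (F (Complex x y))\<bar> \<le> max C C'" if "p' < x" "x < q'" "0 < y" "y < min s s'" for x y
        using s(2)[of x y] s'(2)[of x y] that pq' by (auto simp: abs_le_iff)
    qed
    then have "{p'<..<q'} \<subseteq> ?G" unfolding vanishing_set_def by (intro interior_maximal) auto
    then have "x \<in> ?G" using pq' by auto
    then show False using x by blast
  qed
  then show ?thesis by (rule vanishing_set_imp_boundary_zero)
qed

subsection \<open>Reflection of the derivative\<close>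

text \<open>For real \<open>x\<close> the value \<open>Arctan (- \<i> * x)\<close> is purely
  imaginary if \<open>\<bar>x\<bar> \<le> 1 / 2\<close>, and the derivative is at most 2 on the disc
  of radius \<open>1 / 2\<close>; the mean value inequality over the distance \<open>Im w\<close>
  does the rest.\<close>

lemma Re_Arctan_le:
  assumes w: "norm w \<le> 1 / 2" "Im w \<ge> 0"
  shows "Re (Arctan (- \<i> * w)) \<le> 2 * Im w"
proof -
  let ?S = "cball 0 (1 / 2) :: complex set"
  have der: "(Arctan has_field_derivative inverse (1 + z\<^sup>2)) (at z within ?S)" if "z \<in> ?S" for z
  proof (rule has_field_derivative_at_within, rule has_field_derivative_Arctan)
    show "\<bar>Im z\<bar> < 1" using that abs_Im_le_cmod[of z] by simp
  qed
  have bd: "norm (inverse (1 + z\<^sup>2)) \<le> 2" if "z \<in> ?S" for z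
  proof -
    have "norm (z\<^sup>2) \<le> (1 / 2)\<^sup>2" using that unfolding norm_power by (intro power_mono) auto
    moreover have "1 \<le> norm (1 + z\<^sup>2) + norm (z\<^sup>2)"
      using norm_triangle_ineq4[of "1 + z\<^sup>2" "z\<^sup>2"] by simp
    ultimately have "1 / 2 \<le> norm (1 + z\<^sup>2)" by (simp add: power2_eq_square)
    then show ?thesis
      using le_imp_inverse_le[of "1 / 2" "norm (1 + z\<^sup>2)"] by (simp add: norm_inverse)
  qed
  let ?x = "of_real (Re w) :: complex"
  have xin: "\<bar>Re w\<bar> \<le> 1 / 2" using w abs_Re_le_cmod[of w] by linarith
  have in_S: "- \<i> * w \<in> ?S" "- \<i> * ?x \<in> ?S" using w xin by (auto simp: norm_mult)
  have "norm (Arctan (- \<i> * w) - Arctan (- \<i> * ?x)) \<le> 2 * norm (- \<i> * w - - \<i> * ?x)"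
    by (rule field_differentiable_bound[OF convex_cball der bd in_S])
  also have "- \<i> * w - - \<i> * ?x = of_real (Im w)" by (simp add: complex_eq_iff)
  finally have "norm (Arctan (- \<i> * w) - Arctan (- \<i> * ?x)) \<le> 2 * Im w" using w by simp
  moreover have "Re (Arctan (- \<i> * ?x)) = 0"
  proof -
    have "(1 - \<i> * (- \<i> * ?x)) / (1 + \<i> * (- \<i> * ?x)) = of_real ((1 - Re w) / (1 + Re w))"
      by (simp add: algebra_simps)
    moreover have "(1 - Re w) / (1 + Re w) > 0" using xin by (auto simp: abs_le_iff)
    ultimately show ?thesis unfolding Arctan_def by (simp del: of_real_divide add: Ln_of_real)
  qed
  ultimately show ?thesis
    using complex_Re_le_cmod[of "Arctan (- \<i> * w) - Arctan (- \<i> * ?x)"] by simp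
qed

text \<open>The harmonic measure of the half circle dominates \<open>Re F\<close> on the half disc.\<close>

lemma linear_decay_at_boundary:
  assumes F: "F holomorphic_on upper" and r: "r > 0"
    and le1: "\<And>z. z \<in> upper \<Longrightarrow> dist z (of_real x0) \<le> r \<Longrightarrow> Re (F z) \<le> 1"
    and zero: "\<And>t e. \<bar>t - x0\<bar> \<le> r \<Longrightarrow> e > 0 \<Longrightarrow> \<forall>\<^sub>F z in at (of_real t) within upper. Re (F z) \<le> e"
    and z: "z \<in> upper" "dist z (of_real x0) < r / 2"
  shows "Re (F z) \<le> 3 * Im z / r"
proof -
  define D where "D = ball (of_real x0) r \<inter> upper"
  define w where "w z = (z - of_real x0) / of_real r" for z :: complex
  define A where "A z = Arctan (- \<i> * w z)" for z
  define G where "G z = F z - of_real (4 / pi) * A z" for z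
  have Rew: "Re (- \<i> * w z) = Im z / r" for z by (simp add: w_def)
  have D: "open D" "bounded D" "D \<subseteq> upper"
    by (auto simp: D_def open_upper intro: bounded_subset[OF bounded_ball])
  have A: "A holomorphic_on upper"
  proof -
    have "(Arctan \<circ> (\<lambda>z. - \<i> * w z)) holomorphic_on upper"
    proof (rule holomorphic_on_compose)
      show "(\<lambda>z. - \<i> * w z) holomorphic_on upper" unfolding w_def using r by (intro holomorphic_intros) auto
      have "Re u > 0" if "u \<in> (\<lambda>z. - \<i> * w z) ` upper" for u using that Rew r by auto
      then show "Arctan holomorphic_on (\<lambda>z. - \<i> * w z) ` upper"
        by (intro holomorphic_on_Arctan) force
    qed
    then show ?thesis by (simp add: A_def[abs_def] o_def)
  qed
  have G: "G holomorphic_on upper" unfolding G_def by (intro holomorphic_intros F A)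
  have ReG: "Re (G z) = Re (F z) - 4 / pi * Re (A z)" for z by (simp add: G_def)
  have A0: "Re (A z) \<ge> 0" if "z \<in> upper" for z
    unfolding A_def using that r Rew[of z] by (intro Re_Arctan_nonneg) simp
  have "closure D \<subseteq> cball (of_real x0) r \<inter> {z. 0 \<le> Im z}"
    by (intro closure_minimal closed_Int closed_cball closed_Collect_le continuous_intros) (auto simp: D_def)
  then have cl: "\<And>\<xi>. \<xi> \<in> closure D \<Longrightarrow> dist \<xi> (of_real x0) \<le> r \<and> 0 \<le> Im \<xi>" by (auto simp: dist_commute)
  have "Re (G z) \<le> 0"
  proof (rule Re_le_if_limsup_frontier_le[OF D(1,2), where F = G])
    show "G holomorphic_on D" using G D(3) by (rule holomorphic_on_subset)
    show "z \<in> D" using z r by (auto simp: D_def dist_commute)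
    fix \<xi> and e :: real assume \<xi>: "\<xi> \<in> frontier D" and e: "e > 0"
    have f: "dist \<xi> (of_real x0) \<le> r" "0 \<le> Im \<xi>" "\<xi> \<notin> D"
      using cl[of \<xi>] \<xi> D by (auto simp: frontier_def interior_open)
    show "\<forall>\<^sub>F z in at \<xi> within D. Re (G z) \<le> 0 + e"
    proof (cases "Im \<xi> = 0")
      case True
      then have eq: "\<xi> = of_real (Re \<xi>)" by (simp add: complex_eq_iff)
      have "dist \<xi> (of_real x0) = \<bar>Re \<xi> - x0\<bar>" by (subst eq) (simp add: dist_norm flip: of_real_diff)
      then have "\<forall>\<^sub>F z in at (of_real (Re \<xi>)) within upper. Re (F z) \<le> e" using f e by (intro zero) auto
      then have "\<forall>\<^sub>F z in at \<xi> within upper. Re (F z) \<le> e" using eq by simp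
      then have "\<forall>\<^sub>F z in at \<xi> within D. Re (F z) \<le> e" by (rule filter_leD[OF at_le[OF D(3)]])
      moreover have "\<forall>\<^sub>F z in at \<xi> within D. z \<in> D" by (simp add: eventually_at_filter)
      ultimately show ?thesis
      proof eventually_elim
        case (elim z)
        have "4 / pi * Re (A z) \<ge> 0" using A0 elim D(3) by (intro mult_nonneg_nonneg) auto
        then show ?case using elim by (simp add: ReG)
      qed
    next
      case False
      then have im: "Im \<xi> > 0" using f by simp
      then have d: "dist \<xi> (of_real x0) = r" using f by (auto simp: D_def dist_commute)
      have "Re (A \<xi>) = pi / 4" unfolding A_def
      proof (rule Re_Arctan_unit_circle)
        show "Re (- \<i> * w \<xi>) > 0" using im r Rew by simp
        show "norm (- \<i> * w \<xi>) = 1" using d r by (simp add: w_def norm_mult norm_divide dist_norm)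
      qed
      then have "4 / pi * Re (A \<xi>) = 1" by simp
      then have "Re (G \<xi>) \<le> 0" unfolding ReG using le1[of \<xi>] im d by simp
      then show ?thesis by (intro eventually_Re_le_of_isCont isCont_upper G im e)
    qed
  qed
  moreover have "Re (A z) \<le> 2 * Im (w z)"
    unfolding A_def using z r by (intro Re_Arctan_le) (auto simp: w_def norm_divide dist_norm)
  moreover have "Im (w z) = Im z / r" by (simp add: w_def)
  ultimately have "Re (F z) \<le> 4 / pi * (2 * (Im z / r))"
    unfolding ReG using mult_left_mono[of "Re (A z)" "2 * Im (w z)" "4 / pi"] by simp
  also have "\<dots> \<le> 3 * Im z / r"
  proof -
    \<comment> \<open>\<open>4 / pi\<close> normalises the harmonic measure and the 2 is that of
      \<open>Re_Arctan_le\<close>.\<close>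
    have "8 / pi \<le> 3" using pi_approx by (simp add: divide_le_eq)
    then have "8 / pi * (Im z / r) \<le> 3 * (Im z / r)" using z r by (intro mult_right_mono) auto
    then show ?thesis by simp
  qed
  finally show ?thesis .
qed

lemma boundary_zero_uminus: "boundary_zero (\<lambda>z. Re (F z)) t \<Longrightarrow> boundary_zero (\<lambda>z. Re (- F z)) t"
  using tendsto_minus[of "\<lambda>z. Re (F z)" 0] by simp

lemma boundary_zero_limsup:
  assumes "boundary_zero (\<lambda>z. Re (F z)) t" "e > 0"
  shows "\<forall>\<^sub>F z in at (of_real t) within upper. Re (F z) \<le> e"
  using tendsto_imp_limsup_le[OF assms(1), of 0 e] assms(2) by (auto elim: eventually_mono)

lemma at_upper_neq_bot: "at (of_real t) within upper \<noteq> bot"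
proof -
  have "of_real t \<in> closure upper"
  proof (unfold closure_approachable, intro allI impI)
    fix e :: real assume "e > 0"
    then show "\<exists>y\<in>upper. dist y (of_real t) < e"
      by (intro bexI[of _ "Complex t (e / 2)"]) (auto simp: dist_norm complex_of_real_def complex_diff cmod_def)
  qed
  then show ?thesis by (auto simp: trivial_limit_within closure_def)
qed

text \<open>The real part decays linearly, so it is at most \<open>6 * Im z / r\<close> on the disc
  of radius \<open>Im z\<close> about \<open>z\<close>, and the derivative is bounded near
  \<open>x0\<close>. Hence \<open>F\<close> is Lipschitz on a half disc and extends continuously.
  Schwarz reflection needs this for the imaginary part, of which nothing is assumed.\<close>

lemma boundary_limit_exists:
  assumes F: "F holomorphic_on upper" and x0: "a < x0" "x0 < b"
    and zero: "\<And>t. a < t \<Longrightarrow> t < b \<Longrightarrow> boundary_zero (\<lambda>z. Re (F z)) t"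
  obtains l where "(F \<longlongrightarrow> l) (at (of_real x0) within upper)" "Re l = 0"
proof -
  have "\<forall>\<^sub>F z in at (of_real x0) within upper. \<bar>Re (F z)\<bar> \<le> 0 + 1"
    by (rule tendsto_imp_limsup_le[OF zero]) (use x0 in auto)
  then obtain d where d: "d > 0" "\<And>z. z \<in> upper \<Longrightarrow> z \<noteq> of_real x0 \<Longrightarrow> dist z (of_real x0) < d \<Longrightarrow> \<bar>Re (F z)\<bar> \<le> 1"
    unfolding eventually_at by auto
  define r where "r = min (d / 2) (min ((x0 - a) / 2) ((b - x0) / 2))"
  have r: "r > 0" "r < d" "r < x0 - a" "r < b - x0" using d x0 by (auto simp: r_def min_def)
  have F': "(\<lambda>z. - F z) holomorphic_on upper" using F by (intro holomorphic_intros)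
  have le1: "\<bar>Re (F z)\<bar> \<le> 1" if "z \<in> upper" "dist z (of_real x0) \<le> r" for z
    using that r by (intro d) auto
  have lin: "\<bar>Re (F z)\<bar> \<le> 3 * Im z / r" if z: "z \<in> upper" "dist z (of_real x0) < r / 2" for z
  proof -
    have "Re (F z) \<le> 3 * Im z / r"
    proof (rule linear_decay_at_boundary[OF F r(1) _ _ z])
      show "Re (F z) \<le> 1" if "z \<in> upper" "dist z (of_real x0) \<le> r" for z using le1[OF that] by simp
      show "\<forall>\<^sub>F z in at (of_real t) within upper. Re (F z) \<le> e" if "\<bar>t - x0\<bar> \<le> r" "e > 0" for t e
        by (rule boundary_zero_limsup[OF zero]) (use that r in \<open>auto simp: abs_le_iff\<close>)
    qed
    moreover have "Re (- F z) \<le> 3 * Im z / r"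
    proof (rule linear_decay_at_boundary[OF F' r(1) _ _ z])
      show "Re (- F z) \<le> 1" if "z \<in> upper" "dist z (of_real x0) \<le> r" for z using le1[OF that] by simp
      show "\<forall>\<^sub>F z in at (of_real t) within upper. Re (- F z) \<le> e" if "\<bar>t - x0\<bar> \<le> r" "e > 0" for t e
        by (rule boundary_zero_limsup[OF boundary_zero_uminus[OF zero]]) (use that r in \<open>auto simp: abs_le_iff\<close>)
    qed
    ultimately show ?thesis by simp
  qed
  define X where "X = ball (of_real x0) (r / 4) \<inter> upper"
  have dF: "norm (deriv F z) \<le> 36 / r" if "z \<in> X" for z
  proof -
    have z: "dist z (of_real x0) < r / 4" "Im z > 0" using that by (auto simp: X_def dist_commute)
    have "Im z \<le> dist z (of_real x0)" using abs_Im_le_cmod[of "z - of_real x0"] by (simp add: dist_norm)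
    then have Imz: "Im z < r / 4" using z by simp
    have inb: "Im w > 0 \<and> Im w < 2 * Im z \<and> dist w (of_real x0) < r / 2" if "w \<in> ball z (Im z)" for w
    proof -
      have "\<bar>Im (z - w)\<bar> < Im z" using abs_Im_le_cmod[of "z - w"] that by (simp add: dist_norm)
      moreover have "dist w (of_real x0) < r / 2" using that z Imz by metric
      ultimately show ?thesis by auto
    qed
    have "norm (deriv F z) \<le> 6 * (6 * Im z / r) / Im z"
    proof (rule norm_deriv_le_of_Re_bounded)
      show "F holomorphic_on ball z (Im z)" using F by (rule holomorphic_on_subset) (use inb in auto)
      show "\<bar>Re (F w)\<bar> \<le> 6 * Im z / r" if "w \<in> ball z (Im z)" for w
      proof -
        have "\<bar>Re (F w)\<bar> \<le> 3 * Im w / r" using inb[OF that] by (intro lin) auto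
        also have "\<dots> \<le> 6 * Im z / r" using inb[OF that] r by (intro divide_right_mono) auto
        finally show ?thesis .
      qed
    qed (use z r in auto)
    then show ?thesis using z by simp
  qed
  have cX: "convex X" by (simp add: X_def convex_Int convex_halfspace_Im_gt)
  have lip: "norm (F z - F w) \<le> 36 / r * norm (z - w)" if "z \<in> X" "w \<in> X" for z w
  proof (rule field_differentiable_bound[OF cX _ dF that])
    show "(F has_field_derivative deriv F z) (at z within X)" if "z \<in> X" for z
      by (rule holomorphic_derivI[OF F open_upper]) (use that in \<open>simp add: X_def\<close>)
  qed
  have "(36 / r)-lipschitz_on X F"
    using lip r by (intro lipschitz_onI) (auto simp: dist_norm)
  then have "uniformly_continuous_on X F" by (rule lipschitz_on_uniformly_continuous)
  moreover have eqX: "\<forall>\<^sub>F z in at (of_real x0). (z \<in> X) = (z \<in> upper)"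
  proof -
    have "\<forall>\<^sub>F z in at (of_real x0). z \<in> ball (of_real x0) (r / 4)"
      using r by (intro eventually_at_in_open') auto
    then show ?thesis by eventually_elim (simp add: X_def)
  qed
  have "of_real x0 \<in> closure X"
  proof -
    have "\<exists>y\<in>X. dist y (of_real x0) < e" if "e > 0" for e
    proof
      let ?y = "Complex x0 (min (e / 2) (r / 8))"
      have "dist ?y (of_real x0) = min (e / 2) (r / 8)"
        using that r by (simp add: dist_norm complex_of_real_def complex_diff cmod_def)
      then show "dist ?y (of_real x0) < e" "?y \<in> X"
        using that r by (auto simp: X_def dist_commute min_def)
    qed
    then show ?thesis by (simp add: closure_approachable)
  qed
  ultimately obtain l where "(F \<longlongrightarrow> l) (at (of_real x0) within X)"
    using uniformly_continuous_on_extension_at_closure by blast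
  then have l: "(F \<longlongrightarrow> l) (at (of_real x0) within upper)"
    using Lim_transform_within_set_eq[OF eqX] by blast
  have "Re l = 0"
    using tendsto_unique[OF at_upper_neq_bot tendsto_Re[OF l] zero[OF x0]] .
  with l show ?thesis by (rule that)
qed

definition slit :: "real \<Rightarrow> complex set" where
  "slit \<eta> = {z. Im z \<noteq> 0 \<or> (0 < Re z \<and> Re z < \<eta>)}"

lemma open_slit: "open (slit \<eta>)"
proof -
  have "slit \<eta> = {z. Im z < 0} \<union> {z. 0 < Im z} \<union> ({z. 0 < Re z} \<inter> {z. Re z < \<eta>})"
    by (auto simp: slit_def)
  also have "open \<dots>" by (intro open_Un open_Int open_Collect_less continuous_intros)
  finally show ?thesis .
qed

text \<open>\<open>\<i> * F\<close> has real boundary values on the interval, so Schwarz's principle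
  applies, and the result is differentiated. The derivative is the right object because bounds for
  \<open>Re F\<close> near a point control it there, while they say nothing about
  \<open>Im F\<close>.\<close>

theorem derivative_reflection:
  assumes F: "F holomorphic_on upper"
    and zero: "\<And>t. 0 < t \<Longrightarrow> t < \<eta> \<Longrightarrow> boundary_zero (\<lambda>z. Re (F z)) t"
  obtains g where "g holomorphic_on slit \<eta>" "\<And>z. Im z > 0 \<Longrightarrow> g z = deriv F z"
    "\<And>z. norm (g (cnj z)) = norm (g z)"
proof -
  \<comment> \<open>A choice of the boundary limit; the factor \<open>\<i>\<close> in
    \<open>f\<close> makes it real.\<close>
  define L where "L z = (SOME l. (F \<longlongrightarrow> l) (at z within upper) \<and> Re l = 0)" for z
  have L: "(F \<longlongrightarrow> L (of_real t)) (at (of_real t) within upper)" "Re (L (of_real t)) = 0" if "0 < t" "t < \<eta>" for t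
  proof -
    have "\<exists>l. (F \<longlongrightarrow> l) (at (of_real t) within upper) \<and> Re l = 0"
      using boundary_limit_exists[OF F that zero] by metis
    from someI_ex[OF this]
    show "(F \<longlongrightarrow> L (of_real t)) (at (of_real t) within upper)" "Re (L (of_real t)) = 0" by (auto simp: L_def)
  qed
  define f where "f z = \<i> * (if Im z > 0 then F z else L z)" for z
  define R where "R z = (if 0 \<le> Im z then f z else cnj (f (cnj z)))" for z
  have "R holomorphic_on slit \<eta>"
    unfolding R_def
  proof (rule Schwarz_reflection[OF open_slit])
    show "cnj ` slit \<eta> \<subseteq> slit \<eta>" by (auto simp: slit_def)
    show "f holomorphic_on slit \<eta> \<inter> {z. 0 < Im z}"
    proof (rule holomorphic_transform)
      show "(\<lambda>z. \<i> * F z) holomorphic_on slit \<eta> \<inter> {z. 0 < Im z}"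
        by (intro holomorphic_intros holomorphic_on_subset[OF F]) auto
    qed (simp add: f_def)
    show "f z \<in> \<real>" if "z \<in> slit \<eta>" "z \<in> \<real>" for z
    proof -
      obtain t where t: "z = of_real t" using \<open>z \<in> \<real>\<close> by (auto elim: Reals_cases)
      then have "0 < t" "t < \<eta>" using that by (auto simp: slit_def)
      from L(2)[OF this] show ?thesis by (simp add: f_def t complex_is_Real_iff)
    qed
    show "continuous_on (slit \<eta> \<inter> {z. 0 \<le> Im z}) f"
      unfolding continuous_on_def
    proof
      fix x assume x: "x \<in> slit \<eta> \<inter> {z. 0 \<le> Im z}"
      show "(f \<longlongrightarrow> f x) (at x within slit \<eta> \<inter> {z. 0 \<le> Im z})"
      proof (cases "Im x > 0")
        case True
        have "isCont (\<lambda>z. \<i> * F z) x" using isCont_upper[OF F True] by (intro continuous_intros)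
        then have "((\<lambda>z. \<i> * F z) \<longlongrightarrow> \<i> * F x) (at x)" by (simp add: isCont_def)
        moreover have "\<forall>\<^sub>F z in at x. \<i> * F z = f z"
        proof -
          have "\<forall>\<^sub>F z in at x. z \<in> upper" using True open_upper by (intro eventually_at_in_open') auto
          then show ?thesis by eventually_elim (simp add: f_def)
        qed
        ultimately have "(f \<longlongrightarrow> \<i> * F x) (at x)" by (rule Lim_transform_eventually)
        moreover have "f x = \<i> * F x" using True by (simp add: f_def)
        ultimately show ?thesis by (metis tendsto_within_subset subset_UNIV)
      next
        case False
        then have "Im x = 0" using x by auto
        then obtain t where t: "x = of_real t" by (metis complex_is_Real_iff Reals_cases)
        then have t': "0 < t" "t < \<eta>" using x \<open>Im x = 0\<close> by (auto simp: slit_def)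
        show ?thesis
        proof (rule tendstoI)
          fix e :: real assume e: "e > 0"
          have "\<forall>\<^sub>F z in at x within upper. dist (F z) (L x) < e / 2"
            using tendstoD[OF L(1)[OF t'], of "e / 2"] e t by simp
          then obtain d where d: "d > 0" "\<And>z. z \<in> upper \<Longrightarrow> z \<noteq> x \<Longrightarrow> dist z x < d \<Longrightarrow> dist (F z) (L x) < e / 2"
            unfolding eventually_at by auto
          \<comment> \<open>Real and nonreal neighbours are both compared through values of
            \<open>F\<close> in the upper half plane: at a real \<open>z\<close> the value is a
            limit of such values, so the bound \<open>e / 2\<close> survives as a weak
            inequality.\<close>
          have key: "dist (f z) (f x) < e" if z: "z \<in> slit \<eta> \<inter> {z. 0 \<le> Im z}" "dist z x < d" for z
          proof (cases "Im z > 0")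
            case True
            then have "dist (F z) (L x) < e / 2" using z \<open>Im x = 0\<close> by (intro d(2)) auto
            moreover have "dist (f z) (f x) = dist (F z) (L x)"
              using True \<open>Im x = 0\<close> by (simp add: f_def dist_norm norm_mult flip: right_diff_distrib)
            ultimately show ?thesis using e by simp
          next
            case False
            then have "Im z = 0" using z by auto
            then obtain s where s: "z = of_real s" by (metis complex_is_Real_iff Reals_cases)
            then have s': "0 < s" "s < \<eta>" using z \<open>Im z = 0\<close> by (auto simp: slit_def)
            have l: "((\<lambda>w. dist (F w) (L x)) \<longlongrightarrow> dist (L z) (L x)) (at z within upper)"
              using L(1)[OF s'] s by (intro tendsto_intros) auto
            have "((\<lambda>w. dist w x) \<longlongrightarrow> dist z x) (at z within upper)" by (intro tendsto_intros)
            then have "\<forall>\<^sub>F w in at z within upper. dist w x < d" by (rule order_tendstoD(2)) (use z in simp)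
            moreover have "\<forall>\<^sub>F w in at z within upper. w \<in> upper" by (simp add: eventually_at_filter)
            ultimately have ev: "\<forall>\<^sub>F w in at z within upper. dist (F w) (L x) \<le> e / 2"
            proof eventually_elim
              case (elim w)
              then have "dist (F w) (L x) < e / 2" using \<open>Im x = 0\<close> by (intro d) auto
              then show ?case by simp
            qed
            have "dist (L z) (L x) \<le> e / 2"
              by (rule tendsto_upperbound[OF l ev]) (use at_upper_neq_bot[of s] s in simp)
            moreover have "dist (f z) (f x) = dist (L z) (L x)"
              using False \<open>Im x = 0\<close> by (simp add: f_def dist_norm norm_mult flip: right_diff_distrib)
            ultimately show ?thesis using e by simp
          qed
          show "\<forall>\<^sub>F z in at x within slit \<eta> \<inter> {z. 0 \<le> Im z}. dist (f z) (f x) < e"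
            unfolding eventually_at using d(1) key by blast
        qed
      qed
    qed
  qed
  then have dR: "deriv R holomorphic_on slit \<eta>" using open_slit by (rule holomorphic_deriv)
  have R: "R holomorphic_on slit \<eta>" by fact
  show ?thesis
  proof (rule that[of "\<lambda>z. deriv R z / \<i>"])
    show "(\<lambda>z. deriv R z / \<i>) holomorphic_on slit \<eta>" by (rule holomorphic_on_divide[OF dR holomorphic_on_const]) simp
    show "deriv R z / \<i> = deriv F z" if "Im z > 0" for z
    proof -
      have dF: "(F has_field_derivative deriv F z) (at z)"
        by (rule holomorphic_derivI[OF F open_upper]) (use that in simp)
      have "((\<lambda>z. \<i> * F z) has_field_derivative \<i> * deriv F z) (at z)" by (rule DERIV_cmult[OF dF])
      then have "(R has_field_derivative \<i> * deriv F z) (at z)"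
      proof (rule has_field_derivative_transform_within_open[OF _ open_upper])
        show "z \<in> upper" using that by simp
        show "\<i> * F w = R w" if "w \<in> upper" for w using that by (simp add: R_def f_def)
      qed
      then show ?thesis by (simp add: DERIV_imp_deriv)
    qed
    show "norm (deriv R (cnj z) / \<i>) = norm (deriv R z / \<i>)" for z
    proof (cases "Im z = 0")
      case True
      then have "cnj z = z" by (simp add: complex_eq_iff)
      then show ?thesis by simp
    next
      case False
      have Rc: "cnj (R (cnj w)) = R w" if "Im w \<noteq> 0" for w using that by (auto simp: R_def)
      have op: "open {w. Im w \<noteq> 0}"
        by (simp add: open_Collect_neq continuous_intros)
      have "(R has_field_derivative deriv R z) (at z)"
        by (rule holomorphic_derivI[OF R open_slit]) (use False in \<open>simp add: slit_def\<close>)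
      then have "(cnj \<circ> R \<circ> cnj has_field_derivative cnj (deriv R z)) (at (cnj z))"
        by (intro has_field_derivative_cnj_cnj) simp
      then have "(R has_field_derivative cnj (deriv R z)) (at (cnj z))"
        by (rule has_field_derivative_transform_within_open[OF _ op]) (use False Rc in auto)
      then have "deriv R (cnj z) = cnj (deriv R z)" by (rule DERIV_imp_deriv)
      then show ?thesis by (simp add: norm_divide norm_mult)
    qed
  qed
qed

text \<open>Integration of the derivative along the vertical segment. It starts at a height
  \<open>s\<close> that tends to 0, where the boundary limit takes over.\<close>

lemma Re_le_vertical:
  assumes F: "F holomorphic_on upper" and x: "boundary_zero (\<lambda>z. Re (F z)) x" and y: "y > 0"
    and B: "\<And>t. 0 < t \<Longrightarrow> t \<le> y \<Longrightarrow> norm (deriv F (Complex x t)) \<le> B"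
  shows "\<bar>Re (F (Complex x y))\<bar> \<le> B * y"
proof -
  have "\<bar>Re (F (Complex x y))\<bar> \<le> \<bar>Re (F (Complex x s))\<bar> + B * y" if s: "0 < s" "s < y" for s
  proof -
    have B0: "B \<ge> 0" using B[of y] y norm_ge_zero order_trans by blast
    let ?S = "closed_segment (Complex x s) (Complex x y)"
    have seg: "Re z = x \<and> s \<le> Im z \<and> Im z \<le> y" if "z \<in> ?S" for z
      using that s by (auto simp: closed_segment_same_Re closed_segment_eq_real_ivl)
    have "norm (F (Complex x y) - F (Complex x s)) \<le> B * norm (Complex x y - Complex x s)"
    proof (rule field_differentiable_bound[where S = ?S and f' = "deriv F"])
      show "(F has_field_derivative deriv F z) (at z within ?S)" if "z \<in> ?S" for z
        by (rule holomorphic_derivI[OF F open_upper]) (use seg[OF that] s in simp)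
      show "norm (deriv F z) \<le> B" if "z \<in> ?S" for z
        using B[of "Im z"] seg[OF that] s by (metis complex.collapse less_le_trans)
    qed auto
    also have "norm (Complex x y - Complex x s) = y - s" using s by (simp add: complex_diff cmod_def)
    also have "B * (y - s) \<le> B * y" using B0 s by (intro mult_left_mono) auto
    finally show ?thesis
      using abs_Re_le_cmod[of "F (Complex x y) - F (Complex x s)"] by simp
  qed
  then have ev: "\<forall>\<^sub>F s in at_right 0. \<bar>Re (F (Complex x y))\<bar> \<le> \<bar>Re (F (Complex x s))\<bar> + B * y"
    using y by (intro eventually_at_rightI[of 0 y]) auto
  have "filterlim (\<lambda>s. Complex x s) (at (of_real x) within upper) (at_right 0)"
    unfolding filterlim_at
  proof
    have "((\<lambda>s. Complex x s) \<longlongrightarrow> Complex x 0) (at_right 0)" by (intro tendsto_intros)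
    then show "((\<lambda>s. Complex x s) \<longlongrightarrow> of_real x) (at_right 0)" by (simp add: complex_of_real_def)
    show "\<forall>\<^sub>F s in at_right 0. Complex x s \<in> upper \<and> Complex x s \<noteq> of_real x"
      using eventually_at_right_less[of 0] by eventually_elim (auto simp: complex_eq_iff)
  qed
  from filterlim_compose[OF x this] have "((\<lambda>s. Re (F (Complex x s))) \<longlongrightarrow> 0) (at_right 0)" .
  then have "((\<lambda>s. \<bar>Re (F (Complex x s))\<bar> + B * y) \<longlongrightarrow> \<bar>0\<bar> + B * y) (at_right 0)"
    by (intro tendsto_intros)
  from tendsto_lowerbound[OF this ev] show ?thesis by simp
qed

subsection \<open>Growth of the reflected derivative at a corner\<close>

definition cpow :: "real \<Rightarrow> complex \<Rightarrow> complex" where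
  "cpow a z = exp (of_real a * Ln z)"

lemma norm_cpow: "z \<noteq> 0 \<Longrightarrow> norm (cpow a z) = norm z powr a"
  by (simp add: cpow_def powr_def)

lemma Re_cpow: "z \<noteq> 0 \<Longrightarrow> Re (cpow a z) = norm z powr a * cos (a * Arg z)"
  and Im_cpow: "z \<noteq> 0 \<Longrightarrow> Im (cpow a z) = norm z powr a * sin (a * Arg z)"
  by (simp_all add: cpow_def powr_def Re_exp Im_exp Arg_eq_Im_Ln)

lemma holomorphic_cpow: "cpow a holomorphic_on {z. 0 < Re z}"
  unfolding cpow_def[abs_def]
  by (intro holomorphic_intros) (auto simp: complex_nonpos_Reals_iff)

lemma abs_Arg_le:
  assumes "Re z > 0"
  shows "\<bar>Arg z\<bar> \<le> arctan (\<bar>Im z\<bar> / Re z)" "\<bar>Arg z\<bar> \<le> \<bar>Im z\<bar> / Re z"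
proof -
  have "Arg z = arctan (Im z / Re z)" using assms by (rule arg_conv_arctan)
  then have "\<bar>Arg z\<bar> = \<bar>arctan (Im z / Re z)\<bar>" by simp
  also have "\<dots> = arctan \<bar>Im z / Re z\<bar>"
    by (cases "Im z / Re z \<ge> 0") (auto simp: abs_if arctan_minus not_le)
  also have "\<bar>Im z / Re z\<bar> = \<bar>Im z\<bar> / Re z" using assms by simp
  finally have eq: "\<bar>Arg z\<bar> = arctan (\<bar>Im z\<bar> / Re z)" .
  show "\<bar>Arg z\<bar> \<le> arctan (\<bar>Im z\<bar> / Re z)" by (simp add: eq)
  show "\<bar>Arg z\<bar> \<le> \<bar>Im z\<bar> / Re z" unfolding eq by (rule arctan_le_self) (use assms in simp)
qed

lemma half_le_cos: "\<bar>x\<bar> \<le> pi / 3 \<Longrightarrow> 1 / 2 \<le> cos x" for x :: real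
  using cos_monotone_0_pi_le[of "\<bar>x\<bar>" "pi / 3"] by (simp add: cos_60)

lemma powr_quotient: "a > 0 \<Longrightarrow> b > 0 \<Longrightarrow> a powr r * b powr (- r) = (b / a) powr (- r)" for a b r :: real
  by (simp add: powr_minus powr_divide divide_simps)

lemma powr_le_of_le_root: "e > 0 \<Longrightarrow> k > 0 \<Longrightarrow> 0 < x \<Longrightarrow> x \<le> e powr (1 / k) \<Longrightarrow> x powr k \<le> e" for x e k :: real
  using powr_mono2[of k x "e powr (1 / k)"] by (simp add: powr_powr)

text \<open>
  Comparison with a translate: the vertex of the region sits at a point \<open>\<delta>\<close> where \<open>g\<close> is
  holomorphic, and then \<open>\<delta>\<close> tends to \<open>0\<close>.
\<close>

lemma bound_by_translation:
  fixes \<omega> :: "real \<Rightarrow> real"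
  assumes g: "g holomorphic_on slit \<eta>" and d: "0 < d" "d < \<eta>"
    and \<omega>: "continuous_on UNIV \<omega>" "mono \<omega>" "\<omega> 0 = 0"
    and B: "B holomorphic_on {z. 0 < Re z}"
    and B0: "\<And>z. 0 < Re z \<Longrightarrow> Re z < d \<Longrightarrow> \<bar>Im z\<bar> \<le> \<omega> (Re z) \<Longrightarrow> 0 \<le> Re (B z)"
    and bd: "\<And>\<delta> z. 0 < \<delta> \<Longrightarrow> 0 < Re z \<Longrightarrow> Re z + \<delta> \<le> d \<Longrightarrow> \<bar>Im z\<bar> = \<omega> (Re z) \<Longrightarrow>
      norm (g (z + of_real \<delta>)) \<le> exp (Re (B z))"
  obtains C where "C \<ge> 1" "\<And>z. 0 < Re z \<Longrightarrow> Re z < d \<Longrightarrow> \<bar>Im z\<bar> < \<omega> (Re z) \<Longrightarrow>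
      norm (g z) \<le> C * exp (Re (B z))"
proof -
  have contg: "isCont g z" if "z \<in> slit \<eta>" for z
    using holomorphic_on_imp_continuous_on[OF g] open_slit that by (auto simp: continuous_on_eq_continuous_at)
  have contB: "isCont B z" if "Re z > 0" for z
    using holomorphic_on_imp_continuous_on[OF B] open_halfspace_Re_gt[of 0] that by (auto simp: continuous_on_eq_continuous_at)
  have cont\<omega>: "isCont (\<lambda>z. \<omega> (Re z)) z" for z
  proof (rule isCont_o2[where f = Re and g = \<omega>])
    show "isCont Re z" by (simp add: isCont_def tendsto_Re)
    show "isCont \<omega> (Re z)" using \<omega>(1) by (simp add: continuous_on_eq_continuous_at)
  qed
  then have c\<omega>: "continuous_on UNIV (\<lambda>z. \<omega> (Re z))" by (simp add: continuous_at_imp_continuous_on)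
  \<comment> \<open>The translation carries the right edge of each shifted region into this fixed
    segment, so \<open>C\<close> does not depend on \<delta>.\<close>
  define S where "S = closed_segment (Complex d (- \<omega> d)) (Complex d (\<omega> d))"
  have \<omega>d: "\<omega> d \<ge> 0" using monoD[OF \<omega>(2), of 0 d] \<omega>(3) d by simp
  have Seg: "z \<in> S \<longleftrightarrow> Re z = d \<and> \<bar>Im z\<bar> \<le> \<omega> d" for z
    using \<omega>d by (auto simp: S_def closed_segment_same_Re closed_segment_eq_real_ivl abs_le_iff)
  have "S \<subseteq> slit \<eta>" using d by (auto simp: Seg slit_def)
  then have "compact (g ` S)" unfolding S_def
    by (intro compact_continuous_image compact_segment continuous_on_subset[OF holomorphic_on_imp_continuous_on[OF g]])
  from compact_imp_bounded[OF this] obtain M where M: "\<forall>z\<in>S. norm (g z) \<le> M"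
    unfolding bounded_iff by auto
  define C where "C = max 1 M"
  have C: "C \<ge> 1" "\<And>z. z \<in> S \<Longrightarrow> norm (g z) \<le> C" using M by (auto simp: C_def le_max_iff_disj)
  have shifted: "norm (g (z + of_real \<delta>)) \<le> C * exp (Re (B z))"
    if \<delta>: "0 < \<delta>" "\<delta> < d" and z: "0 < Re z" "Re z + \<delta> < d" "\<bar>Im z\<bar> < \<omega> (Re z)" for \<delta> z
  proof -
    define D where "D = {z. 0 < Re z \<and> Re z < d - \<delta> \<and> \<bar>Im z\<bar> < \<omega> (Re z)}"
    define G where "G z = g (z + of_real \<delta>) * exp (- B z) / of_real C" for z
    have "D = {z. 0 < Re z} \<inter> {z. Re z < d - \<delta>} \<inter> {z. \<bar>Im z\<bar> < \<omega> (Re z)}" by (auto simp: D_def)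
    also have "open \<dots>" by (intro open_Int open_Collect_less continuous_intros c\<omega>)
    finally have D: "open D" .
    have "D \<subseteq> cbox (Complex 0 (- \<omega> d)) (Complex d (\<omega> d))"
    proof
      fix z assume "z \<in> D"
      then have z: "0 < Re z" "Re z < d" "\<bar>Im z\<bar> < \<omega> (Re z)" using \<delta> by (auto simp: D_def)
      moreover have "\<omega> (Re z) \<le> \<omega> d" using z by (intro monoD[OF \<omega>(2)]) simp
      ultimately show "z \<in> cbox (Complex 0 (- \<omega> d)) (Complex d (\<omega> d))" by (auto simp: in_cbox_complex_iff)
    qed
    then have bD: "bounded D" by (rule bounded_subset[OF bounded_cbox])
    have "closed ({z. 0 \<le> Re z} \<inter> {z. Re z \<le> d - \<delta>} \<inter> {z. \<bar>Im z\<bar> \<le> \<omega> (Re z)})"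
      by (intro closed_Int closed_Collect_le continuous_intros c\<omega>)
    then have cl: "closure D \<subseteq> {z. 0 \<le> Re z} \<inter> {z. Re z \<le> d - \<delta>} \<inter> {z. \<bar>Im z\<bar> \<le> \<omega> (Re z)}"
      by (intro closure_minimal) (auto simp: D_def)
    have sl: "z + of_real \<delta> \<in> slit \<eta>" if "0 \<le> Re z" "Re z \<le> d - \<delta>" for z
      using that \<delta> d by (auto simp: slit_def)
    have shift: "(\<lambda>z. g (z + of_real \<delta>)) holomorphic_on D"
    proof -
      have "(g \<circ> (\<lambda>z. z + of_real \<delta>)) holomorphic_on D"
      proof (rule holomorphic_on_compose)
        show "(\<lambda>z. z + of_real \<delta>) holomorphic_on D" by (intro holomorphic_intros)
        show "g holomorphic_on (\<lambda>z. z + of_real \<delta>) ` D"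
          by (rule holomorphic_on_subset[OF g]) (use sl in \<open>force simp: D_def\<close>)
      qed
      then show ?thesis by (simp add: o_def)
    qed
    have BD: "B holomorphic_on D" using B by (rule holomorphic_on_subset) (auto simp: D_def)
    have normG: "norm (G z) = norm (g (z + of_real \<delta>)) / (C * exp (Re (B z)))" for z
      using C by (simp add: G_def norm_mult norm_divide norm_exp_eq_Re exp_minus field_simps)
    have contG: "isCont (\<lambda>z. g (z + of_real \<delta>)) z" if "0 \<le> Re z" "Re z \<le> d - \<delta>" for z
      by (rule isCont_o2[where g = g]) (use contg sl[OF that] in \<open>auto intro!: continuous_intros\<close>)
    have "norm (G z) \<le> 1"
    \<comment> \<open>At the vertex \<open>G\<close> is bounded, though perhaps not by 1, so this
      single point falls under the second alternative. A pole of \<Phi> suffices there, and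
      \<open>inverse\<close> has positive real part because the region lies in the right half
      plane.\<close>
    proof (rule Phragmen_Lindeloef[OF D bD, where G = G and \<Phi> = inverse])
      show "G holomorphic_on D" unfolding G_def using C by (intro holomorphic_intros shift BD) auto
      show "inverse holomorphic_on D" by (intro holomorphic_on_inverse holomorphic_on_ident[unfolded id_def]) (auto simp: D_def)
      show "Re (inverse z) > 0" if "z \<in> D" for z
        using that by (auto simp: D_def intro!: divide_pos_pos add_pos_nonneg)
      show "z \<in> D" using z by (auto simp: D_def)
      fix \<xi> assume \<xi>: "\<xi> \<in> frontier D"
      then have f: "\<xi> \<notin> D" "0 \<le> Re \<xi>" "Re \<xi> \<le> d - \<delta>" "\<bar>Im \<xi>\<bar> \<le> \<omega> (Re \<xi>)"
        using cl D by (auto simp: frontier_def interior_open)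
      let ?A = "\<forall>e>0. \<forall>\<^sub>F z in at \<xi> within D. norm (G z) \<le> 1 + e"
      let ?B = "filterlim inverse at_infinity (at \<xi> within D) \<and>
        (\<forall>e>0. \<forall>\<^sub>F z in at \<xi> within D. norm (G z) \<le> exp (e * norm (inverse z)))"
      show "?A \<or> ?B"
      proof (cases "Re \<xi> = 0")
        case True
        then have \<xi>0: "\<xi> = 0" using f \<omega>(3) by (simp add: complex_eq_iff)
        have lim: "filterlim inverse at_infinity (at \<xi> within D)"
          unfolding \<xi>0 by (rule filterlim_mono[OF filterlim_inverse_at_infinity order_refl at_le]) simp
        have "((\<lambda>z. norm (g (z + of_real \<delta>))) \<longlongrightarrow> norm (g (0 + of_real \<delta>))) (at 0)"
          using contG[of 0] \<delta> by (intro tendsto_norm) (simp add: isCont_def)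
        then have "\<forall>\<^sub>F z in at 0. norm (g (z + of_real \<delta>)) < norm (g (0 + of_real \<delta>)) + 1"
          by (rule order_tendstoD(2)) simp
        then have "\<forall>\<^sub>F z in at \<xi> within D. norm (g (z + of_real \<delta>)) < norm (g (0 + of_real \<delta>)) + 1"
          unfolding \<xi>0 by (rule filter_leD[OF at_le, rotated]) simp
        moreover have evD: "\<forall>\<^sub>F z in at \<xi> within D. z \<in> D" by (simp add: eventually_at_filter)
        ultimately have bdd: "\<forall>\<^sub>F z in at \<xi> within D. norm (G z) \<le> norm (g (of_real \<delta>)) + 1"
        proof eventually_elim
          case (elim z)
          have "Re (B z) \<ge> 0" using elim \<delta> by (intro B0) (auto simp: D_def)
          then have "1 \<le> C * exp (Re (B z))" using C(1) mult_mono[of 1 C 1 "exp (Re (B z))"] by simp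
          then have "norm (G z) \<le> norm (g (z + of_real \<delta>))"
            unfolding normG using divide_left_mono[of 1 "C * exp (Re (B z))" "norm (g (z + of_real \<delta>))"] by simp
          then show ?case using elim by simp
        qed
        have "\<forall>\<^sub>F z in at \<xi> within D. norm (G z) \<le> exp (e * norm (inverse z))" if e: "e > 0" for e
        proof -
          have "0 < (norm (g (of_real \<delta>)) + 1) / e" using e by (simp add: add_nonneg_pos)
          then have "\<forall>\<^sub>F z in at \<xi> within D. (norm (g (of_real \<delta>)) + 1) / e \<le> norm (inverse z)"
            using lim unfolding filterlim_at_infinity[OF order_refl] by blast
          with bdd show ?thesis
          proof eventually_elim
            case (elim z)
            have "norm (g (of_real \<delta>)) + 1 \<le> e * norm (inverse z)"
              using elim(2) e by (simp add: pos_divide_le_eq mult.commute)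
            also have "\<dots> \<le> exp (e * norm (inverse z))" using exp_ge_add_one_self[of "e * norm (inverse z)"] by linarith
            finally show ?case using elim(1) by linarith
          qed
        qed
        with lim show ?thesis by blast
      next
        case False
        then have re: "Re \<xi> > 0" using f by simp
        have cG: "isCont G \<xi>" unfolding G_def using C contG[of \<xi>] contB[OF re] f
          by (intro continuous_intros) auto
        have "norm (g (\<xi> + of_real \<delta>)) \<le> C * exp (Re (B \<xi>))"
        proof (cases "Re \<xi> = d - \<delta>")
          case True
          have "\<omega> (Re \<xi>) \<le> \<omega> d" using True \<delta> by (intro monoD[OF \<omega>(2)]) simp
          then have "\<xi> + of_real \<delta> \<in> S" using f True by (simp add: Seg)
          then have "norm (g (\<xi> + of_real \<delta>)) \<le> C" by (rule C)
          moreover have "Re (B \<xi>) \<ge> 0" using re f \<delta> by (intro B0) auto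
          then have "C * 1 \<le> C * exp (Re (B \<xi>))" using C(1) by (intro mult_left_mono) auto
          ultimately show ?thesis by simp
        next
          case False
          then have "\<bar>Im \<xi>\<bar> = \<omega> (Re \<xi>)" using f re by (auto simp: D_def)
          then have "norm (g (\<xi> + of_real \<delta>)) \<le> exp (Re (B \<xi>))" using \<delta> re f by (intro bd) auto
          also have "\<dots> \<le> C * exp (Re (B \<xi>))" using C(1) by simp
          finally show ?thesis .
        qed
        then have "norm (G \<xi>) \<le> 1" unfolding normG using C(1) by (simp add: divide_le_eq)
        then show ?thesis using cG eventually_norm_le_of_isCont by blast
      qed
    qed
    then show ?thesis unfolding normG using C(1) by (simp add: divide_le_eq)
  qed
  show ?thesis
  proof (rule that[OF C(1)])
    fix z assume z: "0 < Re z" "Re z < d" "\<bar>Im z\<bar> < \<omega> (Re z)"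
    \<comment> \<open>The point is moved left by \<delta> before the comparison, so it must stay
      inside the region; this holds for small \<delta> since \<omega> is continuous.\<close>
    have c1: "((\<lambda>\<delta>. \<omega> (Re (z - of_real \<delta>))) \<longlongrightarrow> \<omega> (Re (z - of_real 0))) (at_right 0)"
      by (rule isCont_tendsto_compose[OF cont\<omega>]) (intro tendsto_intros)
    have ev1: "\<forall>\<^sub>F \<delta> in at_right 0. \<bar>Im z\<bar> < \<omega> (Re (z - of_real \<delta>))"
      by (rule order_tendstoD(1)[OF c1]) (use z in simp)
    have ev2: "\<forall>\<^sub>F \<delta> in at_right 0. \<delta> < Re z" using z by (intro eventually_at_rightI[of 0 "Re z"]) auto
    have "((\<lambda>\<delta>. C * exp (Re (B (z - of_real \<delta>)))) \<longlongrightarrow> C * exp (Re (B (z - of_real 0)))) (at_right 0)"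
      using contB[of z] z by (intro tendsto_intros isCont_tendsto_compose[of _ B]) auto
    then have "norm (g z) \<le> C * exp (Re (B (z - of_real 0)))"
    proof (rule tendsto_lowerbound)
      show "\<forall>\<^sub>F \<delta> in at_right 0. norm (g z) \<le> C * exp (Re (B (z - of_real \<delta>)))"
        using ev1 ev2 eventually_at_right_less[of 0]
      proof eventually_elim
        case (elim \<delta>)
        then show ?case using shifted[of \<delta> "z - of_real \<delta>"] z by simp
      qed
    qed simp
    then show "norm (g z) \<le> C * exp (Re (B z))" by simp
  qed
qed

text \<open>Near the interval \<open>(0, \<eta>)\<close> the hypothesis degenerates with
  \<open>Im z\<close>. Translations along the real axis preserve \<open>Im z\<close>, so on the
  edges of a sector about the interval it holds for all translates at once, and
  \<open>bound_by_translation\<close> carries it inside with a multiple of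
  \<open>cpow (- \<rho>)\<close> as majorant. Outside the sector \<open>\<bar>Im z\<bar>\<close> and
  \<open>norm z\<close> are comparable.\<close>

lemma growth_near_zero_power:
  assumes g: "g holomorphic_on slit \<eta>" "\<eta> > 0" and sym: "\<And>z. norm (g (cnj z)) = norm (g z)" and \<rho>: "\<rho> \<ge> 1"
    and gr: "\<And>e. e > 0 \<Longrightarrow> \<exists>d>0. \<forall>z. 0 < Im z \<and> norm z < d \<longrightarrow> norm (g z) \<le> exp (e * Im z powr (- \<rho>))"
    and e: "e > 0"
  shows "\<exists>d>0. \<forall>z. 0 < Re z \<and> norm z < d \<longrightarrow> norm (g z) \<le> exp (e * norm z powr (- \<rho>))"
proof -
  have gr': "\<exists>d>0. \<forall>z. Im z \<noteq> 0 \<and> norm z < d \<longrightarrow> norm (g z) \<le> exp (e * \<bar>Im z\<bar> powr (- \<rho>))" if "e > 0" for e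
  proof -
    obtain d where d: "d > 0" "\<And>z. 0 < Im z \<Longrightarrow> norm z < d \<Longrightarrow> norm (g z) \<le> exp (e * Im z powr (- \<rho>))"
      using gr[OF \<open>e > 0\<close>] by blast
    have "norm (g z) \<le> exp (e * \<bar>Im z\<bar> powr (- \<rho>))" if "Im z \<noteq> 0" "norm z < d" for z
    proof (cases "Im z > 0")
      case True then show ?thesis using d(2)[of z] that by simp
    next
      case False then show ?thesis using d(2)[of "cnj z"] that sym[of z] by simp
    qed
    then show ?thesis using d(1) by blast
  qed
  \<comment> \<open>With this half opening \<open>\<rho> * \<bar>Arg z\<bar> \<le> pi / 4\<close> in
    the sector, so the real part of \<open>cpow (- \<rho>) z\<close> is comparable with its
    modulus.\<close>
  define \<beta> \<tau> where "\<beta> = pi / (4 * \<rho>)" and "\<tau> = tan \<beta>"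
  have \<beta>: "0 < \<beta>" "\<beta> < pi / 2"
  proof -
    show "0 < \<beta>" using \<rho> by (simp add: \<beta>_def)
    have "\<beta> \<le> pi / (4 * 1)" unfolding \<beta>_def using \<rho> by (intro divide_left_mono) auto
    then show "\<beta> < pi / 2" using pi_gt_zero by linarith
  qed
  have \<tau>: "\<tau> > 0" unfolding \<tau>_def using \<beta> by (rule tan_gt_zero)
  define K where "K = e / 2"
  have K: "K > 0" using e by (simp add: K_def)
  define B where "B z = of_real K * cpow (- \<rho>) z" for z
  have ReB: "K / 2 * norm z powr (- \<rho>) \<le> Re (B z)" if z: "0 < Re z" "\<bar>Im z\<bar> \<le> \<tau> * Re z" for z
  proof -
    have "\<bar>Arg z\<bar> \<le> arctan (\<bar>Im z\<bar> / Re z)" using z by (intro abs_Arg_le)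
    also have "\<dots> \<le> arctan \<tau>" using z by (intro arctan_monotone') (simp add: divide_le_eq)
    also have "\<dots> = \<beta>" unfolding \<tau>_def using \<beta> by (intro arctan_tan) auto
    finally have "\<rho> * \<bar>Arg z\<bar> \<le> \<rho> * \<beta>" using \<rho> by (intro mult_left_mono) auto
    also have "\<rho> * \<beta> = pi / 4" using \<rho> by (simp add: \<beta>_def)
    finally have "\<rho> * \<bar>Arg z\<bar> \<le> pi / 3" using pi_gt_zero by linarith
    then have "\<bar>- \<rho> * Arg z\<bar> \<le> pi / 3" using \<rho> by (simp add: abs_mult)
    then have "1 / 2 \<le> cos (- \<rho> * Arg z)" by (rule half_le_cos)
    then have "K * norm z powr (- \<rho>) * (1 / 2) \<le> K * norm z powr (- \<rho>) * cos (- \<rho> * Arg z)"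
      using K by (intro mult_left_mono) auto
    moreover have "z \<noteq> 0" using z by auto
    ultimately show ?thesis by (simp add: B_def Re_cpow)
  qed
  \<comment> \<open>On the edge \<open>norm z \<le> (1 + \<tau>) * Re z\<close>, hence
    \<open>\<bar>Im z\<bar> \<ge> \<tau> / (1 + \<tau>) * norm z\<close>; the factor
    \<open>K / 2\<close> is that of \<open>ReB\<close>.\<close>
  define e1 where "e1 = K / 2 * (\<tau> / (1 + \<tau>)) powr \<rho>"
  have e1: "e1 > 0" using K \<tau> by (simp add: e1_def)
  obtain d1 where d1: "d1 > 0" "\<And>z. Im z \<noteq> 0 \<Longrightarrow> norm z < d1 \<Longrightarrow> norm (g z) \<le> exp (e1 * \<bar>Im z\<bar> powr (- \<rho>))"
    using gr'[OF e1] by blast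
  define d where "d = min (\<eta> / 2) (d1 / (2 * (1 + \<tau>)))"
  have d: "0 < d" "d < \<eta>" "(1 + \<tau>) * d < d1"
  proof -
    show "0 < d" "d < \<eta>" using g(2) d1 \<tau> by (auto simp: d_def)
    have "(1 + \<tau>) * d \<le> (1 + \<tau>) * (d1 / (2 * (1 + \<tau>)))" using \<tau> by (intro mult_left_mono) (auto simp: d_def)
    also have "\<dots> = d1 / 2" using \<tau> by (simp add: field_simps)
    finally show "(1 + \<tau>) * d < d1" using d1 by simp
  qed
  obtain C where C: "C \<ge> 1" "\<And>z. 0 < Re z \<Longrightarrow> Re z < d \<Longrightarrow> \<bar>Im z\<bar> < \<tau> * Re z \<Longrightarrow> norm (g z) \<le> C * exp (Re (B z))"
  proof (rule bound_by_translation[OF g(1) d(1,2), where \<omega> = "\<lambda>x. \<tau> * x" and B = B])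
    show "continuous_on UNIV ((*) \<tau>)" by (intro continuous_intros)
    show "mono ((*) \<tau>)" using \<tau> by (intro monoI mult_left_mono) auto
    show "B holomorphic_on {z. 0 < Re z}" unfolding B_def by (intro holomorphic_intros holomorphic_cpow)
    show "0 \<le> Re (B z)" if "0 < Re z" "Re z < d" "\<bar>Im z\<bar> \<le> \<tau> * Re z" for z
      using ReB[of z] that K by (intro order_trans[OF _ ReB]) auto
    show "norm (g (z + of_real \<delta>)) \<le> exp (Re (B z))"
      if h: "0 < \<delta>" "0 < Re z" "Re z + \<delta> \<le> d" "\<bar>Im z\<bar> = \<tau> * Re z" for \<delta> z
    proof -
      have im: "\<bar>Im z\<bar> > 0" using h \<tau> by simp
      have "norm (z + of_real \<delta>) \<le> \<bar>Re z + \<delta>\<bar> + \<bar>Im z\<bar>"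
        using cmod_le[of "z + of_real \<delta>"] by simp
      also have "\<dots> \<le> d + \<tau> * d" using h \<tau> by (intro add_mono) auto
      also have "\<dots> < d1" using d by (simp add: algebra_simps)
      finally have "norm (g (z + of_real \<delta>)) \<le> exp (e1 * \<bar>Im z\<bar> powr (- \<rho>))"
        using d1(2)[of "z + of_real \<delta>"] im by simp
      also have "\<dots> \<le> exp (K / 2 * norm z powr (- \<rho>))"
      proof -
        have "(\<tau> / (1 + \<tau>)) powr \<rho> * \<bar>Im z\<bar> powr (- \<rho>) = (\<bar>Im z\<bar> / (\<tau> / (1 + \<tau>))) powr (- \<rho>)"
          using \<tau> im by (intro powr_quotient) auto
        also have "\<bar>Im z\<bar> / (\<tau> / (1 + \<tau>)) = (1 + \<tau>) * Re z" using h \<tau> by simp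
        also have "((1 + \<tau>) * Re z) powr (- \<rho>) \<le> norm z powr (- \<rho>)"
        proof (rule powr_mono2')
          show "norm z \<le> (1 + \<tau>) * Re z" using cmod_le[of z] h by (simp add: algebra_simps)
        qed (use \<rho> h in auto)
        finally have "K / 2 * ((\<tau> / (1 + \<tau>)) powr \<rho> * \<bar>Im z\<bar> powr (- \<rho>)) \<le> K / 2 * norm z powr (- \<rho>)"
          using K by (intro mult_left_mono) auto
        then show ?thesis by (simp add: e1_def mult.assoc)
      qed
      also have "\<dots> \<le> exp (Re (B z))" using ReB[of z] h by simp
      finally show ?thesis .
    qed
  qed auto
  \<comment> \<open>Outside the sector
    \<open>norm z \<le> (1 + 1 / \<tau>) * \<bar>Im z\<bar>\<close>.\<close>
  define e2 where "e2 = e / (1 + 1 / \<tau>) powr \<rho>"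
  have "1 + 1 / \<tau> > 0" using \<tau> by (simp add: add_pos_pos)
  then have "(1 + 1 / \<tau>) powr \<rho> > 0" by (simp only: powr_gt_zero)
  then have e2: "e2 > 0" using e unfolding e2_def by (rule divide_pos_pos[rotated])
  obtain d2 where d2: "d2 > 0" "\<And>z. Im z \<noteq> 0 \<Longrightarrow> norm z < d2 \<Longrightarrow> norm (g z) \<le> exp (e2 * \<bar>Im z\<bar> powr (- \<rho>))"
    using gr'[OF e2] by blast
  \<comment> \<open>The last bound makes \<open>C \<le> exp (K * norm z powr (- \<rho>))\<close>;
    since \<open>K = e / 2\<close>, the factor \<open>C\<close> takes the second half of
    \<open>e\<close>.\<close>
  define d3 where "d3 = min (min d d2) (min 1 (K / (ln C + 1)))"
  have lnC: "ln C \<ge> 0" using C(1) by simp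
  have d3: "d3 > 0" "d3 \<le> d" "d3 \<le> d2" "d3 \<le> 1" "d3 \<le> K / (ln C + 1)"
    using d d2 K lnC by (auto simp: d3_def)
  have "norm (g z) \<le> exp (e * norm z powr (- \<rho>))" if z: "0 < Re z" "norm z < d3" for z
  proof -
    have z0: "norm z > 0" using z by auto
    show ?thesis
    proof (cases "\<bar>Im z\<bar> < \<tau> * Re z")
      case True
      have "Re z < d" using z d3 complex_Re_le_cmod[of z] by linarith
      then have "norm (g z) \<le> C * exp (Re (B z))" using True z by (intro C)
      moreover have "Re (B z) \<le> K * norm z powr (- \<rho>)"
        using complex_Re_le_cmod[of "B z"] K z0 by (simp add: B_def norm_mult norm_cpow)
      moreover have "C \<le> exp (K * norm z powr (- \<rho>))"
      proof -
        have "norm z * (ln C + 1) \<le> K"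
          using z d3 lnC mult_right_mono[of "norm z" "K / (ln C + 1)" "ln C + 1"] by simp
        then have "norm z * ln C \<le> K" unfolding distrib_left using z0 by linarith
        then have "ln C \<le> K * norm z powr (- 1)" using z0 by (simp add: powr_minus divide_simps mult.commute)
        also have "\<dots> \<le> K * norm z powr (- \<rho>)"
          using K z0 z d3 \<rho> by (intro mult_left_mono powr_mono') auto
        finally have "exp (ln C) \<le> exp (K * norm z powr (- \<rho>))" by simp
        then show ?thesis using C(1) by simp
      qed
      ultimately have "norm (g z) \<le> exp (K * norm z powr (- \<rho>)) * exp (K * norm z powr (- \<rho>))"
        using mult_mono[of C "exp (K * norm z powr (- \<rho>))" "exp (Re (B z))" "exp (K * norm z powr (- \<rho>))"]
        by simp
      then show ?thesis by (simp add: K_def flip: exp_add)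
    next
      case False
      then have im: "\<bar>Im z\<bar> > 0" using z \<tau> by (meson less_le_trans mult_pos_pos not_le)
      have "norm (g z) \<le> exp (e2 * \<bar>Im z\<bar> powr (- \<rho>))" using im z d3 by (intro d2) auto
      also have "e2 * \<bar>Im z\<bar> powr (- \<rho>) \<le> e * norm z powr (- \<rho>)"
      proof -
        have t: "1 + 1 / \<tau> > 0" using \<tau> by (simp add: add_pos_pos)
        have "Re z \<le> \<bar>Im z\<bar> / \<tau>" using False \<tau> by (simp add: field_simps)
        then have "norm z \<le> (1 + 1 / \<tau>) * \<bar>Im z\<bar>" using cmod_le[of z] z by (simp add: algebra_simps)
        then have "((1 + 1 / \<tau>) * \<bar>Im z\<bar>) powr (- \<rho>) \<le> norm z powr (- \<rho>)"
          using \<rho> z0 by (intro powr_mono2') auto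
        then have "e * ((1 + 1 / \<tau>) powr (- \<rho>) * \<bar>Im z\<bar> powr (- \<rho>)) \<le> e * norm z powr (- \<rho>)"
          using e t im by (intro mult_left_mono) (auto simp: powr_mult)
        moreover have "e2 = e * (1 + 1 / \<tau>) powr (- \<rho>)" by (simp add: e2_def powr_minus divide_inverse)
        ultimately show ?thesis by (simp add: mult.assoc)
      qed
      finally show ?thesis by simp
    qed
  qed
  then show ?thesis using d3(1) by blast
qed

subsection \<open>Corners with cubic contact\<close>

lemma isCont_slit: "g holomorphic_on slit \<eta> \<Longrightarrow> z \<in> slit \<eta> \<Longrightarrow> isCont g z"
  using holomorphic_on_imp_continuous_on[of g "slit \<eta>"] open_slit
  by (auto simp: continuous_on_eq_continuous_at)

lemma compact_slit_bound:
  assumes "g holomorphic_on slit \<eta>" "compact S" "S \<subseteq> slit \<eta>"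
  obtains M where "M > 0" "\<And>z. z \<in> S \<Longrightarrow> norm (g z) \<le> M"
proof -
  have "compact (g ` S)"
    using assms by (intro compact_continuous_image continuous_on_subset[OF holomorphic_on_imp_continuous_on[OF assms(1)]])
  from compact_imp_bounded[OF this] obtain M where M: "\<forall>z\<in>S. norm (g z) \<le> M"
    unfolding bounded_iff by auto
  show ?thesis
  proof (rule that[of "max 1 M"])
    show "norm (g z) \<le> max 1 M" if "z \<in> S" for z using M that by (auto simp: le_max_iff_disj)
  qed simp
qed

lemma deriv_bound_on_upper:
  assumes F: "F holomorphic_on upper" and r: "0 < r" "r \<le> Im z" and M: "M > 0"
    and b: "\<And>w. w \<in> ball z r \<Longrightarrow> \<bar>Re (F w)\<bar> \<le> M"
  shows "norm (deriv F z) \<le> 6 * M / r"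
proof (rule norm_deriv_le_of_Re_bounded[OF _ r(1) M b])
  show "F holomorphic_on ball z r"
  proof (rule holomorphic_on_subset[OF F])
    show "ball z r \<subseteq> upper"
    proof
      fix w assume "w \<in> ball z r"
      then have "\<bar>Im (z - w)\<bar> < r" using abs_Im_le_cmod[of "z - w"] by (simp add: dist_norm)
      then show "w \<in> upper" using r by simp
    qed
  qed
qed

lemma ball_coordinates:
  assumes "w \<in> ball z r"
  shows "\<bar>Re w - Re z\<bar> < r" "\<bar>Im w - Im z\<bar> < r" "norm w < norm z + r"
proof -
  have n: "norm (w - z) < r" using assms by (simp add: dist_norm norm_minus_commute)
  show "\<bar>Re w - Re z\<bar> < r" "\<bar>Im w - Im z\<bar> < r"
    using n abs_Re_le_cmod[of "w - z"] abs_Im_le_cmod[of "w - z"] by auto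
  show "norm w < norm z + r" using n norm_triangle_sub[of w z] by linarith
qed

text \<open>The derivative estimate on the disc of radius \<open>y / 2\<close> costs half of the
  height and a factor \<open>12 / y\<close>. In \<open>e1\<close> the power of \<open>1 / 2\<close>
  restores the height, and \<open>e / 2\<close> leaves room for the factor.\<close>

lemma deriv_growth_power:
  assumes F: "F holomorphic_on upper" and \<rho>: "\<rho> \<ge> 1"
    and gr: "\<And>e. e > 0 \<Longrightarrow> \<exists>d>0. \<forall>z. 0 < Im z \<and> norm z < d \<longrightarrow> \<bar>Re (F z)\<bar> \<le> exp (e * Im z powr (- \<rho>))"
    and e: "e > 0"
  shows "\<exists>d>0. \<forall>z. 0 < Im z \<and> norm z < d \<longrightarrow> norm (deriv F z) \<le> exp (e * Im z powr (- \<rho>))"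
proof -
  define e1 where "e1 = e / 2 * (1 / 2) powr \<rho>"
  have "e1 > 0" using e by (simp add: e1_def)
  then obtain d1 where d1: "d1 > 0" "\<And>z. 0 < Im z \<Longrightarrow> norm z < d1 \<Longrightarrow> \<bar>Re (F z)\<bar> \<le> exp (e1 * Im z powr (- \<rho>))"
    using gr by blast
  \<comment> \<open>\<open>96 * y \<le> e\<^sup>2\<close> is equivalent to
    \<open>12 / y \<le> (e / (2 * y))\<^sup>2 / 2\<close>, and the right side is the quadratic term
    of the exponential series.\<close>
  define d where "d = min (d1 / 2) (min 1 (e\<^sup>2 / 96))"
  have d: "d > 0" "d \<le> d1 / 2" "d \<le> 1" "d \<le> e\<^sup>2 / 96" using d1 e by (auto simp: d_def)
  have "norm (deriv F z) \<le> exp (e * Im z powr (- \<rho>))" if z: "0 < Im z" "norm z < d" for z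
  proof -
    define y where "y = Im z"
    have y: "0 < y" "y < d" using z abs_Im_le_cmod[of z] by (auto simp: y_def)
    define X where "X = exp (e / 2 * y powr (- \<rho>))"
    have "norm (deriv F z) \<le> 6 * X / (y / 2)"
    proof (rule deriv_bound_on_upper[OF F])
      fix w assume w: "w \<in> ball z (y / 2)"
      have w': "y / 2 \<le> Im w" "norm w < d1"
        using ball_coordinates(2,3)[OF w] z y d abs_Im_le_cmod[of z] unfolding y_def[symmetric] by linarith+
      then have "\<bar>Re (F w)\<bar> \<le> exp (e1 * Im w powr (- \<rho>))" using y by (intro d1) auto
      also have "e1 * Im w powr (- \<rho>) \<le> e1 * (y / 2) powr (- \<rho>)"
        using w' y \<rho> \<open>e1 > 0\<close> by (intro mult_left_mono powr_mono2') auto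
      also have "\<dots> = e / 2 * ((1 / 2) powr \<rho> * (y / 2) powr (- \<rho>))" by (simp add: e1_def)
      also have "(1 / 2) powr \<rho> * (y / 2) powr (- \<rho>) = y powr (- \<rho>)"
        using powr_quotient[of "1 / 2" "y / 2" \<rho>] y by simp
      finally show "\<bar>Re (F w)\<bar> \<le> X" by (simp add: X_def)
    qed (use y in \<open>auto simp: y_def X_def\<close>)
    also have "\<dots> = (12 / y) * X" by simp
    also have "12 / y \<le> X"
    proof -
      have "e / (2 * y) = e / 2 * y powr (- 1)" using y by (simp add: powr_minus field_simps)
      also have "\<dots> \<le> e / 2 * y powr (- \<rho>)" using y d \<rho> e by (intro mult_left_mono powr_mono') auto
      finally have *: "exp (e / (2 * y)) \<le> X" by (simp add: X_def)
      have "12 / y \<le> (e / (2 * y))\<^sup>2 / 2"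
      proof -
        have "96 * y \<le> e\<^sup>2" using y d by simp
        then have "96 * y / (8 * y\<^sup>2) \<le> e\<^sup>2 / (8 * y\<^sup>2)" by (intro divide_right_mono) auto
        then show ?thesis using y by (simp add: power2_eq_square field_simps)
      qed
      also have "\<dots> \<le> exp (e / (2 * y))"
      proof -
        have p: "0 \<le> e / (2 * y)" using e y by simp
        show ?thesis using exp_lower_Taylor_quadratic[OF p] p by linarith
      qed
      finally show ?thesis using * by linarith
    qed
    then have "12 / y * X \<le> X * X" by (intro mult_right_mono) (auto simp: X_def)
    also have "X * X = exp (e * Im z powr (- \<rho>))" by (simp add: X_def y_def flip: exp_add)
    finally show ?thesis .
  qed
  then show ?thesis using d(1) by blast
qed

text \<open>Discs of radius \<open>c * y ^ 3 / 8\<close> about points of the imaginary axis lie in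
  the approach region, so \<open>norm (g z) \<le> k / norm z ^ 3\<close> on this axis for any
  prescribed \<open>k\<close>, by symmetry on both halves. The Phragmen-Lindeloef principle extends
  this to the right half disc. On the arc only a bound \<open>M\<close> is known, which must not
  spoil the small constant; the factor \<open>exp (N * cpow (1 / 2) z)\<close> pays for it and tends
  to 1 at the corner.\<close>

lemma corner_bound_cubic:
  assumes F: "F holomorphic_on upper" and \<eta>: "\<eta> > 0"
    and zero: "\<And>t. 0 < t \<Longrightarrow> t < \<eta> \<Longrightarrow> boundary_zero (\<lambda>z. Re (F z)) t" and c: "c > 0"
    and app: "\<And>e. e > 0 \<Longrightarrow> \<exists>d>0. \<forall>z. 0 < Im z \<and> norm z < d \<and> \<bar>Re z\<bar> \<le> c * Im z ^ 3 \<longrightarrow> \<bar>Re (F z)\<bar> \<le> e"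
    and gr: "\<And>e. e > 0 \<Longrightarrow> \<exists>d>0. \<forall>z. 0 < Im z \<and> norm z < d \<longrightarrow> \<bar>Re (F z)\<bar> \<le> exp (e * Im z powr (- 1))"
    and e: "e > 0"
  shows "\<exists>d>0. \<forall>z. 0 < Re z \<and> 0 < Im z \<and> norm z < d \<longrightarrow> \<bar>Re (F z)\<bar> \<le> e / (norm z)\<^sup>2"
proof -
  obtain g where g: "g holomorphic_on slit \<eta>" and gF: "\<And>z. Im z > 0 \<Longrightarrow> g z = deriv F z"
    and sym: "\<And>z. norm (g (cnj z)) = norm (g z)"
    using derivative_reflection[OF F zero] by metis
  have gr_g: "\<exists>d>0. \<forall>z. 0 < Im z \<and> norm z < d \<longrightarrow> norm (g z) \<le> exp (e * Im z powr (- 1))" if "e > 0" for e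
    using deriv_growth_power[OF F order_refl gr that] gF by auto
  have growth: "\<exists>d>0. \<forall>z. 0 < Re z \<and> norm z < d \<longrightarrow> norm (g z) \<le> exp (e * norm z powr (- 1))" if "e > 0" for e
    by (rule growth_near_zero_power[OF g \<eta> sym order_refl gr_g that])
  \<comment> \<open>\<open>2 * k\<close> becomes \<open>6 * k\<close> when \<open>norm w ^ 3\<close>
    is replaced by \<open>n ^ 3\<close>, and \<open>6 * k = e / 2\<close> leaves the other half for
    the bounded term.\<close>
  define k where "k = e / 12"
  have k: "k > 0" using e by (simp add: k_def)
  \<comment> \<open>Chosen so that
    \<open>6 * (k * c / 48) / (c * y ^ 3 / 8) = k / y ^ 3\<close>.\<close>
  have "k * c / 48 > 0" using k c by simp
  then obtain d1 where d1: "d1 > 0"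
    "\<And>z. 0 < Im z \<Longrightarrow> norm z < d1 \<Longrightarrow> \<bar>Re z\<bar> \<le> c * Im z ^ 3 \<Longrightarrow> \<bar>Re (F z)\<bar> \<le> k * c / 48"
    using app by blast
  obtain d2 where d2: "d2 > 0"
    "\<And>z. 0 < Im z \<Longrightarrow> norm z < d2 \<Longrightarrow> \<bar>Re z\<bar> \<le> c * Im z ^ 3 \<Longrightarrow> \<bar>Re (F z)\<bar> \<le> 1"
    using app[OF zero_less_one] by blast
  \<comment> \<open>\<open>d \<le> 1\<close> and \<open>c * d \<le> 4\<close> give
    \<open>c * y ^ 3 / 8 \<le> y / 2\<close>, so the discs stay at heights of at least
    \<open>y / 2\<close>.\<close>
  define d where "d = min (min (\<eta> / 2) (d1 / 2)) (min 1 (4 / c))"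
  have d: "d > 0" "d < \<eta>" "2 * d \<le> d1" "d \<le> 1"
    using \<eta> d1 c by (auto simp: d_def)
  have "d \<le> 4 / c" by (simp add: d_def)
  then have cd: "c * d \<le> 4" using c by (simp add: field_simps)
  have axis: "norm (g z) \<le> k / norm z ^ 3" if z: "Re z = 0" "z \<noteq> 0" "norm z \<le> d" for z
  proof -
    define y where "y = norm z"
    have y: "y > 0" "y \<le> d" using z by (auto simp: y_def)
    have "\<bar>Im z\<bar> = y" using z by (simp add: y_def cmod_def)
    then have eq: "norm (g z) = norm (deriv F (Complex 0 y))"
    proof (cases "Im z > 0")
      case True
      then have "z = Complex 0 y" using z \<open>\<bar>Im z\<bar> = y\<close> by (simp add: complex_eq_iff)
      then show ?thesis using gF[of z] y by simp
    next
      case False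
      then have "cnj z = Complex 0 y" using z \<open>\<bar>Im z\<bar> = y\<close> by (simp add: complex_eq_iff)
      then show ?thesis using gF[of "cnj z"] sym[of z] y by simp
    qed
    have cy: "c * y ^ 3 \<le> 4 * y"
    proof -
      have "c * y \<le> 4" using y cd c mult_left_mono[of y d c] by linarith
      moreover have "y * y \<le> 1 * 1" using y d by (intro mult_mono) auto
      ultimately have "(c * y) * (y * y) \<le> 4 * (y * y)" "4 * (y * y) \<le> 4 * y"
        using y d by (auto intro!: mult_right_mono mult_left_mono simp: mult_le_cancel_left1)
      then show ?thesis by (simp add: power3_eq_cube mult.assoc)
    qed
    have "norm (deriv F (Complex 0 y)) \<le> 6 * (k * c / 48) / (c * y ^ 3 / 8)"
    proof (rule deriv_bound_on_upper[OF F])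
      show "c * y ^ 3 / 8 \<le> Im (Complex 0 y)" using cy y by simp
      fix w assume w: "w \<in> ball (Complex 0 y) (c * y ^ 3 / 8)"
      have w': "\<bar>Re w\<bar> < c * y ^ 3 / 8" "y / 2 \<le> Im w" "norm w < d1"
      proof -
        have "norm (Complex 0 y) = y" using y by (simp add: cmod_def)
        then show "norm w < d1" using ball_coordinates(3)[OF w] cy y d by linarith
        show "\<bar>Re w\<bar> < c * y ^ 3 / 8" using ball_coordinates(1)[OF w] by simp
        have "\<bar>Im w - y\<bar> < c * y ^ 3 / 8" using ball_coordinates(2)[OF w] by simp
        then show "y / 2 \<le> Im w" using cy by linarith
      qed
      have "(y / 2) ^ 3 \<le> Im w ^ 3" using w' y by (intro power_mono) auto
      then have "c * y ^ 3 / 8 \<le> c * Im w ^ 3" using c by (simp add: power_divide)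
      then show "\<bar>Re (F w)\<bar> \<le> k * c / 48" using w' y by (intro d1) auto
    qed (use c y k in auto)
    also have "\<dots> = k / y ^ 3" using c y by (simp add: field_simps)
    finally show ?thesis unfolding eq y_def .
  qed
  define S where "S = sphere 0 d \<inter> {z. 0 \<le> Re z}"
  have "compact S" unfolding S_def by (intro compact_Int_closed closed_Collect_le continuous_intros) auto
  moreover have "S \<subseteq> slit \<eta>"
  proof
    fix z assume "z \<in> S"
    then have z: "norm z = d" "Re z \<ge> 0" by (auto simp: S_def)
    show "z \<in> slit \<eta>"
    proof (cases "Im z = 0")
      case True
      then have "Re z = d" using z by (simp add: cmod_def)
      then show ?thesis using d by (simp add: slit_def)
    qed (simp add: slit_def)
  qed
  ultimately obtain M0 where M0: "M0 > 0" "\<And>z. z \<in> S \<Longrightarrow> norm (g z) \<le> M0"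
    using compact_slit_bound[OF g] by metis
  define M where "M = max k M0"
  have M: "M \<ge> k" "M > 0" "\<And>z. z \<in> S \<Longrightarrow> norm (g z) \<le> M" using M0 k by (auto simp: M_def le_max_iff_disj)
  \<comment> \<open>On the arc \<open>Re (cpow (1 / 2) z)\<close> is at least
    \<open>d powr (1 / 2) / 2\<close>, so this \<open>N\<close> makes the damping factor at most
    \<open>k / M\<close> there.\<close>
  define N where "N = 2 * ln (M / k) / d powr (1 / 2)"
  have N: "N \<ge> 0" using M k d by (simp add: N_def)
  have cp: "norm z powr (1 / 2) / 2 \<le> Re (cpow (1 / 2) z)" if "Re z \<ge> 0" "z \<noteq> 0" for z
  proof -
    have "\<bar>Arg z\<bar> \<le> pi / 2" using Re_Ln_pos_le[of z] that by (simp add: Arg_eq_Im_Ln)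
    then have "\<bar>1 / 2 * Arg z\<bar> \<le> pi / 3" using pi_gt_zero by (simp add: abs_mult)
    then have "1 / 2 \<le> cos (1 / 2 * Arg z)" by (rule half_le_cos)
    then have "norm z powr (1 / 2) * (1 / 2) \<le> norm z powr (1 / 2) * cos (1 / 2 * Arg z)"
      by (intro mult_left_mono) auto
    then show ?thesis using that by (simp add: Re_cpow)
  qed
  define D where "D = {z. 0 < Re z} \<inter> ball 0 d"
  define G where "G z = g z * z ^ 3 * exp (- of_real N * cpow (1 / 2) z) / of_real k" for z
  have D: "open D" "bounded D" unfolding D_def
    by (auto intro: open_Int open_halfspace_Re_gt bounded_subset[OF bounded_ball])
  have "closure D \<subseteq> {z. 0 \<le> Re z} \<inter> cball 0 d"
    unfolding D_def by (intro closure_minimal closed_Int closed_Collect_le continuous_intros) auto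
  then have cl: "Re z \<ge> 0" "norm z \<le> d" if "z \<in> closure D" for z using that by auto
  have in_slit: "z \<in> slit \<eta>" if "Re z \<ge> 0" "norm z \<le> d" "z \<noteq> 0" for z
    using that d complex_Re_le_cmod[of z] by (auto simp: slit_def complex_eq_iff)
  have normG: "norm (G z) = norm (g z) * norm z ^ 3 * exp (- N * Re (cpow (1 / 2) z)) / k" for z
    using k by (simp add: G_def norm_mult norm_divide norm_power)
  have bound: "norm (g z) \<le> k * exp (N * norm z powr (1 / 2)) / norm z ^ 3" if z: "Re z \<ge> 0" "z \<noteq> 0" "norm z < d" for z
  proof (cases "Re z = 0")
    case True
    have "norm (g z) \<le> k / norm z ^ 3" using axis True z by simp
    also have "\<dots> \<le> k * exp (N * norm z powr (1 / 2)) / norm z ^ 3"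
      using N k by (intro divide_right_mono) auto
    finally show ?thesis .
  next
    case False
    have "norm (G z) \<le> 1"
    proof (rule Phragmen_Lindeloef[OF D, where G = G and \<Phi> = inverse])
      have "D \<subseteq> slit \<eta>"
      proof
        fix z assume "z \<in> D"
        then show "z \<in> slit \<eta>" by (intro in_slit) (auto simp: D_def)
      qed
      then show "G holomorphic_on D"
        unfolding G_def using k
        by (intro holomorphic_intros holomorphic_on_subset[OF g] holomorphic_on_subset[OF holomorphic_cpow]) (auto simp: D_def)
      show "inverse holomorphic_on D" by (intro holomorphic_on_inverse holomorphic_on_ident[unfolded id_def]) (auto simp: D_def)
      show "Re (inverse z) > 0" if "z \<in> D" for z
        using that by (auto simp: D_def intro!: divide_pos_pos add_pos_nonneg)
      show "z \<in> D" using z False by (auto simp: D_def)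
      fix \<xi> assume "\<xi> \<in> frontier D"
      then have f: "\<xi> \<notin> D" "Re \<xi> \<ge> 0" "norm \<xi> \<le> d"
        using cl[of \<xi>] D by (auto simp: frontier_def interior_open)
      let ?A = "\<forall>e>0. \<forall>\<^sub>F z in at \<xi> within D. norm (G z) \<le> 1 + e"
      let ?B = "filterlim inverse at_infinity (at \<xi> within D) \<and>
        (\<forall>e>0. \<forall>\<^sub>F z in at \<xi> within D. norm (G z) \<le> exp (e * norm (inverse z)))"
      show "?A \<or> ?B"
      proof (cases "\<xi> = 0")
        case True
        have lim: "filterlim inverse at_infinity (at \<xi> within D)"
          unfolding True by (rule filterlim_mono[OF filterlim_inverse_at_infinity order_refl at_le]) simp
        have "\<forall>\<^sub>F z in at \<xi> within D. norm (G z) \<le> exp (e' * norm (inverse z))" if "e' > 0" for e'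
        proof -
          obtain d' where d': "d' > 0" "\<And>z. 0 < Re z \<Longrightarrow> norm z < d' \<Longrightarrow> norm (g z) \<le> exp (e' * norm z powr (- 1))"
            using growth[OF \<open>e' > 0\<close>] by blast
          have "((\<lambda>z. norm z ^ 3) \<longlongrightarrow> norm \<xi> ^ 3) (at \<xi> within D)" by (intro tendsto_intros)
          then have "\<forall>\<^sub>F z in at \<xi> within D. norm z ^ 3 < k"
            by (rule order_tendstoD(2)) (use k True in simp)
          moreover have "((\<lambda>z. norm z) \<longlongrightarrow> norm \<xi>) (at \<xi> within D)" by (intro tendsto_intros)
          then have "\<forall>\<^sub>F z in at \<xi> within D. norm z < d'"
            by (rule order_tendstoD(2)) (use d' True in simp)
          moreover have "\<forall>\<^sub>F z in at \<xi> within D. z \<in> D" by (simp add: eventually_at_filter)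
          ultimately show ?thesis
          proof eventually_elim
            case (elim z)
            then have z: "Re z > 0" "z \<noteq> 0" by (auto simp: D_def)
            have "N * Re (cpow (1 / 2) z) \<ge> 0" using cp[of z] z N
              by (intro mult_nonneg_nonneg order_trans[OF _ cp]) auto
            then have "exp (- N * Re (cpow (1 / 2) z)) \<le> 1" by simp
            moreover have "norm z ^ 3 / k \<le> 1" using elim k by simp
            ultimately have "norm z ^ 3 / k * exp (- N * Re (cpow (1 / 2) z)) \<le> 1 * 1"
              using k by (intro mult_mono) auto
            then have "norm (g z) * (norm z ^ 3 / k * exp (- N * Re (cpow (1 / 2) z))) \<le> norm (g z) * 1"
              by (intro mult_left_mono) auto
            moreover have "norm (g z) \<le> exp (e' * norm z powr (- 1))" using d' z elim by blast
            moreover have "norm z powr (- 1) = norm (inverse z)" using z by (simp add: powr_minus norm_inverse)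
            ultimately have "norm (g z) * (norm z ^ 3 / k * exp (- N * Re (cpow (1 / 2) z))) \<le> exp (e' * norm (inverse z))"
              by (simp only: mult_1_right)
            then show ?case unfolding normG by (simp only: times_divide_eq_left times_divide_eq_right mult.assoc)
          qed
        qed
        with lim show ?thesis by blast
      next
        case False
        then have "\<xi> \<in> slit \<eta>" using in_slit f by blast
        then have cg: "isCont g \<xi>" by (rule isCont_slit[OF g])
        have "\<xi> \<notin> \<real>\<^sub>\<le>\<^sub>0" using f False by (auto simp: complex_nonpos_Reals_iff complex_eq_iff)
        then have "isCont (cpow (1 / 2)) \<xi>" unfolding cpow_def[abs_def] by (intro continuous_intros)
        with cg have cG: "isCont G \<xi>" unfolding G_def using k by (intro continuous_intros) auto
        have cp0: "N * (norm \<xi> powr (1 / 2) / 2) \<le> N * Re (cpow (1 / 2) \<xi>)"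
          using cp[of \<xi>] f False N by (intro mult_left_mono) auto
        have "norm (G \<xi>) \<le> 1"
        proof (cases "Re \<xi> = 0")
          case True
          have "norm (g \<xi>) * norm \<xi> ^ 3 \<le> k" using axis[OF True False f(3)] False by (simp add: field_simps)
          moreover have "exp (- N * Re (cpow (1 / 2) \<xi>)) \<le> 1"
          proof -
            have "0 \<le> N * (norm \<xi> powr (1 / 2) / 2)" using N by simp
            then show ?thesis using cp0 by simp
          qed
          ultimately have "norm (g \<xi>) * norm \<xi> ^ 3 * exp (- N * Re (cpow (1 / 2) \<xi>)) \<le> k * 1"
            using k by (intro mult_mono) auto
          then show ?thesis unfolding normG using k by simp
        next
          case False
          then have nd: "norm \<xi> = d" using f by (auto simp: D_def)
          then have "\<xi> \<in> S" using f by (simp add: S_def)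
          then have "norm (g \<xi>) \<le> M" by (rule M)
          moreover have "norm \<xi> ^ 3 \<le> 1" using nd d by (simp add: power_le_one)
          moreover have "exp (- N * Re (cpow (1 / 2) \<xi>)) \<le> k / M"
          proof -
            have "N * (d powr (1 / 2) / 2) = ln (M / k)" using d by (simp add: N_def)
            then have "exp (- N * Re (cpow (1 / 2) \<xi>)) \<le> exp (- ln (M / k))" using cp0 nd by simp
            also have "\<dots> = k / M" using M k by (simp add: exp_minus)
            finally show ?thesis .
          qed
          ultimately have "norm (g \<xi>) * norm \<xi> ^ 3 * exp (- N * Re (cpow (1 / 2) \<xi>)) \<le> M * 1 * (k / M)"
            using M by (intro mult_mono) auto
          then show ?thesis unfolding normG using M k by simp
        qed
        then show ?thesis using cG eventually_norm_le_of_isCont by blast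
      qed
    qed
    then have "norm (g z) * norm z ^ 3 \<le> k * exp (N * Re (cpow (1 / 2) z))"
      unfolding normG using k by (simp add: exp_minus field_simps)
    also have "\<dots> \<le> k * exp (N * norm z powr (1 / 2))"
      using k N complex_Re_le_cmod[of "cpow (1 / 2) z"] z norm_cpow[of z "1 / 2"] by (simp add: mult_left_mono)
    finally show ?thesis using z by (simp add: field_simps)
  qed
  \<comment> \<open>The last bound gives \<open>N * norm z powr (1 / 2) \<le> 1 / 2\<close>, and
    \<open>exp (1 / 2) \<le> 2\<close>.\<close>
  define d3 where "d3 = min (min d d2) (min (e / 2) ((1 / (2 * (N + 1))) powr (1 / (1 / 2))))"
  have d3: "d3 > 0" "d3 \<le> d" "d3 \<le> d2" "d3 \<le> e / 2" "d3 \<le> (1 / (2 * (N + 1))) powr (1 / (1 / 2))"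
    using d d2 e N by (auto simp: d3_def)
  have gb: "norm (g z) \<le> 2 * k / norm z ^ 3" if z: "Re z \<ge> 0" "z \<noteq> 0" "norm z < d3" for z
  proof -
    have "norm z powr (1 / 2) \<le> 1 / (2 * (N + 1))"
      by (rule powr_le_of_le_root) (use z d3 N in auto)
    then have "N * norm z powr (1 / 2) \<le> N * (1 / (2 * (N + 1)))" using N by (intro mult_left_mono)
    also have "\<dots> \<le> 1 / 2" using N by (simp add: field_simps)
    finally have "exp (N * norm z powr (1 / 2)) \<le> exp (1 / 2 :: real)" by simp
    also have "exp (1 / 2 :: real) \<le> 2" using exp_bound_half[of "1 / 2 :: real"] by simp
    finally have "k * exp (N * norm z powr (1 / 2)) / norm z ^ 3 \<le> k * 2 / norm z ^ 3"
      using k by (intro divide_right_mono mult_left_mono) auto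
    moreover have "norm (g z) \<le> k * exp (N * norm z powr (1 / 2)) / norm z ^ 3"
      using z d3 by (intro bound) auto
    ultimately show ?thesis by (simp add: mult.commute)
  qed
  have "\<bar>Re (F z)\<bar> \<le> e / (norm z)\<^sup>2" if z: "0 < Re z" "0 < Im z" "norm z < min d3 1" for z
  proof -
    define n where "n = norm z"
    have n: "0 < n" "n < d3" "n < 1" "Re z \<le> n" "Im z \<le> n"
      using z complex_Re_le_cmod[of z] abs_Im_le_cmod[of z] by (auto simp: n_def)
    have n2: "n\<^sup>2 = (Re z)\<^sup>2 + (Im z)\<^sup>2" by (simp add: n_def cmod_power2)
    have dB: "norm (deriv F w) \<le> 6 * k / n ^ 3" if w: "Re w \<ge> 0" "Im w > 0" "norm w < d3" "n\<^sup>2 \<le> 2 * (norm w)\<^sup>2" for w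
    proof -
      have w0: "norm w > 0" using w by auto
      have "n \<le> sqrt 2 * norm w" using real_le_rsqrt[OF w(4)] by (simp add: real_sqrt_mult)
      then have "n ^ 3 \<le> (sqrt 2 * norm w) ^ 3" using n by (intro power_mono) auto
      also have "\<dots> = 2 * sqrt 2 * norm w ^ 3" by (simp add: power_mult_distrib power3_eq_cube)
      also have "\<dots> \<le> 3 * norm w ^ 3"
      proof (rule mult_right_mono)
        have "sqrt 2 \<le> 3 / 2" by (rule real_le_lsqrt) (auto simp: power2_eq_square)
        then show "2 * sqrt 2 \<le> 3" by simp
      qed simp
      finally have "2 * k / norm w ^ 3 \<le> 6 * k / n ^ 3" using w0 n k by (simp add: field_simps)
      moreover have "w \<noteq> 0" using w by auto
      ultimately show ?thesis using gb[of w] gF[of w] w by simp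
    qed
    \<comment> \<open>Integrate horizontally from the imaginary axis, where
      \<open>\<bar>Re F\<bar> \<le> 1\<close>, or vertically from the real axis, where
      \<open>Re F\<close> vanishes, whichever path keeps \<open>norm w\<close> above
      \<open>n / sqrt 2\<close>.\<close>
    have "\<bar>Re (F z)\<bar> \<le> 1 + 6 * k / n\<^sup>2"
    proof (cases "Re z \<le> Im z")
      case True
      let ?S = "closed_segment (Complex 0 (Im z)) (Complex (Re z) (Im z))"
      have seg: "0 \<le> Re w \<and> Re w \<le> Re z \<and> Im w = Im z" if "w \<in> ?S" for w
        using that z by (auto simp: closed_segment_same_Im closed_segment_eq_real_ivl)
      have "norm (F (Complex (Re z) (Im z)) - F (Complex 0 (Im z))) \<le> 6 * k / n ^ 3 * norm (Complex (Re z) (Im z) - Complex 0 (Im z))"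
      proof (rule field_differentiable_bound[where S = ?S and f' = "deriv F"])
        show "(F has_field_derivative deriv F w) (at w within ?S)" if "w \<in> ?S" for w
          by (rule holomorphic_derivI[OF F open_upper]) (use seg[OF that] z in simp)
        show "norm (deriv F w) \<le> 6 * k / n ^ 3" if "w \<in> ?S" for w
        proof (rule dB)
          have s: "0 \<le> Re w" "Re w \<le> Re z" "Im w = Im z" using seg[OF that] by auto
          then have "(norm w)\<^sup>2 \<le> n\<^sup>2" unfolding n2 cmod_power2 by (simp add: power_mono)
          then have "norm w \<le> n" using n by (intro power2_le_imp_le[of "norm w" n]) auto
          then show "norm w < d3" using n by simp
          show "Re w \<ge> 0" "Im w > 0" using s z by auto
          have "(Re z)\<^sup>2 \<le> (Im z)\<^sup>2" using True z by (intro power_mono) auto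
          also have "\<dots> \<le> (Im z)\<^sup>2 + 2 * (Re w)\<^sup>2" by simp
          finally show "n\<^sup>2 \<le> 2 * (norm w)\<^sup>2" unfolding n2 cmod_power2 s(3) by simp
        qed
      qed auto
      also have "norm (Complex (Re z) (Im z) - Complex 0 (Im z)) = Re z" using z by (simp add: complex_diff cmod_def)
      also have "6 * k / n ^ 3 * Re z \<le> 6 * k / n ^ 3 * n" using k n by (intro mult_left_mono) auto
      also have "\<dots> = 6 * k / n\<^sup>2" using n by (simp add: power3_eq_cube power2_eq_square)
      finally have "\<bar>Re (F z) - Re (F (Complex 0 (Im z)))\<bar> \<le> 6 * k / n\<^sup>2"
        using abs_Re_le_cmod[of "F z - F (Complex 0 (Im z))"] by simp
      moreover have "\<bar>Re (F (Complex 0 (Im z)))\<bar> \<le> 1"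
        using z n d3 c by (intro d2) (auto simp: cmod_def)
      ultimately show ?thesis by linarith
    next
      case False
      have "\<bar>Re (F (Complex (Re z) (Im z)))\<bar> \<le> 6 * k / n ^ 3 * Im z"
      proof (rule Re_le_vertical[OF F])
        show "boundary_zero (\<lambda>z. Re (F z)) (Re z)" using z n d3 d by (intro zero) auto
        show "Im z > 0" by fact
        fix t assume t: "0 < t" "t \<le> Im z"
        show "norm (deriv F (Complex (Re z) t)) \<le> 6 * k / n ^ 3"
        proof (rule dB)
          have "(norm (Complex (Re z) t))\<^sup>2 \<le> n\<^sup>2" unfolding n2 cmod_power2 using t by (simp add: power_mono)
          then have "norm (Complex (Re z) t) \<le> n" using n by (intro power2_le_imp_le[of "norm (Complex (Re z) t)" n]) auto
          then show "norm (Complex (Re z) t) < d3" using n by simp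
          have "(Im z)\<^sup>2 \<le> (Re z)\<^sup>2" using False z by (intro power_mono) auto
          also have "\<dots> \<le> (Re z)\<^sup>2 + 2 * t\<^sup>2" by simp
          finally show "n\<^sup>2 \<le> 2 * (norm (Complex (Re z) t))\<^sup>2" unfolding n2 cmod_power2 by simp
        qed (use t z in auto)
      qed
      also have "\<dots> \<le> 6 * k / n ^ 3 * n" using k n by (intro mult_left_mono) auto
      also have "\<dots> = 6 * k / n\<^sup>2" using n by (simp add: power3_eq_cube power2_eq_square)
      finally show ?thesis by simp
    qed
    also have "1 \<le> (e / 2) / n\<^sup>2"
    proof -
      have "n\<^sup>2 \<le> n" using n by (simp add: power2_eq_square mult_le_cancel_left1)
      then have "n\<^sup>2 \<le> e / 2" using n d3 by linarith
      then show ?thesis using n by simp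
    qed
    also have "(e / 2) / n\<^sup>2 + 6 * k / n\<^sup>2 = e / n\<^sup>2" by (simp add: k_def add_divide_distrib[symmetric])
    finally show ?thesis by (simp add: n_def)
  qed
  then show ?thesis using d3(1) by (intro exI[of _ "min d3 1"]) auto
qed

subsection \<open>Corners with sectors\<close>

text \<open>\<open>D\<close> is the sector \<open>c * \<bar>Im z\<bar> < Re z\<close> widened by
  \<open>(norm z)\<^sup>2\<close>. In the coordinate \<open>1 / z\<close> this is a sector of the
  same opening with vertex \<open>- 1\<close>, so the power \<open>cpow \<rho> (1 + 1 / z)\<close>
  has positive real part, while the edges now run inside the approach region with a margin of order
  \<open>(norm z)\<^sup>2\<close>. There \<open>\<bar>Re F\<bar> \<le> 1\<close> bounds the
  derivative by a multiple of \<open>1 / (norm z)\<^sup>2\<close>. The principle extends this to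
  \<open>D\<close>, and integration gives order \<open>1 / norm z\<close>.\<close>

lemma corner_bound_sector:
  assumes F: "F holomorphic_on upper" and \<eta>: "\<eta> > 0"
    and zero: "\<And>t. 0 < t \<Longrightarrow> t < \<eta> \<Longrightarrow> boundary_zero (\<lambda>z. Re (F z)) t" and c: "c > 0"
    and app: "\<And>e. e > 0 \<Longrightarrow> \<exists>d>0. \<forall>z. 0 < Im z \<and> norm z < d \<and> \<bar>Re z\<bar> \<le> c * Im z \<longrightarrow> \<bar>Re (F z)\<bar> \<le> e"
    and \<rho>: "\<rho> = pi / (2 * arctan (1 / c))"
    and gr: "\<And>e. e > 0 \<Longrightarrow> \<exists>d>0. \<forall>z. 0 < Im z \<and> norm z < d \<longrightarrow> \<bar>Re (F z)\<bar> \<le> exp (e * Im z powr (- \<rho>))"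
    and e: "e > 0"
  shows "\<exists>d>0. \<forall>z. 0 < Re z \<and> 0 < Im z \<and> norm z < d \<longrightarrow> \<bar>Re (F z)\<bar> \<le> e / (norm z)\<^sup>2"
proof -
  obtain g where g: "g holomorphic_on slit \<eta>" and gF: "\<And>z. Im z > 0 \<Longrightarrow> g z = deriv F z"
    and sym: "\<And>z. norm (g (cnj z)) = norm (g z)"
    using derivative_reflection[OF F zero] by metis
  \<comment> \<open>The angle between the real axis and the edge of the approach region, half the
    opening of the reflected sector.\<close>
  define \<alpha> where "\<alpha> = arctan (1 / c)"
  have \<alpha>: "0 < \<alpha>" "\<alpha> < pi / 2" using c arctan_ubound[of "1 / c"] by (auto simp: \<alpha>_def)
  have \<rho>\<alpha>: "\<rho> * \<alpha> = pi / 2" using \<alpha> by (simp add: \<rho> \<alpha>_def[symmetric])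
  have \<rho>1: "\<rho> \<ge> 1"
  proof -
    have "2 * \<alpha> \<le> pi" using \<alpha> by simp
    then show ?thesis using \<alpha> unfolding \<rho> \<alpha>_def[symmetric] by (simp add: le_divide_eq)
  qed
  have gr_g: "\<exists>d>0. \<forall>z. 0 < Im z \<and> norm z < d \<longrightarrow> norm (g z) \<le> exp (e * Im z powr (- \<rho>))" if "e > 0" for e
    using deriv_growth_power[OF F \<rho>1 gr that] gF by auto
  have growth: "\<exists>d>0. \<forall>z. 0 < Re z \<and> norm z < d \<longrightarrow> norm (g z) \<le> exp (e * norm z powr (- \<rho>))" if "e > 0" for e
    by (rule growth_near_zero_power[OF g \<eta> sym \<rho>1 gr_g that])
  obtain d1 where d1: "d1 > 0"
    "\<And>z. 0 < Im z \<Longrightarrow> norm z < d1 \<Longrightarrow> \<bar>Re z\<bar> \<le> c * Im z \<Longrightarrow> \<bar>Re (F z)\<bar> \<le> 1"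
    using app[OF zero_less_one] by blast
  \<comment> \<open>The bound with \<open>c\<close> keeps \<open>D\<close> in the right half plane,
    and \<open>1 / 2\<close> gives \<open>norm (1 + 1 / z) \<ge> 1 / (2 * norm z)\<close>.\<close>
  define d where "d = min (min (\<eta> / 2) (d1 / 2)) (min (1 / 2) (c / (2 * (1 + c))))"
  have "d \<le> \<eta> / 2" "d \<le> d1 / 2" "d \<le> 1 / 2" unfolding d_def by linarith+
  moreover have "d > 0" "d \<le> c / (2 * (1 + c))" using \<eta> d1 c by (auto simp: d_def)
  ultimately have d: "d > 0" "d < \<eta>" "2 * d \<le> d1" "d \<le> 1 / 2" "d \<le> c / (2 * (1 + c))"
    using \<eta> by linarith+
  have dc: "d * (2 * (1 + c)) \<le> c" using d(5) c by (simp add: pos_le_divide_eq)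
  define D where "D = {z. c * \<bar>Im z\<bar> < Re z + (norm z)\<^sup>2} \<inter> ball 0 d"
  have D: "open D" "bounded D" unfolding D_def
    by (auto intro!: open_Int open_Collect_less continuous_intros intro: bounded_subset[OF bounded_ball])
  have "closure D \<subseteq> {z. c * \<bar>Im z\<bar> \<le> Re z + (norm z)\<^sup>2} \<inter> cball 0 d"
    unfolding D_def by (intro closure_minimal closed_Int closed_Collect_le continuous_intros) auto
  then have cl: "c * \<bar>Im z\<bar> \<le> Re z + (norm z)\<^sup>2" "norm z \<le> d" if "z \<in> closure D" for z using that by auto
  have re_pos: "Re z > 0" if z: "c * \<bar>Im z\<bar> \<le> Re z + (norm z)\<^sup>2" "z \<noteq> 0" "norm z \<le> d" for z
  proof (rule ccontr)
    assume "\<not> Re z > 0"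
    moreover have "0 \<le> c * \<bar>Im z\<bar>" using c by simp
    ultimately have h: "\<bar>Re z\<bar> \<le> (norm z)\<^sup>2" "c * \<bar>Im z\<bar> \<le> (norm z)\<^sup>2"
      using z(1) by linarith+
    have "norm z * c \<le> (\<bar>Re z\<bar> + \<bar>Im z\<bar>) * c" using cmod_le[of z] c by (intro mult_right_mono) auto
    also have "\<dots> \<le> (norm z)\<^sup>2 * c + (norm z)\<^sup>2"
      unfolding distrib_right using h c by (intro add_mono mult_right_mono) (auto simp: mult.commute)
    also have "\<dots> = norm z * (norm z * (1 + c))" by (simp add: power2_eq_square algebra_simps)
    finally have "norm z * c \<le> norm z * (norm z * (1 + c))" .
    then have "c \<le> norm z * (1 + c)" using z by simp
    also have "\<dots> \<le> d * (1 + c)" using z c by (intro mult_right_mono) auto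
    also have "\<dots> < c"
    proof -
      have "0 < d * (1 + c)" using c d(1) by simp
      moreover have "2 * (d * (1 + c)) \<le> c" using dc by (simp only: ac_simps)
      ultimately show ?thesis by linarith
    qed
    finally show False by simp
  qed
  have in_slit: "z \<in> slit \<eta>" if "c * \<bar>Im z\<bar> \<le> Re z + (norm z)\<^sup>2" "z \<noteq> 0" "norm z \<le> d" for z
    using re_pos[OF that] that d complex_Re_le_cmod[of z] by (auto simp: slit_def)
  have edge_up: "norm (deriv F z) * (norm z)\<^sup>2 \<le> 12 * (1 + c)"
    if z: "c * Im z = Re z + (norm z)\<^sup>2" "Im z > 0" "norm z \<le> d" for z
  proof -
    define n where "n = norm z"
    have n: "n > 0" "n \<le> d" "n \<le> 1 / 2" using z d by (auto simp: n_def)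
    have nn: "n\<^sup>2 \<le> n * d" using n by (simp add: power2_eq_square)
    have "z \<noteq> 0" using z by auto
    then have x: "Re z > 0" using re_pos[of z] z by simp
    \<comment> \<open>\<open>(1 + c) * r\<close> is half of the margin
      \<open>n\<^sup>2 = c * Im z - Re z\<close>, so a move by \<open>r\<close> in any direction
      stays in the approach region.\<close>
    define r where "r = n\<^sup>2 / (2 * (1 + c))"
    have r0: "r > 0" using n c by (simp add: r_def)
    have rc: "r * (2 * (1 + c)) = n\<^sup>2" using c by (simp add: r_def)
    have rc': "r + c * r = n\<^sup>2 / 2" using rc by (simp add: algebra_simps)
    have ny: "n \<le> (1 + c) * Im z"
    proof -
      have "n \<le> Re z + Im z" using cmod_le[of z] x z by (simp add: n_def)
      also have "\<dots> \<le> c * Im z + Im z" using z by (simp add: n_def)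
      finally show ?thesis by (simp add: algebra_simps)
    qed
    have ry: "r \<le> Im z / 2"
    proof -
      have "r * (2 * (1 + c)) \<le> n * (1 / 2)" unfolding rc using n by (simp add: power2_eq_square)
      also have "\<dots> \<le> (1 + c) * Im z * (1 / 2)" using ny by (intro mult_right_mono) auto
      also have "\<dots> \<le> (1 + c) * Im z"
      proof -
        have "0 \<le> (1 + c) * Im z" using c z by simp
        then show ?thesis by linarith
      qed
      also have "\<dots> = (Im z / 2) * (2 * (1 + c))" by simp
      finally show ?thesis by (rule mult_right_le_imp_le) (use c in simp)
    qed
    have "norm (deriv F z) \<le> 6 * 1 / r"
    proof (rule deriv_bound_on_upper[OF F r0])
      show "r \<le> Im z" using ry z by linarith
      fix w assume w: "w \<in> ball z r"
      note b = ball_coordinates[OF w]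
      have im: "Im z - r < Im w" using b by linarith
      then have "c * (Im z - r) \<le> c * Im w" using c by (intro mult_left_mono) auto
      then have ci: "c * Im z - c * r \<le> c * Im w" by (simp add: algebra_simps)
      have n2: "n\<^sup>2 > 0" "c * Im z = Re z + n\<^sup>2" using n z by (auto simp: n_def)
      have "Re w \<le> c * Im w" using b(1) n2 rc' ci by linarith
      moreover have "- Re w \<le> c * Im w" using b(1) n2 rc' ci x by linarith
      ultimately have "\<bar>Re w\<bar> \<le> c * Im w" by linarith
      moreover have "norm w < d1" using b(3) ry z d abs_Im_le_cmod[of z] by linarith
      moreover have "Im w > 0" using im ry z by linarith
      ultimately show "\<bar>Re (F w)\<bar> \<le> 1" using d1 by blast
    qed simp
    then have "norm (deriv F z) * n\<^sup>2 \<le> 6 / r * n\<^sup>2" by (intro mult_right_mono) auto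
    also have "\<dots> = 12 * (1 + c)" using n c by (simp add: r_def field_simps)
    finally show ?thesis by (simp add: n_def)
  qed
  define S where "S = sphere 0 d \<inter> {z. c * \<bar>Im z\<bar> \<le> Re z + (norm z)\<^sup>2}"
  have "compact S" unfolding S_def by (intro compact_Int_closed closed_Collect_le continuous_intros) auto
  moreover have "S \<subseteq> slit \<eta>" using d(1) by (auto simp: S_def intro!: in_slit)
  ultimately obtain M0 where M0: "M0 > 0" "\<And>z. z \<in> S \<Longrightarrow> norm (g z) \<le> M0"
    using compact_slit_bound[OF g] by metis
  define M where "M = max (12 * (1 + c)) M0"
  have M: "M \<ge> 12 * (1 + c)" "M > 0" "M \<ge> 1" "\<And>z. z \<in> S \<Longrightarrow> norm (g z) \<le> M"
    using M0 c by (auto simp: M_def le_max_iff_disj)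
  define G where "G z = g z * z\<^sup>2 / of_real M" for z
  define P where "P z = cpow \<rho> (1 + 1 / z)" for z
  have normG: "norm (G z) = norm (g z) * (norm z)\<^sup>2 / M" for z
    using M by (simp add: G_def norm_mult norm_divide norm_power)
  have DD: "z \<noteq> 0" "norm z < d" "c * \<bar>Im z\<bar> < Re z + (norm z)\<^sup>2" "Re z > 0" if "z \<in> D" for z
  proof -
    show 1: "z \<noteq> 0" "norm z < d" "c * \<bar>Im z\<bar> < Re z + (norm z)\<^sup>2" using that by (auto simp: D_def)
    show "Re z > 0" using 1 by (intro re_pos) auto
  qed
  have w: "Re (1 + 1 / z) > 0" "\<bar>\<rho> * Arg (1 + 1 / z)\<bar> < pi / 2" if z: "z \<in> D" for z
  proof -
    note zD = DD[OF z]
    define n2 where "n2 = (norm z)\<^sup>2"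
    have n2: "n2 > 0" using zD by (simp add: n2_def)
    \<comment> \<open>The denominators cancel in the quotient, which turns the inequality defining
      \<open>D\<close> into \<open>\<bar>Arg (1 + 1 / z)\<bar> < \<alpha>\<close>.\<close>
    have re: "Re (1 + 1 / z) = (Re z + n2) / n2" and im: "Im (1 + 1 / z) = - Im z / n2"
      using n2 by (auto simp: Re_divide Im_divide n2_def cmod_power2 add_divide_distrib)
    show 1: "Re (1 + 1 / z) > 0" unfolding re using n2 zD by simp
    have "\<bar>Im (1 + 1 / z)\<bar> / Re (1 + 1 / z) = \<bar>Im z\<bar> / (Re z + n2)"
      unfolding re im using n2 by (simp add: abs_divide)
    also have "\<dots> < 1 / c" using zD n2 c by (simp add: n2_def[symmetric] field_simps)
    finally have "arctan (\<bar>Im (1 + 1 / z)\<bar> / Re (1 + 1 / z)) < \<alpha>" unfolding \<alpha>_def by (simp only: arctan_less_iff)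
    then have "\<bar>Arg (1 + 1 / z)\<bar> < \<alpha>" using abs_Arg_le(1)[OF 1] by linarith
    then have "\<rho> * \<bar>Arg (1 + 1 / z)\<bar> < \<rho> * \<alpha>" using \<rho>1 by (intro mult_strict_left_mono) auto
    then show "\<bar>\<rho> * Arg (1 + 1 / z)\<bar> < pi / 2" using \<rho>\<alpha> \<rho>1 by (simp add: abs_mult)
  qed
  have normP: "(1 / (2 * norm z)) powr \<rho> \<le> norm (P z)" "1 / (2 * norm z) \<le> norm (P z)" if z: "z \<in> D" for z
  proof -
    note zD = DD[OF z]
    have n: "norm z > 0" "norm z \<le> 1 / 2" using zD d by auto
    have "norm (1 / z) \<le> norm (1 + 1 / z) + 1" using norm_triangle_ineq4[of "1 + 1 / z" 1] by simp
    moreover have "1 / (2 * norm z) + 1 \<le> norm (1 / z)" using n by (simp add: norm_divide field_simps)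
    ultimately have a: "1 / (2 * norm z) \<le> norm (1 + 1 / z)" by linarith
    have ne: "1 + 1 / z \<noteq> 0" using w(1)[OF z] by (metis less_irrefl zero_complex.sel(1))
    have "(1 / (2 * norm z)) powr \<rho> \<le> norm (1 + 1 / z) powr \<rho>"
      using a \<rho>1 by (intro powr_mono2) auto
    then show 1: "(1 / (2 * norm z)) powr \<rho> \<le> norm (P z)" using ne by (simp add: P_def norm_cpow)
    have "1 / (2 * norm z) = (1 / (2 * norm z)) powr 1" using n by simp
    also have "\<dots> \<le> (1 / (2 * norm z)) powr \<rho>" using n \<rho>1 by (intro powr_mono) auto
    finally show "1 / (2 * norm z) \<le> norm (P z)" using 1 by linarith
  qed
  have bound: "norm (g z) * (norm z)\<^sup>2 \<le> M" if z: "z \<in> D" for z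
  proof -
    have "norm (G z) \<le> 1"
    proof (rule Phragmen_Lindeloef[OF D, where G = G and \<Phi> = P])
      have "D \<subseteq> slit \<eta>"
      proof
        fix z assume "z \<in> D"
        from DD[OF this] show "z \<in> slit \<eta>" by (intro in_slit) auto
      qed
      then show "G holomorphic_on D" unfolding G_def using M
        by (intro holomorphic_intros holomorphic_on_subset[OF g]) auto
      show "P holomorphic_on D" unfolding P_def cpow_def
        by (intro holomorphic_intros) (use DD w(1) in \<open>auto simp: complex_nonpos_Reals_iff not_le\<close>)
      show "Re (P z) > 0" if "z \<in> D" for z
      proof -
        have ne: "1 + 1 / z \<noteq> 0" using w(1)[OF that] by (metis less_irrefl zero_complex.sel(1))
        have "cos (\<rho> * Arg (1 + 1 / z)) > 0" using w(2)[OF that] by (intro cos_gt_zero_pi) (auto simp: abs_less_iff)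
        then show ?thesis using ne by (simp add: P_def Re_cpow)
      qed
      show "z \<in> D" by fact
      fix \<xi> assume "\<xi> \<in> frontier D"
      then have f: "\<xi> \<notin> D" "c * \<bar>Im \<xi>\<bar> \<le> Re \<xi> + (norm \<xi>)\<^sup>2" "norm \<xi> \<le> d"
        using cl[of \<xi>] D by (auto simp: frontier_def interior_open)
      let ?A = "\<forall>e>0. \<forall>\<^sub>F z in at \<xi> within D. norm (G z) \<le> 1 + e"
      let ?B = "filterlim P at_infinity (at \<xi> within D) \<and>
        (\<forall>e>0. \<forall>\<^sub>F z in at \<xi> within D. norm (G z) \<le> exp (e * norm (P z)))"
      show "?A \<or> ?B"
      proof (cases "\<xi> = 0")
        case True
        have small: "\<forall>\<^sub>F z in at \<xi> within D. norm z < r" if "r > 0" for r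
        proof -
          have "((\<lambda>z. norm z) \<longlongrightarrow> norm \<xi>) (at \<xi> within D)" by (intro tendsto_intros)
          then show ?thesis by (rule order_tendstoD(2)) (use that True in simp)
        qed
        have evD: "\<forall>\<^sub>F z in at \<xi> within D. z \<in> D" by (simp add: eventually_at_filter)
        have lim: "filterlim P at_infinity (at \<xi> within D)"
          unfolding filterlim_at_infinity[OF order_refl]
        proof (intro allI impI)
          fix r :: real assume r: "r > 0"
          have "\<forall>\<^sub>F z in at \<xi> within D. norm z < 1 / (2 * r)" using r by (intro small) simp
          then show "\<forall>\<^sub>F z in at \<xi> within D. r \<le> norm (P z)" using evD
          proof eventually_elim
            case (elim z)
            have "norm z > 0" using DD[OF elim(2)] by simp
            then have "r \<le> 1 / (2 * norm z)" using elim(1) r by (simp add: field_simps)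
            then show ?case using normP(2)[OF elim(2)] by linarith
          qed
        qed
        have "\<forall>\<^sub>F z in at \<xi> within D. norm (G z) \<le> exp (e' * norm (P z))" if e': "e' > 0" for e'
        proof -
          have "e' * (1 / 2) powr \<rho> > 0" using e' by simp
          then obtain d' where d': "d' > 0"
            "\<And>z. 0 < Re z \<Longrightarrow> norm z < d' \<Longrightarrow> norm (g z) \<le> exp (e' * (1 / 2) powr \<rho> * norm z powr (- \<rho>))"
            using growth by blast
          show ?thesis using small[OF d'(1)] evD
          proof eventually_elim
            case (elim z)
            note zD = DD[OF elim(2)]
            have "norm (g z) \<le> exp (e' * (1 / 2) powr \<rho> * norm z powr (- \<rho>))" using d' zD elim by blast
            also have "e' * (1 / 2) powr \<rho> * norm z powr (- \<rho>) = e' * (1 / (2 * norm z)) powr \<rho>"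
              using powr_quotient[of "1 / 2" "norm z" \<rho>] zD
              by (simp add: mult.assoc powr_minus powr_divide powr_mult divide_simps)
            also have "\<dots> \<le> e' * norm (P z)" using normP(1)[OF elim(2)] e' by (intro mult_left_mono) auto
            finally have "norm (g z) \<le> exp (e' * norm (P z))" by simp
            moreover have "norm (G z) \<le> norm (g z) * 1"
            proof -
              have "(norm z)\<^sup>2 \<le> 1" using zD d by (intro power_le_one) auto
              then have "(norm z)\<^sup>2 / M \<le> 1" using M by (simp add: divide_le_eq)
              then have "norm (g z) * ((norm z)\<^sup>2 / M) \<le> norm (g z) * 1" by (intro mult_left_mono) auto
              then show ?thesis by (simp add: normG)
            qed
            ultimately show ?case by simp
          qed
        qed
        with lim show ?thesis by blast
      next
        case False
        have cG: "isCont G \<xi>" unfolding G_def using M isCont_slit[OF g in_slit[OF f(2) False f(3)]]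
          by (intro continuous_intros) auto
        have "norm (g \<xi>) * (norm \<xi>)\<^sup>2 \<le> M"
        proof (cases "norm \<xi> = d")
          case True
          then have "norm (g \<xi>) \<le> M" using f by (intro M) (simp add: S_def)
          moreover have "(norm \<xi>)\<^sup>2 \<le> 1" using f d by (intro power_le_one) auto
          ultimately have "norm (g \<xi>) * (norm \<xi>)\<^sup>2 \<le> M * 1" using M by (intro mult_mono) auto
          then show ?thesis by simp
        next
          case nd: False
          have eq: "c * \<bar>Im \<xi>\<bar> = Re \<xi> + (norm \<xi>)\<^sup>2" using f nd by (auto simp: D_def)
          have x: "Re \<xi> > 0" using re_pos f False by blast
          have "c * \<bar>Im \<xi>\<bar> > 0" unfolding eq using x by (intro add_pos_nonneg) auto
          then have "Im \<xi> \<noteq> 0" by auto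
          then have "norm (g \<xi>) * (norm \<xi>)\<^sup>2 \<le> 12 * (1 + c)"
          proof (cases "Im \<xi> > 0")
            case True
            then show ?thesis using edge_up[of \<xi>] eq f gF[of \<xi>] by simp
          next
            case False
            then have "Im (cnj \<xi>) > 0" using \<open>Im \<xi> \<noteq> 0\<close> by simp
            then show ?thesis using edge_up[of "cnj \<xi>"] eq f gF[of "cnj \<xi>"] sym[of \<xi>] by simp
          qed
          then show ?thesis using M by linarith
        qed
        then have "norm (G \<xi>) \<le> 1" unfolding normG using M by simp
        then show ?thesis using cG eventually_norm_le_of_isCont by blast
      qed
    qed
    then show ?thesis unfolding normG using M by simp
  qed
  \<comment> \<open>Off the approach region \<open>\<bar>Re (F z)\<bar> \<le> M / (c * Re z)\<close>
    and \<open>norm z \<le> (1 + 1 / c) * Re z\<close>, so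
    \<open>\<bar>Re (F z)\<bar> * (norm z)\<^sup>2 \<le> A * Re z\<close>.\<close>
  define A where "A = M * (1 + 1 / c)\<^sup>2 / c"
  have A: "A > 0" unfolding A_def using M c by (intro divide_pos_pos mult_pos_pos zero_less_power add_pos_pos) auto
  define d3 where "d3 = min (min d 1) (min e (e / A))"
  have d3: "d3 > 0" "d3 \<le> d" "d3 \<le> 1" "d3 \<le> e" "d3 \<le> e / A" using d e A by (auto simp: d3_def)
  have "\<bar>Re (F z)\<bar> \<le> e / (norm z)\<^sup>2" if z: "0 < Re z" "0 < Im z" "norm z < d3" for z
  proof -
    have n: "norm z > 0" using z by auto
    have n2: "(norm z)\<^sup>2 \<le> norm z" using z d3 n by (simp add: power2_eq_square mult_le_cancel_left1)
    have "\<bar>Re (F z)\<bar> * (norm z)\<^sup>2 \<le> e"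
    proof (cases "Re z \<le> c * Im z")
      case True
      then have "\<bar>Re (F z)\<bar> \<le> 1" using z d d3 by (intro d1) auto
      then have "\<bar>Re (F z)\<bar> * (norm z)\<^sup>2 \<le> 1 * (norm z)\<^sup>2" by (intro mult_right_mono) auto
      then show ?thesis using n2 z d3 by linarith
    next
      case False
      have "\<bar>Re (F (Complex (Re z) (Im z)))\<bar> \<le> M / (Re z)\<^sup>2 * Im z"
      proof (rule Re_le_vertical[OF F])
        show "boundary_zero (\<lambda>z. Re (F z)) (Re z)"
          using z d3 d complex_Re_le_cmod[of z] by (intro zero) auto
        show "Im z > 0" by fact
        fix t assume t: "0 < t" "t \<le> Im z"
        let ?w = "Complex (Re z) t"
        have "(norm ?w)\<^sup>2 \<le> (norm z)\<^sup>2" unfolding cmod_power2 using t by (simp add: power_mono)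
        then have "norm ?w \<le> norm z" by (rule power2_le_imp_le) simp
        moreover have "c * t \<le> c * Im z" using t c by simp
        then have "c * t < Re z + (norm ?w)\<^sup>2" using False zero_le_power2[of "norm ?w"] by linarith
        ultimately have "?w \<in> D" using t z d3 by (auto simp: D_def)
        then have "norm (g ?w) * (norm ?w)\<^sup>2 \<le> M" by (rule bound)
        moreover have "norm (g ?w) * (Re z)\<^sup>2 \<le> norm (g ?w) * (norm ?w)\<^sup>2"
          unfolding cmod_power2 by (intro mult_left_mono) auto
        ultimately have "norm (g ?w) * (Re z)\<^sup>2 \<le> M" by linarith
        then show "norm (deriv F ?w) \<le> M / (Re z)\<^sup>2" using gF[of ?w] t z by (simp add: pos_le_divide_eq)
      qed
      also have "\<dots> \<le> M / (Re z)\<^sup>2 * (Re z / c)"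
        using False c M by (intro mult_left_mono) (auto simp: field_simps)
      also have "\<dots> = M / (c * Re z)" using z by (simp add: power2_eq_square)
      finally have F1: "\<bar>Re (F z)\<bar> \<le> M / (c * Re z)" by simp
      have "norm z \<le> Re z + Im z" using cmod_le[of z] z by simp
      also have "Im z \<le> Re z / c" using False c by (simp add: field_simps)
      finally have "norm z \<le> (1 + 1 / c) * Re z" by (simp add: algebra_simps)
      then have "(norm z)\<^sup>2 \<le> ((1 + 1 / c) * Re z)\<^sup>2" by (intro power_mono) auto
      with F1 have "\<bar>Re (F z)\<bar> * (norm z)\<^sup>2 \<le> M / (c * Re z) * ((1 + 1 / c) * Re z)\<^sup>2"
        using M c z by (intro mult_mono) auto
      also have "\<dots> = A * Re z" using z c by (simp add: A_def power_mult_distrib power2_eq_square)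
      also have "\<dots> \<le> A * (e / A)" using A z d3 complex_Re_le_cmod[of z] by (intro mult_left_mono) auto
      also have "\<dots> = e" using A by simp
      finally show ?thesis .
    qed
    then show ?thesis using n by (simp add: pos_le_divide_eq)
  qed
  then show ?thesis using d3(1) by blast
qed

subsection \<open>Corners with cusps\<close>

text \<open>As for powers, but the factor \<open>12 / y\<close> is now swallowed by the difference
  of the two inner exponentials.\<close>

lemma deriv_growth_exp:
  assumes F: "F holomorphic_on upper" and \<gamma>: "\<gamma> < 1"
    and gr: "\<And>e. e > 0 \<Longrightarrow> \<exists>d>0. \<forall>z. 0 < Im z \<and> norm z < d \<longrightarrow> \<bar>Re (F z)\<bar> \<le> exp (exp (e * Im z powr (\<gamma> - 1)))"
    and e: "e > 0"
  shows "\<exists>d>0. \<forall>z. 0 < Im z \<and> norm z < d \<longrightarrow> norm (deriv F z) \<le> exp (exp (e * Im z powr (\<gamma> - 1)))"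
proof -
  define e1 where "e1 = e / 2 * (1 / 2) powr (1 - \<gamma>)"
  have "e1 > 0" using e by (simp add: e1_def)
  then obtain d1 where d1: "d1 > 0" "\<And>z. 0 < Im z \<Longrightarrow> norm z < d1 \<Longrightarrow> \<bar>Re (F z)\<bar> \<le> exp (exp (e1 * Im z powr (\<gamma> - 1)))"
    using gr by blast
  have "\<forall>\<^sub>F y in at_right (0::real). 12 / y \<le> exp (exp (e * y powr (\<gamma> - 1)) - exp (e / 2 * y powr (\<gamma> - 1)))"
    using e \<gamma> by real_asymp
  then obtain d2 where d2: "d2 > 0" "\<And>y. 0 < y \<Longrightarrow> y < d2 \<Longrightarrow> 12 / y \<le> exp (exp (e * y powr (\<gamma> - 1)) - exp (e / 2 * y powr (\<gamma> - 1)))"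
    by (auto simp: eventually_at_right_field)
  define d where "d = min (d1 / 2) d2"
  have d: "d > 0" "d \<le> d1 / 2" "d \<le> d2" using d1 d2 by (auto simp: d_def)
  have "norm (deriv F z) \<le> exp (exp (e * Im z powr (\<gamma> - 1)))" if z: "0 < Im z" "norm z < d" for z
  proof -
    define y where "y = Im z"
    have y: "0 < y" "y < d" using z abs_Im_le_cmod[of z] by (auto simp: y_def)
    define X where "X = exp (exp (e / 2 * y powr (\<gamma> - 1)))"
    have "norm (deriv F z) \<le> 6 * X / (y / 2)"
    proof (rule deriv_bound_on_upper[OF F])
      fix w assume w: "w \<in> ball z (y / 2)"
      have w': "y / 2 \<le> Im w" "norm w < d1"
        using ball_coordinates(2,3)[OF w] z y d abs_Im_le_cmod[of z] unfolding y_def[symmetric] by linarith+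
      then have "\<bar>Re (F w)\<bar> \<le> exp (exp (e1 * Im w powr (\<gamma> - 1)))" using y by (intro d1) auto
      also have "e1 * Im w powr (\<gamma> - 1) \<le> e1 * (y / 2) powr (\<gamma> - 1)"
        using w' y \<gamma> \<open>e1 > 0\<close> by (intro mult_left_mono powr_mono2') auto
      also have "\<dots> = e / 2 * ((1 / 2) powr (1 - \<gamma>) * (y / 2) powr (- (1 - \<gamma>)))" by (simp add: e1_def)
      also have "(1 / 2) powr (1 - \<gamma>) * (y / 2) powr (- (1 - \<gamma>)) = y powr (- (1 - \<gamma>))"
        using powr_quotient[of "1 / 2" "y / 2" "1 - \<gamma>"] y by simp
      finally show "\<bar>Re (F w)\<bar> \<le> X" by (simp add: X_def)
    qed (use y in \<open>auto simp: y_def X_def\<close>)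
    also have "\<dots> = (12 / y) * X" by simp
    also have "\<dots> \<le> exp (exp (e * y powr (\<gamma> - 1)) - exp (e / 2 * y powr (\<gamma> - 1))) * X"
      using d2(2)[of y] y d by (intro mult_right_mono) (auto simp: X_def)
    also have "\<dots> = exp (exp (e * Im z powr (\<gamma> - 1)))" by (simp add: X_def y_def flip: exp_add)
    finally show ?thesis .
  qed
  then show ?thesis using d(1) by blast
qed

text \<open>
  On the cusp \<open>\<bar>Im z\<bar> \<le> (2 * Re z) powr (k + 1)\<close> the imaginary part of \<open>cpow (- k) z\<close> is bounded, so
  there \<open>exp (l * cpow (- k) z)\<close> has positive real part for small \<open>l\<close>.
\<close>

lemma cusp_cpow:
  assumes k: "k > 0" and x: "0 < Re z" and z: "\<bar>Im z\<bar> \<le> (2 * Re z) powr (k + 1)"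
    and small: "(1 + k) * 2 powr (k + 1) * Re z powr k \<le> 1"
  shows "\<bar>Im (cpow (- k) z)\<bar> \<le> k * 2 powr (k + 1)"
    and "norm z powr (- k) / 2 \<le> Re (cpow (- k) z)"
    and "norm z \<le> 2 * Re z"
proof -
  have z0: "z \<noteq> 0" "Re z \<le> norm z" using x complex_Re_le_cmod[of z] by auto
  have split: "(2 * Re z) powr (k + 1) = 2 powr (k + 1) * Re z powr k * Re z"
    using x by (simp add: powr_mult powr_add)
  have b: "\<bar>Im z\<bar> / Re z \<le> 2 powr (k + 1) * Re z powr k"
    using z x unfolding split by (simp add: pos_divide_le_eq)
  have Arg: "\<bar>Arg z\<bar> \<le> 2 powr (k + 1) * Re z powr k"
    using abs_Arg_le(2)[OF x] b by linarith
  then have kA: "k * \<bar>Arg z\<bar> \<le> k * (2 powr (k + 1) * Re z powr k)" using k by (intro mult_left_mono) auto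
  have "\<bar>sin (- k * Arg z)\<bar> \<le> \<bar>- k * Arg z\<bar>" by (rule abs_sin_x_le_abs_x)
  also have "\<dots> = k * \<bar>Arg z\<bar>" using k by (simp add: abs_mult)
  also note kA
  also have "k * (2 powr (k + 1) * Re z powr k) \<le> k * (2 powr (k + 1) * norm z powr k)"
    using k x z0 by (intro mult_left_mono powr_mono2) auto
  finally have "norm z powr (- k) * \<bar>sin (- k * Arg z)\<bar> \<le> norm z powr (- k) * (k * (2 powr (k + 1) * norm z powr k))"
    by (intro mult_left_mono) auto
  also have "\<dots> = k * 2 powr (k + 1)" using z0 by (simp add: powr_minus)
  finally show "\<bar>Im (cpow (- k) z)\<bar> \<le> k * 2 powr (k + 1)" using z0 by (simp add: Im_cpow abs_mult)
  have p: "2 powr (k + 1) * Re z powr k \<ge> 0" by simp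
  \<comment> \<open>The single smallness condition covers both
    \<open>k * \<bar>Arg z\<bar> \<le> 1\<close> and
    \<open>\<bar>Im z\<bar> \<le> Re z\<close>.\<close>
  have s: "2 powr (k + 1) * Re z powr k + k * (2 powr (k + 1) * Re z powr k) \<le> 1"
    using small by (simp add: algebra_simps)
  have "k * (2 powr (k + 1) * Re z powr k) \<ge> 0" using k by simp
  then have "k * \<bar>Arg z\<bar> \<le> 1" using kA s p by linarith
  then have "\<bar>- k * Arg z\<bar> \<le> pi / 3" using k pi_gt3 by (simp add: abs_mult)
  then have "1 / 2 \<le> cos (- k * Arg z)" by (rule half_le_cos)
  then have "norm z powr (- k) * (1 / 2) \<le> norm z powr (- k) * cos (- k * Arg z)"
    by (intro mult_left_mono) auto
  then show "norm z powr (- k) / 2 \<le> Re (cpow (- k) z)" using z0 by (simp add: Re_cpow)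
  have "\<bar>Im z\<bar> / Re z \<le> 1" using b s \<open>k * (2 powr (k + 1) * Re z powr k) \<ge> 0\<close> by linarith
  then have "\<bar>Im z\<bar> \<le> Re z" using x by simp
  then show "norm z \<le> 2 * Re z" using cmod_le[of z] x by simp
qed

text \<open>\<open>l\<close> is so small that the imaginary part of the exponent is at most 1, below
  \<open>pi / 3\<close>, where the cosine is at least \<open>1 / 2\<close>.\<close>

lemma Re_exp_cusp:
  assumes k: "k > 0" and x: "0 < Re z" and z: "\<bar>Im z\<bar> \<le> (2 * Re z) powr (k + 1)"
    and small: "(1 + k) * 2 powr (k + 1) * Re z powr k \<le> 1" and l: "l > 0" "l * (k * 2 powr (k + 1)) \<le> 1"
  shows "exp (l / 2 * norm z powr (- k)) / 2 \<le> Re (exp (of_real l * cpow (- k) z))"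
    and "norm (exp (of_real l * cpow (- k) z)) \<le> exp (l * norm z powr (- k))"
proof -
  note C = cusp_cpow[OF k x z small]
  have "l * \<bar>Im (cpow (- k) z)\<bar> \<le> 1" using mult_left_mono[OF C(1), of l] l by linarith
  then have "\<bar>l * Im (cpow (- k) z)\<bar> \<le> pi / 3" using l pi_gt3 by (simp add: abs_mult)
  then have c: "1 / 2 \<le> cos (l * Im (cpow (- k) z))" by (rule half_le_cos)
  have "l / 2 * norm z powr (- k) \<le> l * Re (cpow (- k) z)" using mult_left_mono[OF C(2), of l] l by simp
  then have "exp (l / 2 * norm z powr (- k)) * (1 / 2) \<le> exp (l * Re (cpow (- k) z)) * cos (l * Im (cpow (- k) z))"
    using c by (intro mult_mono) auto
  then show "exp (l / 2 * norm z powr (- k)) / 2 \<le> Re (exp (of_real l * cpow (- k) z))" by (simp add: Re_exp)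
  have "z \<noteq> 0" using x by auto
  then have "Re (cpow (- k) z) \<le> norm z powr (- k)" using complex_Re_le_cmod[of "cpow (- k) z"] by (simp add: norm_cpow)
  then show "norm (exp (of_real l * cpow (- k) z)) \<le> exp (l * norm z powr (- k))" using l by simp
qed

text \<open>On the edge \<open>\<bar>Im z\<bar> = (2 * Re z) powr (k + 1)\<close> the hypothesis
  becomes one in \<open>Re z\<close>, because \<open>(k + 1) * (\<gamma> - 1) = - k\<close>. As
  before, translates share the imaginary part and hence the edge estimate.\<close>

lemma growth_near_zero_cusp:
  assumes g: "g holomorphic_on slit \<eta>" "\<eta> > 0" and sym: "\<And>z. norm (g (cnj z)) = norm (g z)"
    and k: "k > 0" and \<gamma>: "\<gamma> = 1 / (k + 1)"
    and gr: "\<And>e. e > 0 \<Longrightarrow> \<exists>d>0. \<forall>z. 0 < Im z \<and> norm z < d \<longrightarrow> norm (g z) \<le> exp (exp (e * Im z powr (\<gamma> - 1)))"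
    and l: "l > 0" "l * (k * 2 powr (k + 1)) \<le> 1"
  shows "\<exists>d>0. \<exists>C\<ge>1. \<forall>z. 0 < Re z \<and> Re z < d \<and> \<bar>Im z\<bar> < (2 * Re z) powr (k + 1) \<longrightarrow>
    norm (g z) \<le> C * exp (exp (l * norm z powr (- k)))"
proof -
  \<comment> \<open>With \<open>l / 4\<close> the edge bound is \<open>exp T\<close>. Once
    \<open>T \<ge> 2\<close>, it is at most \<open>exp (T * T / 2)\<close>, and
    \<open>T * T / 2\<close> lies below the lower bound of \<open>Re_exp_cusp\<close> for the
    majorant.\<close>
  define e1 where "e1 = l / 4"
  have "e1 > 0" using l by (simp add: e1_def)
  then obtain d1 where d1: "d1 > 0" "\<And>z. 0 < Im z \<Longrightarrow> norm z < d1 \<Longrightarrow> norm (g z) \<le> exp (exp (e1 * Im z powr (\<gamma> - 1)))"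
    using gr by blast
  have d1': "norm (g z) \<le> exp (exp (e1 * \<bar>Im z\<bar> powr (\<gamma> - 1)))" if "Im z \<noteq> 0" "norm z < d1" for z
  proof (cases "Im z > 0")
    case True then show ?thesis using d1(2)[of z] that by simp
  next
    case False then show ?thesis using d1(2)[of "cnj z"] that sym[of z] by simp
  qed
  have "\<forall>\<^sub>F x in at_right (0::real). (1 + k) * 2 powr (k + 1) * x powr k \<le> 1" using k by real_asymp
  then obtain d2 where d2: "d2 > 0" "\<And>x. 0 < x \<Longrightarrow> x < d2 \<Longrightarrow> (1 + k) * 2 powr (k + 1) * x powr k \<le> 1"
    by (auto simp: eventually_at_right_field)
  have "\<forall>\<^sub>F x in at_right (0::real). 2 \<le> exp (l / 4 * (2 * x) powr (- k))" using k l(1) by real_asymp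
  then obtain d3 where d3: "d3 > 0" "\<And>x. 0 < x \<Longrightarrow> x < d3 \<Longrightarrow> 2 \<le> exp (l / 4 * (2 * x) powr (- k))"
    by (auto simp: eventually_at_right_field)
  define d where "d = min (min (\<eta> / 2) (d1 / 4)) (min (d2 / 2) (d3 / 2))"
  have d: "d > 0" "d < \<eta>" "4 * d \<le> d1" "d < d2" "d < d3"
  proof -
    show 1: "d > 0" using g d1 d2 d3 by (simp add: d_def)
    have "d \<le> \<eta> / 2" "d \<le> d1 / 4" "d \<le> d2 / 2" "d \<le> d3 / 2" unfolding d_def by linarith+
    with 1 show "d < \<eta>" "4 * d \<le> d1" "d < d2" "d < d3" by linarith+
  qed
  \<comment> \<open>Extended by 0 to negative arguments, since continuity and monotonicity are
    required on the whole line.\<close>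
  define \<omega> where "\<omega> x = (2 * max 0 x) powr (k + 1)" for x :: real
  define B where "B z = exp (of_real l * cpow (- k) z)" for z
  have \<omega>: "\<omega> x = (2 * x) powr (k + 1)" if "x > 0" for x using that by (simp add: \<omega>_def)
  obtain C where C: "C \<ge> 1" "\<And>z. 0 < Re z \<Longrightarrow> Re z < d \<Longrightarrow> \<bar>Im z\<bar> < \<omega> (Re z) \<Longrightarrow> norm (g z) \<le> C * exp (Re (B z))"
  proof (rule bound_by_translation[OF g(1) d(1,2), where \<omega> = \<omega> and B = B])
    show "continuous_on UNIV \<omega>" unfolding \<omega>_def
      using k by (intro continuous_on_powr' continuous_intros) auto
    show "mono \<omega>" unfolding \<omega>_def using k by (intro monoI powr_mono2) auto
    show "\<omega> 0 = 0" by (simp add: \<omega>_def)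
    show "B holomorphic_on {z. 0 < Re z}" unfolding B_def by (intro holomorphic_intros holomorphic_cpow)
    have ReB: "exp (l / 2 * norm z powr (- k)) / 2 \<le> Re (B z)" if "0 < Re z" "Re z < d" "\<bar>Im z\<bar> \<le> \<omega> (Re z)" for z
      unfolding B_def by (rule Re_exp_cusp(1)[OF k that(1) _ d2(2) l]) (use that d \<omega> in auto)
    show "0 \<le> Re (B z)" if "0 < Re z" "Re z < d" "\<bar>Im z\<bar> \<le> \<omega> (Re z)" for z
      using ReB[OF that] exp_gt_zero[of "l / 2 * norm z powr (- k)"] by linarith
    show "norm (g (z + of_real \<delta>)) \<le> exp (Re (B z))"
      if h: "0 < \<delta>" "0 < Re z" "Re z + \<delta> \<le> d" "\<bar>Im z\<bar> = \<omega> (Re z)" for \<delta> z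
    proof -
      define T where "T = exp (l / 4 * (2 * Re z) powr (- k))"
      have small: "(1 + k) * 2 powr (k + 1) * Re z powr k \<le> 1" using h d by (intro d2) auto
      have imz: "\<bar>Im z\<bar> = (2 * Re z) powr (k + 1)" using h \<omega> by simp
      have n2: "norm z \<le> 2 * Re z" by (rule cusp_cpow(3)[OF k h(2) _ small]) (use imz in simp)
      have im: "\<bar>Im z\<bar> > 0" using imz h by simp
      have "norm (z + of_real \<delta>) \<le> norm z + norm (of_real \<delta> :: complex)" by (rule norm_triangle_ineq)
      also have "\<dots> < d1" using n2 h d by simp
      finally have "norm (g (z + of_real \<delta>)) \<le> exp (exp (e1 * \<bar>Im z\<bar> powr (\<gamma> - 1)))"
        using d1'[of "z + of_real \<delta>"] im by simp
      also have "\<bar>Im z\<bar> powr (\<gamma> - 1) = (2 * Re z) powr (- k)"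
      proof -
        have "(k + 1) * (\<gamma> - 1) = - k" unfolding \<gamma> using k by (simp add: field_simps)
        then show ?thesis unfolding imz by (simp add: powr_powr)
      qed
      also have "exp (e1 * (2 * Re z) powr (- k)) = T" by (simp add: T_def e1_def)
      also have "T \<le> T * T / 2"
      proof -
        have "2 \<le> T" unfolding T_def using h d by (intro d3) auto
        then have "T * 2 \<le> T * T" by (intro mult_left_mono) (auto simp: T_def)
        then show ?thesis by simp
      qed
      also have "T * T = exp (l / 2 * (2 * Re z) powr (- k))" by (simp add: T_def flip: exp_add)
      also have "\<dots> / 2 \<le> exp (l / 2 * norm z powr (- k)) / 2"
      proof -
        have "(2 * Re z) powr (- k) \<le> norm z powr (- k)"
          using n2 k h by (intro powr_mono2') auto
        then show ?thesis using l by simp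
      qed
      also have "\<dots> \<le> Re (B z)" using h by (intro ReB) auto
      finally show ?thesis by simp
    qed
  qed blast
  have "norm (g z) \<le> C * exp (exp (l * norm z powr (- k)))"
    if h: "0 < Re z" "Re z < d" "\<bar>Im z\<bar> < (2 * Re z) powr (k + 1)" for z
  proof -
    have "norm (g z) \<le> C * exp (Re (B z))" using h \<omega> by (intro C) auto
    also have "\<dots> \<le> C * exp (exp (l * norm z powr (- k)))"
    proof -
      have "norm (B z) \<le> exp (l * norm z powr (- k))" unfolding B_def
        by (rule Re_exp_cusp(2)[OF k h(1) _ d2(2) l]) (use h d in auto)
      then show ?thesis using complex_Re_le_cmod[of "B z"] C(1) by simp
    qed
    finally show ?thesis .
  qed
  then show ?thesis using C(1) d(1) by blast
qed

text \<open>With \<open>k = 1 / \<gamma> - 1\<close> the edge of the approach region is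
  \<open>y = x powr (k + 1)\<close>. The edge of \<open>D\<close>, with \<open>2 * x\<close> in
  place of \<open>x\<close>, runs well above it, so discs of radius \<open>y / 4\<close> fit into
  the region and the derivative is at most \<open>24 / y\<close>. Growth is used with
  \<open>l / 4\<close>, of smaller order than the lower bound with \<open>l / 2\<close> for
  \<open>P\<close>. In the end the derivative times the height of the cusp is bounded, and so is
  \<open>Re F\<close>.\<close>

lemma corner_bound_cusp:
  assumes F: "F holomorphic_on upper" and \<eta>: "\<eta> > 0"
    and zero: "\<And>t. 0 < t \<Longrightarrow> t < \<eta> \<Longrightarrow> boundary_zero (\<lambda>z. Re (F z)) t" and \<gamma>: "0 < \<gamma>" "\<gamma> < 1"
    and app: "\<And>e. e > 0 \<Longrightarrow> \<exists>d>0. \<forall>z. 0 < Im z \<and> norm z < d \<and> \<bar>Re z\<bar> \<le> Im z powr \<gamma> \<longrightarrow> \<bar>Re (F z)\<bar> \<le> e"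
    and gr: "\<And>e. e > 0 \<Longrightarrow> \<exists>d>0. \<forall>z. 0 < Im z \<and> norm z < d \<longrightarrow> \<bar>Re (F z)\<bar> \<le> exp (exp (e * Im z powr (\<gamma> - 1)))"
    and e: "e > 0"
  shows "\<exists>d>0. \<forall>z. 0 < Re z \<and> 0 < Im z \<and> norm z < d \<longrightarrow> \<bar>Re (F z)\<bar> \<le> e / (norm z)\<^sup>2"
proof -
  obtain g where g: "g holomorphic_on slit \<eta>" and gF: "\<And>z. Im z > 0 \<Longrightarrow> g z = deriv F z"
    and sym: "\<And>z. norm (g (cnj z)) = norm (g z)"
    using derivative_reflection[OF F zero] by metis
  define k where "k = 1 / \<gamma> - 1"
  have k: "k > 0" "\<gamma> = 1 / (k + 1)" using \<gamma> by (auto simp: k_def)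
  have gr_g: "\<exists>d>0. \<forall>z. 0 < Im z \<and> norm z < d \<longrightarrow> norm (g z) \<le> exp (exp (e * Im z powr (\<gamma> - 1)))" if "e > 0" for e
    using deriv_growth_exp[OF F \<gamma>(2) gr that] gF by auto
  define l where "l = 1 / (k * 2 powr (k + 1))"
  have l: "l > 0" "l * (k * 2 powr (k + 1)) \<le> 1" using k by (auto simp: l_def)
  have l4: "l / 4 > 0" "l / 4 * (k * 2 powr (k + 1)) \<le> 1" using l by auto
  obtain d0 C where d0: "d0 > 0" "C \<ge> 1" "\<And>z. 0 < Re z \<Longrightarrow> Re z < d0 \<Longrightarrow> \<bar>Im z\<bar> < (2 * Re z) powr (k + 1) \<Longrightarrow>
    norm (g z) \<le> C * exp (exp (l / 4 * norm z powr (- k)))"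
    using growth_near_zero_cusp[OF g \<eta> sym k gr_g l4] by blast
  obtain d1 where d1: "d1 > 0"
    "\<And>z. 0 < Im z \<Longrightarrow> norm z < d1 \<Longrightarrow> \<bar>Re z\<bar> \<le> Im z powr \<gamma> \<Longrightarrow> \<bar>Re (F z)\<bar> \<le> 1"
    using app[OF zero_less_one] by blast
  have "\<forall>\<^sub>F x in at_right (0::real). (1 + k) * 2 powr (k + 1) * x powr k \<le> 1" using k(1) by real_asymp
  then obtain d2 where d2: "d2 > 0" "\<And>x. 0 < x \<Longrightarrow> x < d2 \<Longrightarrow> (1 + k) * 2 powr (k + 1) * x powr k \<le> 1"
    by (auto simp: eventually_at_right_field)
  define d where "d = min (min (\<eta> / 2) d0) (min (min (d1 / 5) (d2 / 2)) (1 / 2))"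
  have d: "d > 0" "d < \<eta>" "d \<le> d0" "5 * d \<le> d1" "d < d2" "d \<le> 1 / 2"
  proof -
    show 1: "d > 0" using \<eta> d0 d1 d2 by (simp add: d_def)
    have "d \<le> \<eta> / 2" "d \<le> d1 / 5" "d \<le> d2 / 2" "d \<le> 1 / 2" "d \<le> d0" unfolding d_def by linarith+
    with 1 show "d < \<eta>" "d \<le> d0" "5 * d \<le> d1" "d < d2" "d \<le> 1 / 2" by linarith+
  qed
  define \<omega> where "\<omega> x = (2 * max 0 x) powr (k + 1)" for x :: real
  have \<omega>: "\<omega> x = (2 * x) powr (k + 1)" if "x > 0" for x using that by (simp add: \<omega>_def)
  have \<omega>0: "\<omega> 0 = 0" by (simp add: \<omega>_def)
  have cont\<omega>: "continuous_on UNIV \<omega>" unfolding \<omega>_def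
    using k by (intro continuous_on_powr' continuous_intros) auto
  then have c\<omega>: "continuous_on UNIV (\<lambda>z. \<omega> (Re z))"
    by (intro continuous_on_compose2[OF cont\<omega>] continuous_intros) auto
  have mono\<omega>: "mono \<omega>" unfolding \<omega>_def using k by (intro monoI powr_mono2) auto
  have \<omega>_le: "\<omega> x \<le> 2 * x" if "0 < x" "x \<le> d" for x
  proof -
    have "(2 * x) powr (k + 1) \<le> (2 * x) powr 1" using that d k by (intro powr_mono') auto
    then show ?thesis using that \<omega> by simp
  qed
  define D where "D = {z. 0 < Re z} \<inter> {z. Re z < d} \<inter> {z. \<bar>Im z\<bar> < \<omega> (Re z)}"
  have D: "open D" unfolding D_def by (intro open_Int open_Collect_less continuous_intros c\<omega>)
  have "closed ({z. 0 \<le> Re z} \<inter> {z. Re z \<le> d} \<inter> {z. \<bar>Im z\<bar> \<le> \<omega> (Re z)})"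
    by (intro closed_Int closed_Collect_le continuous_intros c\<omega>)
  then have "closure D \<subseteq> {z. 0 \<le> Re z} \<inter> {z. Re z \<le> d} \<inter> {z. \<bar>Im z\<bar> \<le> \<omega> (Re z)}"
    by (intro closure_minimal) (auto simp: D_def)
  then have cl: "0 \<le> Re z" "Re z \<le> d" "\<bar>Im z\<bar> \<le> \<omega> (Re z)" if "z \<in> closure D" for z using that by auto
  have "D \<subseteq> cbox (Complex 0 (- \<omega> d)) (Complex d (\<omega> d))"
  proof
    fix z assume "z \<in> D"
    then have z: "0 < Re z" "Re z < d" "\<bar>Im z\<bar> < \<omega> (Re z)" by (auto simp: D_def)
    moreover have "\<omega> (Re z) \<le> \<omega> d" using z by (intro monoD[OF mono\<omega>]) simp
    ultimately show "z \<in> cbox (Complex 0 (- \<omega> d)) (Complex d (\<omega> d))" by (auto simp: in_cbox_complex_iff)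
  qed
  then have bD: "bounded D" by (rule bounded_subset[OF bounded_cbox])
  have in_slit: "z \<in> slit \<eta>" if "0 < Re z" "Re z \<le> d" for z using that d by (simp add: slit_def)
  have nz: "norm z \<le> 2 * Re z" if "0 < Re z" "Re z \<le> d" "\<bar>Im z\<bar> \<le> \<omega> (Re z)" for z
    by (rule cusp_cpow(3)[OF k(1) that(1) _ d2(2)]) (use that d \<omega> in auto)
  have edge_up: "norm (deriv F z) * norm z powr (k + 1) \<le> 24"
    if z: "0 < Re z" "Re z \<le> d" "Im z = \<omega> (Re z)" for z
  proof -
    define x y where "x = Re z" and "y = Im z"
    have y: "y = (2 * x) powr (k + 1)" "x > 0" using z \<omega> by (auto simp: x_def y_def)
    then have y0: "y > 0" by simp
    have y2: "y \<le> 2 * x" using z \<omega>_le[of x] by (simp add: x_def y_def)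
    have "norm (deriv F z) \<le> 6 * 1 / (y / 4)"
    \<comment> \<open>In this disc \<open>\<bar>Re w\<bar> \<le> 3 / 2 * x\<close>, and
      \<open>(3 / 4 * y) powr \<gamma> \<ge> 3 / 4 * (2 * x)\<close> because
      \<open>y powr \<gamma> = 2 * x\<close> on the edge.\<close>
    proof (rule deriv_bound_on_upper[OF F])
      fix w assume w: "w \<in> ball z (y / 4)"
      note b = ball_coordinates[OF w]
      have im: "3 / 4 * y \<le> Im w" using b(2) unfolding y_def by linarith
      have re: "\<bar>Re w\<bar> \<le> 3 / 2 * x" using b(1) y2 y unfolding x_def by linarith
      have yg: "2 * x = y powr \<gamma>" unfolding y(1) using k y(2) by (simp add: powr_powr)
      have "3 / 4 * (2 * x) \<le> (3 / 4) powr \<gamma> * (2 * x)"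
        using powr_mono'[of \<gamma> 1 "3 / 4"] \<gamma> y by (intro mult_right_mono) auto
      also note yg
      also have "(3 / 4) powr \<gamma> * y powr \<gamma> = (3 / 4 * y) powr \<gamma>"
        by (subst powr_mult) (use y0 in auto)
      also have "\<dots> \<le> Im w powr \<gamma>" using im y0 \<gamma> by (intro powr_mono2) auto
      finally have "\<bar>Re w\<bar> \<le> Im w powr \<gamma>" using re yg by simp
      moreover have "norm w < d1"
      proof -
        have "norm z \<le> 2 * Re z" using z y0 by (intro nz) (auto simp: y_def)
        then show ?thesis using b(3) y2 z d unfolding x_def by linarith
      qed
      ultimately show "\<bar>Re (F w)\<bar> \<le> 1" using im y0 by (intro d1) auto
    qed (use y0 in \<open>auto simp: y_def\<close>)
    moreover have "norm z powr (k + 1) \<le> y"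
      unfolding y(1) using nz[of z] z y0 k by (intro powr_mono2) (auto simp: x_def y_def)
    ultimately have "norm (deriv F z) * norm z powr (k + 1) \<le> 6 * 1 / (y / 4) * y"
      using y0 by (intro mult_mono) auto
    then show ?thesis using y0 by simp
  qed
  define S where "S = closed_segment (Complex d (- \<omega> d)) (Complex d (\<omega> d))"
  have Seg: "z \<in> S \<longleftrightarrow> Re z = d \<and> \<bar>Im z\<bar> \<le> \<omega> d" for z
    using d \<omega>[of d] by (auto simp: S_def closed_segment_same_Re closed_segment_eq_real_ivl abs_le_iff)
  have "S \<subseteq> slit \<eta>" using d by (auto simp: Seg slit_def)
  moreover have "compact S" by (simp add: S_def)
  ultimately obtain M0 where M0: "M0 > 0" "\<And>z. z \<in> S \<Longrightarrow> norm (g z) \<le> M0"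
    using compact_slit_bound[OF g] by metis
  define M where "M = max 24 M0"
  have M: "M \<ge> 24" "M > 0" "\<And>z. z \<in> S \<Longrightarrow> norm (g z) \<le> M" using M0 by (auto simp: M_def le_max_iff_disj)
  define G where "G z = g z * cpow (k + 1) z / of_real M" for z
  define P where "P z = exp (of_real l * cpow (- k) z)" for z
  have normG: "norm (G z) = norm (g z) * norm z powr (k + 1) / M" if "Re z > 0" for z
  proof -
    have "z \<noteq> 0" using that by auto
    then show ?thesis using M by (simp add: G_def norm_mult norm_divide norm_cpow)
  qed
  have n1: "norm z powr (k + 1) \<le> 1" if "0 < Re z" "Re z \<le> d" "\<bar>Im z\<bar> \<le> \<omega> (Re z)" for z
  proof -
    have "norm z \<le> 1" using nz[OF that] that d by linarith
    then show ?thesis using k by (intro powr_le1) auto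
  qed
  have ReP: "exp (l / 2 * norm z powr (- k)) / 2 \<le> Re (P z)" if "z \<in> D" for z
    unfolding P_def by (rule Re_exp_cusp(1)[OF k(1) _ _ d2(2) l]) (use that d \<omega> in \<open>auto simp: D_def\<close>)
  have bound: "norm (g z) * norm z powr (k + 1) \<le> M" if z: "z \<in> D" for z
  proof -
    have "norm (G z) \<le> 1"
    proof (rule Phragmen_Lindeloef[OF D bD, where G = G and \<Phi> = P])
      have "D \<subseteq> slit \<eta>" using in_slit by (auto simp: D_def)
      then show "G holomorphic_on D" unfolding G_def using M
        by (intro holomorphic_intros holomorphic_on_subset[OF g] holomorphic_on_subset[OF holomorphic_cpow])
          (auto simp: D_def)
      show "P holomorphic_on D" unfolding P_def
        by (intro holomorphic_intros holomorphic_on_subset[OF holomorphic_cpow]) (auto simp: D_def)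
      show "Re (P z) > 0" if "z \<in> D" for z
        using ReP[OF that] exp_gt_zero[of "l / 2 * norm z powr (- k)"] by linarith
      show "z \<in> D" by fact
      fix \<xi> assume "\<xi> \<in> frontier D"
      then have f: "\<xi> \<notin> D" "0 \<le> Re \<xi>" "Re \<xi> \<le> d" "\<bar>Im \<xi>\<bar> \<le> \<omega> (Re \<xi>)"
        using cl[of \<xi>] D by (auto simp: frontier_def interior_open)
      let ?A = "\<forall>e>0. \<forall>\<^sub>F z in at \<xi> within D. norm (G z) \<le> 1 + e"
      let ?B = "filterlim P at_infinity (at \<xi> within D) \<and>
        (\<forall>e>0. \<forall>\<^sub>F z in at \<xi> within D. norm (G z) \<le> exp (e * norm (P z)))"
      show "?A \<or> ?B"
      proof (cases "Re \<xi> = 0")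
        case True
        then have \<xi>0: "\<xi> = 0" using f \<omega>0 by (simp add: complex_eq_iff)
        have evD: "\<forall>\<^sub>F z in at \<xi> within D. z \<in> D" by (simp add: eventually_at_filter)
        have nlim: "filterlim norm (at_right 0) (at \<xi> within D)"
          unfolding filterlim_at
        proof
          have "((\<lambda>z. norm z) \<longlongrightarrow> norm \<xi>) (at \<xi> within D)" by (intro tendsto_intros)
          then show "((\<lambda>z. norm z) \<longlongrightarrow> 0) (at \<xi> within D)" using \<xi>0 by simp
          show "\<forall>\<^sub>F z in at \<xi> within D. norm z \<in> {0<..} \<and> norm z \<noteq> 0"
            using evD by eventually_elim (auto simp: D_def)
        qed
        have normP: "exp (l / 2 * norm z powr (- k)) / 2 \<le> norm (P z)" if "z \<in> D" for z
          using ReP[OF that] complex_Re_le_cmod[of "P z"] by linarith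
        have lim: "filterlim P at_infinity (at \<xi> within D)"
          unfolding filterlim_at_infinity[OF order_refl]
        proof (intro allI impI)
          fix r :: real assume r: "r > 0"
          have "\<forall>\<^sub>F y in at_right (0::real). r \<le> exp (l / 2 * y powr (- k)) / 2" using l(1) k(1) r by real_asymp
          then have "\<forall>\<^sub>F z in at \<xi> within D. r \<le> exp (l / 2 * norm z powr (- k)) / 2"
            using nlim by (rule eventually_compose_filterlim)
          then show "\<forall>\<^sub>F z in at \<xi> within D. r \<le> norm (P z)" using evD
            by eventually_elim (use normP in force)
        qed
        have "\<forall>\<^sub>F z in at \<xi> within D. norm (G z) \<le> exp (e' * norm (P z))" if e': "e' > 0" for e'
        proof -
          have "\<forall>\<^sub>F y in at_right (0::real). ln C + exp (l / 4 * y powr (- k)) \<le> e' / 2 * exp (l / 2 * y powr (- k))"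
            using l(1) k(1) e' by real_asymp
          then have "\<forall>\<^sub>F z in at \<xi> within D. ln C + exp (l / 4 * norm z powr (- k)) \<le> e' / 2 * exp (l / 2 * norm z powr (- k))"
            using nlim by (rule eventually_compose_filterlim)
          then show ?thesis using evD
          proof eventually_elim
            case (elim z)
            have zD: "0 < Re z" "Re z < d" "\<bar>Im z\<bar> < \<omega> (Re z)" using elim(2) by (auto simp: D_def)
            have "norm (g z) \<le> C * exp (exp (l / 4 * norm z powr (- k)))" using zD d \<omega> by (intro d0) auto
            also have "\<dots> = exp (ln C + exp (l / 4 * norm z powr (- k)))" using d0(2) by (simp add: exp_add)
            also have "\<dots> \<le> exp (e' * norm (P z))"
            proof -
              have "e' / 2 * exp (l / 2 * norm z powr (- k)) \<le> e' * norm (P z)"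
                using mult_left_mono[OF normP[OF elim(2)], of e'] e' by simp
              then show ?thesis using elim(1) by simp
            qed
            finally have "norm (g z) \<le> exp (e' * norm (P z))" .
            moreover have "norm (G z) \<le> norm (g z) * 1"
            proof -
              have "norm z powr (k + 1) \<le> 1" using zD by (intro n1) auto
              then have "norm z powr (k + 1) / M \<le> 1" using M by (simp add: divide_le_eq)
              then have "norm (g z) * (norm z powr (k + 1) / M) \<le> norm (g z) * 1" by (intro mult_left_mono) auto
              then show ?thesis using zD by (simp add: normG)
            qed
            ultimately show ?case by simp
          qed
        qed
        with lim show ?thesis by blast
      next
        case False
        then have re: "Re \<xi> > 0" using f by simp
        have "isCont (cpow (k + 1)) \<xi>" unfolding cpow_def[abs_def]
          using re by (intro continuous_intros) (auto simp: complex_nonpos_Reals_iff)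
        then have cG: "isCont G \<xi>" unfolding G_def using M isCont_slit[OF g in_slit[OF re f(3)]]
          by (intro continuous_intros) auto
        have "norm (g \<xi>) * norm \<xi> powr (k + 1) \<le> M"
        proof (cases "Re \<xi> = d")
          case True
          then have "norm (g \<xi>) \<le> M" using f by (intro M) (simp add: Seg)
          then have "norm (g \<xi>) * norm \<xi> powr (k + 1) \<le> M * 1" using M n1[OF re f(3,4)] by (intro mult_mono) auto
          then show ?thesis by simp
        next
          case nd: False
          have eq: "\<bar>Im \<xi>\<bar> = \<omega> (Re \<xi>)" using f nd re by (auto simp: D_def)
          then have "\<bar>Im \<xi>\<bar> > 0" using \<omega>[OF re] re by simp
          then have "Im \<xi> \<noteq> 0" by auto
          then have "norm (g \<xi>) * norm \<xi> powr (k + 1) \<le> 24"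
          proof (cases "Im \<xi> > 0")
            case True
            then show ?thesis using edge_up[of \<xi>] eq f gF[of \<xi>] re by simp
          next
            case False
            then have "Im (cnj \<xi>) > 0" using \<open>Im \<xi> \<noteq> 0\<close> by simp
            then show ?thesis using edge_up[of "cnj \<xi>"] eq f gF[of "cnj \<xi>"] sym[of \<xi>] re by simp
          qed
          then show ?thesis using M by linarith
        qed
        then have "norm (G \<xi>) \<le> 1" using normG[OF re] M by simp
        then show ?thesis using cG eventually_norm_le_of_isCont by blast
      qed
    qed
    then show ?thesis using M normG[of z] z by (simp add: D_def)
  qed
  define d3 where "d3 = min (min d 1) (e / M)"
  have d3: "d3 > 0" "d3 \<le> d" "d3 \<le> 1" "d3 \<le> e / M" using d e M by (auto simp: d3_def)
  have "\<bar>Re (F z)\<bar> \<le> e / (norm z)\<^sup>2" if z: "0 < Re z" "0 < Im z" "norm z < d3" for z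
  proof -
    have n: "norm z > 0" using z by auto
    have n2: "(norm z)\<^sup>2 \<le> norm z" using z d3 n by (simp add: power2_eq_square mult_le_cancel_left1)
    have "\<bar>Re (F z)\<bar> \<le> M"
    proof (cases "Re z \<le> Im z powr \<gamma>")
      case True
      then have "\<bar>Re (F z)\<bar> \<le> 1" using z d d3 by (intro d1) auto
      then show ?thesis using M by linarith
    next
      case False
      \<comment> \<open>Off the approach region the height is at most
        \<open>Re z powr (k + 1)\<close>, which cancels the bound for the derivative in the
        integration.\<close>
      have yx: "Im z \<le> Re z powr (k + 1)"
      proof -
        have "Im z = (Im z powr \<gamma>) powr (k + 1)" using k z by (simp add: powr_powr)
        also have "\<dots> \<le> Re z powr (k + 1)" using False k by (intro powr_mono2) auto
        finally show ?thesis .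
      qed
      have x0: "Re z powr (k + 1) > 0" using z by simp
      have xlt: "Re z powr (k + 1) < \<omega> (Re z)" using z k \<omega>[OF z(1)] by (simp add: powr_less_mono2)
      have "\<bar>Re (F (Complex (Re z) (Im z)))\<bar> \<le> M / Re z powr (k + 1) * Im z"
      proof (rule Re_le_vertical[OF F])
        show "boundary_zero (\<lambda>z. Re (F z)) (Re z)"
          using z d3 d complex_Re_le_cmod[of z] by (intro zero) auto
        show "Im z > 0" by fact
        fix t assume t: "0 < t" "t \<le> Im z"
        let ?w = "Complex (Re z) t"
        have "Re z < d" using z d3 complex_Re_le_cmod[of z] by linarith
        moreover have "\<bar>t\<bar> < \<omega> (Re z)" using t yx xlt by linarith
        ultimately have "?w \<in> D" using z by (simp add: D_def)
        then have "norm (g ?w) * norm ?w powr (k + 1) \<le> M" by (rule bound)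
        moreover have "norm (g ?w) * Re z powr (k + 1) \<le> norm (g ?w) * norm ?w powr (k + 1)"
          using z k complex_Re_le_cmod[of ?w] by (intro mult_left_mono powr_mono2) auto
        ultimately have "norm (g ?w) * Re z powr (k + 1) \<le> M" by linarith
        then show "norm (deriv F ?w) \<le> M / Re z powr (k + 1)" using gF[of ?w] t x0 by (simp add: pos_le_divide_eq)
      qed
      also have "\<dots> \<le> M / Re z powr (k + 1) * Re z powr (k + 1)"
        using yx M by (intro mult_left_mono) auto
      also have "\<dots> = M" using x0 by simp
      finally show ?thesis by simp
    qed
    then have "\<bar>Re (F z)\<bar> * (norm z)\<^sup>2 \<le> M * (e / M)"
      using n2 z d3 M by (intro mult_mono) auto
    then show ?thesis using n M by (simp add: pos_le_divide_eq)
  qed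
  then show ?thesis using d3(1) by blast
qed

subsection \<open>Charts at boundary points\<close>

text \<open>\<open>(norm (\<i> - z))\<^sup>2\<close> is
  \<open>(norm (\<i> + z))\<^sup>2 - 4 * Im z\<close>. The second estimate turns growth in the
  distance to the circle into growth in the height, at the cost of a factor 2.\<close>

lemma half_plane_to_disc_norm:
  assumes "Im z > 0"
  shows "norm (half_plane_to_disc \<phi> z) < 1"
    and "norm z \<le> 1 \<Longrightarrow> norm (half_plane_to_disc \<phi> z) \<le> 1 - Im z / 2"
proof -
  have ne: "norm (\<i> + z) > 0" using assms by (auto simp: complex_eq_iff)
  have n: "norm (half_plane_to_disc \<phi> z) = norm (\<i> - z) / norm (\<i> + z)"
    by (simp add: half_plane_to_disc_def norm_mult norm_divide)
  have sq: "(norm (\<i> - z))\<^sup>2 = (norm (\<i> + z))\<^sup>2 - 4 * Im z"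
    unfolding cmod_power2 by (simp add: power2_eq_square algebra_simps)
  then have "(norm (\<i> - z))\<^sup>2 < (norm (\<i> + z))\<^sup>2" using assms by simp
  then have "norm (\<i> - z) < norm (\<i> + z)" by (rule power2_less_imp_less) simp
  then show "norm (half_plane_to_disc \<phi> z) < 1" using ne by (simp add: n)
  assume z: "norm z \<le> 1"
  have "norm (\<i> + z) \<le> 2" using norm_triangle_ineq[of \<i> z] z by simp
  then have "(norm (\<i> + z))\<^sup>2 \<le> 2\<^sup>2" by (rule power_mono) simp
  then have b: "(norm (\<i> + z))\<^sup>2 \<le> 4" by simp
  have y1: "Im z \<le> 1" using abs_Im_le_cmod[of z] z by linarith
  have "(norm (half_plane_to_disc \<phi> z))\<^sup>2 = 1 - 4 * Im z / (norm (\<i> + z))\<^sup>2"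
    unfolding n power_divide sq using ne by (simp add: diff_divide_distrib)
  also have "\<dots> \<le> 1 - Im z"
  proof -
    have "Im z * (norm (\<i> + z))\<^sup>2 \<le> Im z * 4" using b assms by (intro mult_left_mono) auto
    then have "Im z \<le> 4 * Im z / (norm (\<i> + z))\<^sup>2" using ne by (simp add: pos_le_divide_eq mult.commute)
    then show ?thesis by simp
  qed
  also have "\<dots> \<le> (1 - Im z / 2)\<^sup>2" by (simp add: power2_eq_square algebra_simps)
  finally show "norm (half_plane_to_disc \<phi> z) \<le> 1 - Im z / 2"
    by (rule power2_le_imp_le) (use y1 in simp)
qed

lemma half_plane_to_disc_holomorphic: "half_plane_to_disc \<phi> holomorphic_on upper"
  unfolding half_plane_to_disc_def[abs_def] by (intro holomorphic_intros) (auto simp: complex_eq_iff)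

lemma isCont_half_plane_to_disc: "Im z \<ge> 0 \<Longrightarrow> isCont (half_plane_to_disc \<phi>) z"
  unfolding half_plane_to_disc_def[abs_def] by (intro continuous_intros) (auto simp: complex_eq_iff)

lemma half_plane_to_disc_0: "half_plane_to_disc \<phi> 0 = cis \<phi>"
  by (simp add: half_plane_to_disc_def)

lemma chart_holomorphic:
  assumes "f holomorphic_on ball 0 1"
  shows "(\<lambda>z. f (half_plane_to_disc \<phi> z)) holomorphic_on upper"
proof -
  have "(f \<circ> half_plane_to_disc \<phi>) holomorphic_on upper"
    by (rule holomorphic_on_compose_gen[OF half_plane_to_disc_holomorphic assms])
      (use half_plane_to_disc_norm(1) in auto)
  then show ?thesis by (simp add: o_def)
qed

lemma norm_exp_ii: "norm (exp (\<i> * z)) = exp (- Im z)"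
  by (simp add: norm_exp_eq_Re)

lemma strip_holomorphic:
  assumes "f holomorphic_on ball 0 1"
  shows "(\<lambda>z. f (exp (\<i> * z))) holomorphic_on upper"
proof -
  have "(f \<circ> (\<lambda>z. exp (\<i> * z))) holomorphic_on upper"
    by (rule holomorphic_on_compose_gen[OF _ assms]) (auto intro!: holomorphic_intros simp: norm_exp_ii)
  then show ?thesis by (simp add: o_def)
qed

lemma boundary_zero_imp_disc_limit:
  assumes "boundary_zero (\<lambda>z. Re (f (exp (\<i> * z)))) s"
  shows "((\<lambda>z. Re (f z)) \<longlongrightarrow> 0) (at (cis s) within ball 0 1)"
proof -
  \<comment> \<open>The local inverse of \<open>exp (\<i> * z)\<close> at \<open>s\<close>; the
    quotient by \<open>cis s\<close> is close to 1, away from the cut of \<open>Ln\<close>.\<close>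
  define L where "L z = of_real s - \<i> * Ln (z / cis s)" for z
  have ev: "\<forall>\<^sub>F z in at (cis s) within ball 0 1. z \<in> ball 0 1 \<and> z \<noteq> 0"
  proof -
    have "((\<lambda>z. norm z) \<longlongrightarrow> norm (cis s)) (at (cis s) within ball 0 1)" by (intro tendsto_intros)
    then have "\<forall>\<^sub>F z in at (cis s) within ball 0 1. norm z > 0" by (rule order_tendstoD(1)) simp
    moreover have "\<forall>\<^sub>F z in at (cis s) within ball 0 1. z \<in> ball 0 1" by (simp add: eventually_at_filter)
    ultimately show ?thesis by eventually_elim auto
  qed
  have up: "Im (L z) > 0" if "z \<in> ball 0 1" "z \<noteq> 0" for z
    using that by (simp add: L_def norm_divide)
  have "filterlim L (at (of_real s) within upper) (at (cis s) within ball 0 1)"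
    unfolding filterlim_at
  proof
    have "(L \<longlongrightarrow> of_real s - \<i> * Ln (cis s / cis s)) (at (cis s) within ball 0 1)"
      unfolding L_def by (intro tendsto_intros) auto
    then show "(L \<longlongrightarrow> of_real s) (at (cis s) within ball 0 1)" by simp
    show "\<forall>\<^sub>F z in at (cis s) within ball 0 1. L z \<in> upper \<and> L z \<noteq> of_real s"
      using ev
    proof eventually_elim
      case (elim z)
      then show ?case using up[of z] by (auto simp: complex_eq_iff)
    qed
  qed
  from filterlim_compose[OF assms this]
  have "((\<lambda>z. Re (f (exp (\<i> * L z)))) \<longlongrightarrow> 0) (at (cis s) within ball 0 1)" .
  moreover have "\<forall>\<^sub>F z in at (cis s) within ball 0 1. Re (f (exp (\<i> * L z))) = Re (f z)"
    using ev
  proof eventually_elim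
    case (elim z)
    have "\<i> * L z = \<i> * of_real s + Ln (z / cis s)" by (simp add: L_def algebra_simps)
    then have "exp (\<i> * L z) = cis s * (z / cis s)"
      using elim by (simp add: exp_add cis_conv_exp)
    then show ?case by simp
  qed
  ultimately show ?thesis by (rule Lim_transform_eventually)
qed

text \<open>\<open>(\<i> - t) / (\<i> + t)\<close> is \<open>exp (2 * \<i> * Arctan t)\<close>.
  Positive \<open>t\<close> turns counterclockwise, so the right side of a boundary point
  corresponds to the first quadrant of its chart.\<close>

lemma half_plane_to_disc_of_real:
  assumes "\<bar>t\<bar> < 1"
  shows "half_plane_to_disc \<phi> (of_real t) = cis (\<phi> + 2 * arctan t)"
proof -
  let ?t = "of_real t :: complex"
  have ne: "1 - \<i> * ?t \<noteq> 0" "1 + \<i> * ?t \<noteq> 0" "\<i> + ?t \<noteq> 0" by (auto simp: complex_eq_iff)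
  have "2 * \<i> * Arctan ?t = - Ln ((1 - \<i> * ?t) / (1 + \<i> * ?t))"
    by (simp add: Arctan_def)
  then have "exp (2 * \<i> * Arctan ?t) = inverse ((1 - \<i> * ?t) / (1 + \<i> * ?t))"
    using ne by (simp add: exp_minus)
  also have "\<dots> = (\<i> - ?t) / (\<i> + ?t)" using ne by (simp add: field_simps)
  also have "Arctan ?t = of_real (arctan t)" by (rule Arctan_of_real)
  finally have "cis (2 * arctan t) = (\<i> - ?t) / (\<i> + ?t)" by (simp add: cis_conv_exp mult_ac)
  then show ?thesis by (simp add: half_plane_to_disc_def cis_mult[symmetric])
qed

lemma chart_boundary_zero:
  assumes zero: "\<And>s. a < s \<Longrightarrow> s < b \<Longrightarrow> boundary_zero (\<lambda>z. Re (f (exp (\<i> * z)))) s"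
    and t: "0 < t" "t < 1" "2 * t < b - a"
  shows "boundary_zero (\<lambda>z. Re (f (half_plane_to_disc a z))) t"
proof -
  define s where "s = a + 2 * arctan t"
  have "0 < arctan t" "arctan t \<le> t" using t by (auto intro: arctan_le_self)
  then have s: "a < s" "s < b" using t by (auto simp: s_def)
  have eq: "half_plane_to_disc a (of_real t) = cis s"
    unfolding s_def using t by (intro half_plane_to_disc_of_real) simp
  have "filterlim (half_plane_to_disc a) (at (cis s) within ball 0 1) (at (of_real t) within upper)"
    unfolding filterlim_at
  proof
    have "isCont (half_plane_to_disc a) (of_real t)" by (rule isCont_half_plane_to_disc) simp
    then show "(half_plane_to_disc a \<longlongrightarrow> cis s) (at (of_real t) within upper)"
      unfolding isCont_def eq by (rule tendsto_within_subset) simp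
    have "\<forall>\<^sub>F z in at (of_real t) within upper. z \<in> upper" by (simp add: eventually_at_filter)
    then show "\<forall>\<^sub>F z in at (of_real t) within upper. half_plane_to_disc a z \<in> ball 0 1 \<and> half_plane_to_disc a z \<noteq> cis s"
    proof eventually_elim
      case (elim z)
      then have "norm (half_plane_to_disc a z) < 1" by (intro half_plane_to_disc_norm) simp
      moreover have "norm (cis s) = 1" by simp
      ultimately show ?case by auto
    qed
  qed
  from filterlim_compose[OF boundary_zero_imp_disc_limit[OF zero[OF s]] this] show ?thesis .
qed

text \<open>The inverse of the chart at \<open>a\<close>, in the coordinate \<open>\<zeta>\<close> with \<open>exp (\<i> * \<zeta>)\<close> in the disc.\<close>

definition chart_coordinate :: "complex \<Rightarrow> complex" where
  "chart_coordinate \<tau> = \<i> * (1 - exp (\<i> * \<tau>)) / (1 + exp (\<i> * \<tau>))"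

lemma exp_ne_minus_one: "Im \<tau> > 0 \<Longrightarrow> 1 + exp (\<i> * \<tau>) \<noteq> 0"
proof
  assume "Im \<tau> > 0" "1 + exp (\<i> * \<tau>) = 0"
  then have "exp (\<i> * \<tau>) = - 1" by (simp add: add_eq_0_iff)
  then have "norm (exp (\<i> * \<tau>)) = 1" by simp
  then show False using \<open>Im \<tau> > 0\<close> by (simp add: norm_exp_ii)
qed

lemma half_plane_to_disc_chart_coordinate:
  assumes "Im \<zeta> > 0"
  shows "half_plane_to_disc a (chart_coordinate (\<zeta> - of_real a)) = exp (\<i> * \<zeta>)"
proof -
  define q where "q = exp (\<i> * (\<zeta> - of_real a))"
  have ne: "1 + q \<noteq> 0" unfolding q_def by (rule exp_ne_minus_one) (use assms in simp)
  have Z: "chart_coordinate (\<zeta> - of_real a) = \<i> * (1 - q) / (1 + q)" by (simp add: chart_coordinate_def q_def)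
  have "\<i> - \<i> * (1 - q) / (1 + q) = 2 * \<i> * q / (1 + q)" "\<i> + \<i> * (1 - q) / (1 + q) = 2 * \<i> / (1 + q)"
    using ne by (simp_all add: field_simps)
  then have "(\<i> - chart_coordinate (\<zeta> - of_real a)) / (\<i> + chart_coordinate (\<zeta> - of_real a)) = q"
    unfolding Z using ne by simp
  then have "half_plane_to_disc a (chart_coordinate (\<zeta> - of_real a)) = cis a * q"
    by (simp add: half_plane_to_disc_def)
  also have "\<dots> = exp (\<i> * \<zeta>)" by (simp add: q_def cis_conv_exp algebra_simps flip: exp_add)
  finally show ?thesis .
qed

text \<open>Over the denominator \<open>(norm (1 + q))\<^sup>2\<close> the numerators are
  \<open>1 - (norm q)\<^sup>2\<close> and \<open>2 * Im q\<close>. Right corners thus correspond to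
  first quadrants in both coordinates.\<close>

lemma chart_coordinate_quadrant:
  assumes "0 < Im \<tau>"
  shows "0 < Im (chart_coordinate \<tau>)" and "0 < Re \<tau> \<Longrightarrow> Re \<tau> < pi \<Longrightarrow> 0 < Re (chart_coordinate \<tau>)"
proof -
  define q where "q = exp (\<i> * \<tau>)"
  have ne: "1 + q \<noteq> 0" unfolding q_def using assms by (rule exp_ne_minus_one)
  have nq: "norm q < 1" using assms by (simp add: q_def norm_exp_ii)
  have eq: "chart_coordinate \<tau> = \<i> * (1 - q) * cnj (1 + q) / of_real ((norm (1 + q))\<^sup>2)"
    unfolding chart_coordinate_def q_def[symmetric] by (subst complex_div_cnj) simp
  have pos: "(norm (1 + q))\<^sup>2 > 0" using ne by simp
  have "Im (\<i> * (1 - q) * cnj (1 + q)) = 1 - (norm q)\<^sup>2"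
    unfolding cmod_power2 by (simp add: power2_eq_square algebra_simps)
  then have "Im (chart_coordinate \<tau>) = (1 - (norm q)\<^sup>2) / (norm (1 + q))\<^sup>2"
    using eq by (simp only: Im_divide_of_real)
  moreover have "(norm q)\<^sup>2 < 1" using nq by (simp add: power_less_one_iff abs_square_less_1)
  ultimately show "0 < Im (chart_coordinate \<tau>)" using pos by simp
  assume r: "0 < Re \<tau>" "Re \<tau> < pi"
  have "Re (\<i> * (1 - q) * cnj (1 + q)) = 2 * Im q" by (simp add: algebra_simps)
  then have "Re (chart_coordinate \<tau>) = 2 * Im q / (norm (1 + q))\<^sup>2"
    using eq by (simp only: Re_divide_of_real)
  moreover have "Im q > 0" using r by (simp add: q_def Im_exp sin_gt_zero)
  ultimately show "0 < Re (chart_coordinate \<tau>)" using pos by simp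
qed

lemma chart_coordinate_near_0:
  "\<forall>\<^sub>F \<tau> in at 0. norm \<tau> / 4 \<le> norm (chart_coordinate \<tau>)"
  "(chart_coordinate \<longlongrightarrow> 0) (at 0)"
proof -
  have der: "(chart_coordinate has_field_derivative 1 / 2) (at 0)"
    unfolding chart_coordinate_def[abs_def] by (auto intro!: derivative_eq_intros)
  have Z0: "chart_coordinate 0 = 0" by (simp add: chart_coordinate_def)
  show "(chart_coordinate \<longlongrightarrow> 0) (at 0)"
    using DERIV_isCont[OF der] by (simp add: isCont_def Z0)
  have "((\<lambda>\<tau>. chart_coordinate \<tau> / \<tau>) \<longlongrightarrow> 1 / 2) (at 0)"
    using der by (simp add: has_field_derivative_iff Z0)
  then have "((\<lambda>\<tau>. norm (chart_coordinate \<tau> / \<tau>)) \<longlongrightarrow> norm (1 / 2 :: complex)) (at 0)"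
    by (rule tendsto_norm)
  then have "\<forall>\<^sub>F \<tau> in at 0. 1 / 4 < norm (chart_coordinate \<tau> / \<tau>)"
    by (rule order_tendstoD(1)) (simp add: norm_divide)
  moreover have "\<forall>\<^sub>F \<tau> in at 0. (\<tau> :: complex) \<noteq> 0" by (simp add: eventually_at_filter)
  ultimately show "\<forall>\<^sub>F \<tau> in at 0. norm \<tau> / 4 \<le> norm (chart_coordinate \<tau>)"
    by eventually_elim (simp add: norm_divide field_simps)
qed

lemma right_corner_of_chart:
  assumes "\<And>e. e > 0 \<Longrightarrow> \<exists>d>0. \<forall>z. 0 < Re z \<and> 0 < Im z \<and> norm z < d \<longrightarrow>
    U (half_plane_to_disc a z) \<le> e / (norm z)\<^sup>2"
  shows "right_corner (\<lambda>z. U (exp (\<i> * z))) a"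
  unfolding right_corner_def
proof (intro allI impI)
  fix e :: real assume e: "e > 0"
  let ?S = "{z. a < Re z \<and> 0 < Im z}"
  \<comment> \<open>The chart coordinate has derivative \<open>1 / 2\<close> at 0, so near 0 it
    shrinks distances at most by a factor 4, and 16 is its square.\<close>
  have "e / 16 > 0" using e by simp
  then obtain d where d: "d > 0" "\<And>z. 0 < Re z \<Longrightarrow> 0 < Im z \<Longrightarrow> norm z < d \<Longrightarrow> U (half_plane_to_disc a z) \<le> (e / 16) / (norm z)\<^sup>2"
    using assms by blast
  have sh: "filterlim (\<lambda>z. z - of_real a) (at 0) (at (of_real a) within ?S)"
    unfolding filterlim_at
  proof
    have "((\<lambda>z. z - of_real a) \<longlongrightarrow> of_real a - of_real a) (at (of_real a) within ?S)" by (intro tendsto_intros)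
    then show "((\<lambda>z. z - of_real a) \<longlongrightarrow> 0) (at (of_real a) within ?S)" by simp
    show "\<forall>\<^sub>F z in at (of_real a) within ?S. z - of_real a \<in> UNIV \<and> z - of_real a \<noteq> 0"
      by (simp add: eventually_at_filter)
  qed
  have ev1: "\<forall>\<^sub>F z in at (of_real a) within ?S. norm (z - of_real a) / 4 \<le> norm (chart_coordinate (z - of_real a))"
    using chart_coordinate_near_0(1) sh by (rule eventually_compose_filterlim)
  have "\<forall>\<^sub>F \<tau> in at 0. norm (chart_coordinate \<tau>) < d"
    using tendstoD[OF chart_coordinate_near_0(2) d(1)] by (simp add: dist_norm)
  then have ev2: "\<forall>\<^sub>F z in at (of_real a) within ?S. norm (chart_coordinate (z - of_real a)) < d"
    using sh by (rule eventually_compose_filterlim)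
  have "((\<lambda>z. Re z) \<longlongrightarrow> Re (of_real a)) (at (of_real a) within ?S)" by (intro tendsto_intros)
  then have ev3: "\<forall>\<^sub>F z in at (of_real a) within ?S. Re z < a + pi" by (rule order_tendstoD(2)) simp
  have "\<forall>\<^sub>F z in at (of_real a) within ?S. z \<in> ?S" by (simp add: eventually_at_filter)
  with ev1 ev2 ev3 show "\<forall>\<^sub>F z in at (of_real a) within ?S. U (exp (\<i> * z)) \<le> e / (norm (z - of_real a))\<^sup>2"
  proof eventually_elim
    case (elim z)
    define w where "w = chart_coordinate (z - of_real a)"
    have w: "0 < Re w" "0 < Im w" "norm w < d"
      unfolding w_def using elim by (auto intro!: chart_coordinate_quadrant)
    have "half_plane_to_disc a w = exp (\<i> * z)"
      unfolding w_def using elim by (intro half_plane_to_disc_chart_coordinate) simp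
    then have "U (exp (\<i> * z)) \<le> (e / 16) / (norm w)\<^sup>2" using d(2)[OF w] by simp
    also have "\<dots> \<le> (e / 16) / (norm (z - of_real a) / 4)\<^sup>2"
    proof (intro divide_left_mono)
      show "(norm (z - of_real a) / 4)\<^sup>2 \<le> (norm w)\<^sup>2" using elim unfolding w_def by (intro power_mono) auto
      have "z - of_real a \<noteq> 0" using elim by (auto simp: complex_eq_iff)
      moreover have "w \<noteq> 0" using w by auto
      ultimately show "0 < (norm w)\<^sup>2 * (norm (z - of_real a) / 4)\<^sup>2" by simp
    qed (use e in simp)
    also have "\<dots> = e / (norm (z - of_real a))\<^sup>2" by (simp add: power_divide)
    finally show ?case .
  qed
qed

definition disc_zero_limits :: "(real \<Rightarrow> real) \<Rightarrow> (complex \<Rightarrow> complex) \<Rightarrow> bool" where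
  "disc_zero_limits h f \<longleftrightarrow>
    (\<forall>\<phi>. ((\<lambda>z. Re (f z)) \<longlongrightarrow> 0) (at (cis \<phi>) within disc_approach_region h \<phi>))"

lemma disc_approach_region_subset: "disc_approach_region h \<phi> \<subseteq> ball 0 1"
  using half_plane_to_disc_norm(1) by (auto simp: disc_approach_region_def approach_region_def)

lemma disc_zero_limitsI:
  assumes z: "zero_limits_along h u" and f: "\<And>z. z \<in> ball 0 1 \<Longrightarrow> u z = Re (f z)"
  shows "disc_zero_limits h f"
  unfolding disc_zero_limits_def
proof
  fix \<phi> :: real
  define k where "k = \<lfloor>\<phi> / (2 * pi)\<rfloor>"
  define \<psi> where "\<psi> = \<phi> - 2 * pi * real_of_int k"
  have "real_of_int k \<le> \<phi> / (2 * pi)" "\<phi> / (2 * pi) < real_of_int k + 1" by (auto simp: k_def)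
  then have "2 * pi * real_of_int k \<le> \<phi>" "\<phi> < 2 * pi * real_of_int k + 2 * pi"
    by (simp_all add: field_simps)
  then have \<psi>: "\<psi> \<in> {0..2 * pi}" by (auto simp: \<psi>_def)
  have cis: "cis \<psi> = cis \<phi>"
    unfolding \<psi>_def by (simp add: cis_divide[symmetric] cis_multiple_2pi)
  have reg: "disc_approach_region h \<psi> = disc_approach_region h \<phi>"
    by (simp add: disc_approach_region_def half_plane_to_disc_def cis)
  have "(u \<longlongrightarrow> 0) (at (cis \<phi>) within disc_approach_region h \<phi>)"
    using z \<psi> unfolding zero_limits_along_def by (metis cis reg)
  moreover have "\<forall>\<^sub>F z in at (cis \<phi>) within disc_approach_region h \<phi>. u z = Re (f z)"
  proof -
    have "\<forall>\<^sub>F z in at (cis \<phi>) within disc_approach_region h \<phi>. z \<in> disc_approach_region h \<phi>"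
      by (simp add: eventually_at_filter)
    then show ?thesis by eventually_elim (rule f[OF subsetD[OF disc_approach_region_subset]])
  qed
  ultimately show "((\<lambda>z. Re (f z)) \<longlongrightarrow> 0) (at (cis \<phi>) within disc_approach_region h \<phi>)"
    by (rule Lim_transform_eventually)
qed

lemma disc_zero_limits_chart:
  assumes H: "disc_zero_limits h f"
  shows "((\<lambda>z. Re (f (half_plane_to_disc \<phi> z))) \<longlongrightarrow> 0) (at 0 within approach_region h)"
proof -
  have "filterlim (half_plane_to_disc \<phi>) (at (cis \<phi>) within disc_approach_region h \<phi>) (at 0 within approach_region h)"
    unfolding filterlim_at
  proof
    have "isCont (half_plane_to_disc \<phi>) 0" by (rule isCont_half_plane_to_disc) simp
    then show "(half_plane_to_disc \<phi> \<longlongrightarrow> cis \<phi>) (at 0 within approach_region h)"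
      unfolding isCont_def half_plane_to_disc_0 by (rule tendsto_within_subset) simp
    have "\<forall>\<^sub>F z in at 0 within approach_region h. z \<in> approach_region h" by (simp add: eventually_at_filter)
    then show "\<forall>\<^sub>F z in at 0 within approach_region h.
      half_plane_to_disc \<phi> z \<in> disc_approach_region h \<phi> \<and> half_plane_to_disc \<phi> z \<noteq> cis \<phi>"
    proof eventually_elim
      case (elim z)
      have "norm (half_plane_to_disc \<phi> z) < 1"
        using elim by (intro half_plane_to_disc_norm) (simp add: approach_region_def)
      moreover have "norm (cis \<phi>) = 1" by simp
      ultimately show ?case using elim by (auto simp: disc_approach_region_def)
    qed
  qed
  from filterlim_compose[OF _ this] show ?thesis
    using H unfolding disc_zero_limits_def by blast
qed

lemma chart_approach_bound:
  assumes H: "disc_zero_limits h f" and e: "e > 0"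
  shows "\<exists>d>0. \<forall>z. 0 < Im z \<and> norm z < d \<and> \<bar>Re z\<bar> \<le> h (Im z) \<longrightarrow> \<bar>Re (f (half_plane_to_disc \<phi> z))\<bar> \<le> e"
proof -
  have "\<forall>\<^sub>F z in at 0 within approach_region h. dist (Re (f (half_plane_to_disc \<phi> z))) 0 < e"
    by (rule tendstoD[OF disc_zero_limits_chart[OF H] e])
  then obtain d where d: "d > 0" "\<And>z. z \<in> approach_region h \<Longrightarrow> z \<noteq> 0 \<Longrightarrow> norm z < d \<Longrightarrow> \<bar>Re (f (half_plane_to_disc \<phi> z))\<bar> < e"
    unfolding eventually_at by (auto simp: dist_real_def)
  have "\<bar>Re (f (half_plane_to_disc \<phi> z))\<bar> \<le> e" if z: "0 < Im z" "norm z < min d 1" "\<bar>Re z\<bar> \<le> h (Im z)" for z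
  proof -
    have "Im z < 1" using abs_Im_le_cmod[of z] z by linarith
    then have "z \<in> approach_region h" using z by (simp add: approach_region_def)
    moreover have "z \<noteq> 0" using z by auto
    ultimately show ?thesis using d(2)[of z] z by simp
  qed
  then show ?thesis using d(1) by (intro exI[of _ "min d 1"]) auto
qed

text \<open>The vertical line over \<open>x\<close> is the radius to \<open>cis x\<close>, which is
  the imaginary axis in the chart at \<open>x\<close>; \<open>s y\<close> is
  \<open>tanh (y / 2)\<close>. The axis lies in the region because \<open>h\<close> is
  nonnegative.\<close>

lemma disc_zero_limits_vertical:
  assumes H: "disc_zero_limits h f" and h: "\<And>t. 0 < t \<Longrightarrow> t < 1 \<Longrightarrow> 0 \<le> h t"
  shows "((\<lambda>y. Re (f (exp (\<i> * Complex x y)))) \<longlongrightarrow> 0) (at_right 0)"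
proof -
  define s where "s y = (1 - exp (- y)) / (1 + exp (- y))" for y :: real
  have s01: "0 < s y" "s y < 1" if "y > 0" for y
    using that by (auto simp: s_def divide_less_eq add_pos_pos)
  have ev: "\<forall>\<^sub>F y in at_right (0::real). y > 0" by (rule eventually_at_right_less)
  have "filterlim (\<lambda>y. \<i> * of_real (s y)) (at 0 within approach_region h) (at_right 0)"
    unfolding filterlim_at
  proof
    have "((\<lambda>y. \<i> * of_real (s y)) \<longlongrightarrow> \<i> * of_real ((1 - exp (- 0)) / (1 + exp (- 0)))) (at_right 0)"
      unfolding s_def by (intro tendsto_intros) auto
    then show "((\<lambda>y. \<i> * complex_of_real (s y)) \<longlongrightarrow> 0) (at_right 0)" by simp
    show "\<forall>\<^sub>F y in at_right 0. \<i> * complex_of_real (s y) \<in> approach_region h \<and> \<i> * complex_of_real (s y) \<noteq> 0"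
      using ev
    proof eventually_elim
      case (elim y)
      then show ?case using s01[OF elim] h[of "s y"] by (simp add: approach_region_def)
    qed
  qed
  from filterlim_compose[OF disc_zero_limits_chart[OF H, of x] this]
  have "((\<lambda>y. Re (f (half_plane_to_disc x (\<i> * of_real (s y))))) \<longlongrightarrow> 0) (at_right 0)" .
  moreover have "half_plane_to_disc x (\<i> * of_real (s y)) = exp (\<i> * Complex x y)" if "y > 0" for y
  proof -
    have ne: "1 + exp (- y) \<noteq> 0" using exp_gt_zero[of "- y"] by linarith
    then have r: "(1 - s y) / (1 + s y) = exp (- y)" by (simp add: s_def field_simps)
    have "(\<i> - \<i> * of_real (s y)) / (\<i> + \<i> * of_real (s y)) = (\<i> * of_real (1 - s y)) / (\<i> * of_real (1 + s y))"
      by (simp add: algebra_simps)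
    also have "\<dots> = of_real ((1 - s y) / (1 + s y))" by simp
    finally have "half_plane_to_disc x (\<i> * of_real (s y)) = cis x * of_real (exp (- y))"
      unfolding half_plane_to_disc_def r by simp
    also have "\<dots> = exp (\<i> * Complex x y)"
      by (simp add: exp_eq_polar mult.commute)
    finally show ?thesis .
  qed
  then have "\<forall>\<^sub>F y in at_right 0. Re (f (half_plane_to_disc x (\<i> * of_real (s y)))) = Re (f (exp (\<i> * Complex x y)))"
    using ev by (auto elim: eventually_mono)
  ultimately show ?thesis by (rule Lim_transform_eventually)
qed

lemma boundary_zero_imp_zero:
  assumes f: "f holomorphic_on ball 0 1" and z: "\<And>t. boundary_zero (\<lambda>z. Re (f (exp (\<i> * z)))) t"
    and w: "w \<in> ball 0 1"
  shows "Re (f w) = 0"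
proof -
  have lim: "((\<lambda>z. Re (f z)) \<longlongrightarrow> 0) (at \<xi> within ball 0 1)" if "\<xi> \<in> frontier (ball 0 1)" for \<xi>
  proof -
    have "norm \<xi> = 1" using that by (simp add: frontier_ball)
    then have "\<xi> = cis (Arg \<xi>)" using rcis_cmod_Arg[of \<xi>] by (simp add: rcis_def)
    then show ?thesis using boundary_zero_imp_disc_limit[OF z[of "Arg \<xi>"]] by simp
  qed
  have f': "(\<lambda>z. - f z) holomorphic_on ball 0 1" using f by (intro holomorphic_intros)
  have "Re (f w) \<le> 0"
  proof (rule Re_le_if_limsup_frontier_le[OF open_ball bounded_ball f _ w])
    fix \<xi> and e :: real assume \<xi>: "\<xi> \<in> frontier (ball (0::complex) 1)" and e: "e > 0"
    show "\<forall>\<^sub>F z in at \<xi> within ball 0 1. Re (f z) \<le> 0 + e"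
      using tendsto_imp_limsup_le[OF lim[OF \<xi>] order_refl e] by eventually_elim simp
  qed
  moreover have "Re (- f w) \<le> 0"
  proof (rule Re_le_if_limsup_frontier_le[OF open_ball bounded_ball f' _ w])
    fix \<xi> and e :: real assume \<xi>: "\<xi> \<in> frontier (ball (0::complex) 1)" and e: "e > 0"
    show "\<forall>\<^sub>F z in at \<xi> within ball 0 1. Re (- f z) \<le> 0 + e"
      using tendsto_imp_limsup_le[OF lim[OF \<xi>] order_refl e] by eventually_elim simp
  qed
  ultimately show ?thesis by simp
qed

text \<open>Reflection of the disc in the real axis, the counterpart of \<open>mirror\<close>. The
  approach regions are symmetric, so the assumptions carry over and only right corners need an
  estimate.\<close>

definition cnj_fun :: "(complex \<Rightarrow> complex) \<Rightarrow> complex \<Rightarrow> complex" where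
  "cnj_fun f z = cnj (f (cnj z))"

lemma cnj_fun_holomorphic:
  assumes "f holomorphic_on ball 0 1"
  shows "cnj_fun f holomorphic_on ball 0 1"
proof -
  have "(cnj \<circ> f \<circ> cnj) field_differentiable at z" if "z \<in> ball 0 1" for z
  proof (rule field_differentiable_cnj_cnj)
    show "f field_differentiable at (cnj z)"
      by (rule holomorphic_on_imp_differentiable_at[OF assms open_ball]) (use that in simp)
  qed
  then have "(cnj \<circ> f \<circ> cnj) holomorphic_on ball 0 1"
    by (auto simp: holomorphic_on_def field_differentiable_at_within)
  moreover have "cnj \<circ> f \<circ> cnj = cnj_fun f" by (auto simp: cnj_fun_def)
  ultimately show ?thesis by simp
qed

lemma disc_zero_limits_cnj_fun:
  assumes "disc_zero_limits h f"
  shows "disc_zero_limits h (cnj_fun f)"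
  unfolding disc_zero_limits_def
proof
  fix \<phi>
  have cnj_map: "cnj (half_plane_to_disc \<phi> z) = half_plane_to_disc (- \<phi>) (- cnj z)" if "Im z > 0" for z
  proof -
    have "cnj ((\<i> - z) / (\<i> + z)) = (- (\<i> + cnj z)) / (- (\<i> - cnj z))" by simp
    also have "\<dots> = (\<i> - - cnj z) / (\<i> + - cnj z)" by (simp only: minus_divide_divide) simp
    finally show ?thesis unfolding half_plane_to_disc_def complex_cnj_mult cis_cnj by (rule arg_cong)
  qed
  have reg: "cnj w \<in> disc_approach_region h (- \<phi>)" if w: "w \<in> disc_approach_region h \<phi>" for w
  proof -
    obtain z where z: "z \<in> approach_region h" "w = half_plane_to_disc \<phi> z"
      using w by (auto simp: disc_approach_region_def)
    then have "cnj w = half_plane_to_disc (- \<phi>) (- cnj z)" using cnj_map by (simp add: approach_region_def)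
    moreover have "- cnj z \<in> approach_region h" using z by (simp add: approach_region_def)
    ultimately show ?thesis by (auto simp: disc_approach_region_def)
  qed
  have "filterlim cnj (at (cis (- \<phi>)) within disc_approach_region h (- \<phi>)) (at (cis \<phi>) within disc_approach_region h \<phi>)"
    unfolding filterlim_at
  proof
    have "(cnj \<longlongrightarrow> cnj (cis \<phi>)) (at (cis \<phi>) within disc_approach_region h \<phi>)" by (intro tendsto_intros)
    then show "(cnj \<longlongrightarrow> cis (- \<phi>)) (at (cis \<phi>) within disc_approach_region h \<phi>)" by (simp add: cis_cnj)
    show "\<forall>\<^sub>F z in at (cis \<phi>) within disc_approach_region h \<phi>. cnj z \<in> disc_approach_region h (- \<phi>) \<and> cnj z \<noteq> cis (- \<phi>)"
      unfolding eventually_at_filter using reg by (intro always_eventually) (auto simp flip: cis_cnj)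
  qed
  moreover have "((\<lambda>z. Re (f z)) \<longlongrightarrow> 0) (at (cis (- \<phi>)) within disc_approach_region h (- \<phi>))"
    using assms unfolding disc_zero_limits_def by blast
  ultimately have "((\<lambda>z. Re (f (cnj z))) \<longlongrightarrow> 0) (at (cis \<phi>) within disc_approach_region h \<phi>)"
    by (rule filterlim_compose[rotated])
  then show "((\<lambda>z. Re (cnj_fun f z)) \<longlongrightarrow> 0) (at (cis \<phi>) within disc_approach_region h \<phi>)"
    by (simp add: cnj_fun_def)
qed

text \<open>The local conclusion shared by the cases (b) to (d), in the chart at \<open>a\<close>.
  Left corners of \<open>f\<close> are right corners of \<open>cnj_fun f\<close>.\<close>

definition corner_decay :: "(complex \<Rightarrow> complex) \<Rightarrow> bool" where
  "corner_decay f \<longleftrightarrow> (\<forall>a b. a < b \<longrightarrow>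
    (\<forall>t. a < t \<and> t < b \<longrightarrow> boundary_zero (\<lambda>z. Re (f (exp (\<i> * z)))) t) \<longrightarrow>
    (\<forall>e>0. \<exists>d>0. \<forall>z. 0 < Re z \<and> 0 < Im z \<and> norm z < d \<longrightarrow>
      \<bar>Re (f (half_plane_to_disc a z))\<bar> \<le> e / (norm z)\<^sup>2))"

lemma right_corner_of_corner_decay:
  assumes c: "corner_decay f" and ab: "a < b"
    and z: "\<And>t. a < t \<Longrightarrow> t < b \<Longrightarrow> boundary_zero (\<lambda>z. Re (f (exp (\<i> * z)))) t"
  shows "right_corner (\<lambda>z. Re (f (exp (\<i> * z)))) a" "right_corner (\<lambda>z. Re (- f (exp (\<i> * z)))) a"
proof -
  have b: "\<exists>d>0. \<forall>z. 0 < Re z \<and> 0 < Im z \<and> norm z < d \<longrightarrow> \<bar>Re (f (half_plane_to_disc a z))\<bar> \<le> e / (norm z)\<^sup>2"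
    if "e > 0" for e
    using c ab z that unfolding corner_decay_def by blast
  show "right_corner (\<lambda>z. Re (f (exp (\<i> * z)))) a"
  proof (rule right_corner_of_chart[where U = "\<lambda>z. Re (f z)"])
    fix e :: real assume "e > 0"
    from b[OF this] show "\<exists>d>0. \<forall>z. 0 < Re z \<and> 0 < Im z \<and> norm z < d \<longrightarrow> Re (f (half_plane_to_disc a z)) \<le> e / (norm z)\<^sup>2"
      by (meson abs_le_D1)
  qed
  show "right_corner (\<lambda>z. Re (- f (exp (\<i> * z)))) a"
  proof (rule right_corner_of_chart[where U = "\<lambda>z. Re (- f z)"])
    fix e :: real assume "e > 0"
    from b[OF this] show "\<exists>d>0. \<forall>z. 0 < Re z \<and> 0 < Im z \<and> norm z < d \<longrightarrow> Re (- f (half_plane_to_disc a z)) \<le> e / (norm z)\<^sup>2"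
      by (metis abs_le_D2 uminus_complex.simps(1))
  qed
qed

theorem zero_of_corner_decay:
  assumes f: "f holomorphic_on ball 0 1" and H: "disc_zero_limits h f" and h: "\<And>t. 0 < t \<Longrightarrow> t < 1 \<Longrightarrow> 0 \<le> h t"
    and c: "corner_decay f" "corner_decay (cnj_fun f)" and w: "w \<in> ball 0 1"
  shows "Re (f w) = 0"
proof (rule boundary_zero_imp_zero[OF f _ w])
  fix t
  let ?E = "\<lambda>z. f (exp (\<i> * z))"
  \<comment> \<open>In the lifted coordinate, conjugation in the disc is reflection in the imaginary
    axis.\<close>
  have mir: "f (exp (\<i> * - cnj z)) = cnj (cnj_fun f (exp (\<i> * z)))" for z
    by (simp add: cnj_fun_def exp_cnj)
  show "boundary_zero (\<lambda>z. Re (f (exp (\<i> * z)))) t"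
  proof (rule vanishing_everywhere_two_sided)
    show "?E holomorphic_on upper" using f by (rule strip_holomorphic)
    show "((\<lambda>y. Re (?E (Complex x y))) \<longlongrightarrow> 0) (at_right 0)" for x
      by (rule disc_zero_limits_vertical[OF H h])
    fix a b :: real assume ab: "a < b" and z: "\<And>t. a < t \<Longrightarrow> t < b \<Longrightarrow> boundary_zero (\<lambda>z. Re (?E z)) t"
    have z': "boundary_zero (\<lambda>z. Re (cnj_fun f (exp (\<i> * z)))) t" if "- b < t" "t < - a" for t
    proof -
      have "filterlim (\<lambda>z. - cnj z) (at (- cnj (of_real t)) within upper) (at (of_real t) within upper)"
        by (rule filterlim_mirror) auto
      moreover have "boundary_zero (\<lambda>z. Re (?E z)) (- t)" using that by (intro z) auto
      then have "((\<lambda>z. Re (?E z)) \<longlongrightarrow> 0) (at (- cnj (of_real t)) within upper)" by simp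
      ultimately have "((\<lambda>z. Re (?E (- cnj z))) \<longlongrightarrow> 0) (at (of_real t) within upper)"
        by (rule filterlim_compose[rotated])
      then show ?thesis unfolding mir by simp
    qed
    have "right_corner (\<lambda>z. Re (cnj_fun f (exp (\<i> * z)))) (- b)"
      "right_corner (\<lambda>z. Re (- cnj_fun f (exp (\<i> * z)))) (- b)"
      by (rule right_corner_of_corner_decay[OF c(2), of "- b" "- a"]; use ab z' in simp)+
    then have rc: "right_corner (\<lambda>z. Re (?E (- cnj z))) (- b)" "right_corner (\<lambda>z. Re (- ?E (- cnj z))) (- b)"
      unfolding mir by simp_all
    have "left_corner (\<lambda>z. Re (?E z)) b" "left_corner (\<lambda>z. Re (- ?E z)) b"
      using left_corner_of_mirror[where U = "\<lambda>z. Re (?E z)", OF rc(1)]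
        left_corner_of_mirror[where U = "\<lambda>z. Re (- ?E z)", OF rc(2)] by auto
    moreover have "right_corner (\<lambda>z. Re (?E z)) a" "right_corner (\<lambda>z. Re (- ?E z)) a"
      by (rule right_corner_of_corner_decay[OF c(1) ab z]; assumption)+
    ultimately show "right_corner (\<lambda>z. Re (?E z)) a \<and> left_corner (\<lambda>z. Re (?E z)) b \<and>
      right_corner (\<lambda>z. Re (- ?E z)) a \<and> left_corner (\<lambda>z. Re (- ?E z)) b" by blast
  qed
qed

subsection \<open>Growth in the disc\<close>

lemma le_exp_of_log_plus_le: "log_plus s \<le> L \<Longrightarrow> s \<le> exp L"
proof (cases "s > 0")
  case True
  assume "log_plus s \<le> L"
  then have "ln s \<le> L" using True by (simp add: log_plus_def)
  then have "exp (ln s) \<le> exp L" by simp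
  then show ?thesis using True by simp
next
  case False
  then have "s \<le> 0" by simp
  also have "0 \<le> exp L" by simp
  finally show ?thesis .
qed

lemma le_circle_max:
  assumes f: "f holomorphic_on ball 0 1" and u: "\<And>z. z \<in> ball 0 1 \<Longrightarrow> u z = Re (f z)" and z: "z \<in> ball 0 1"
  shows "Re (f z) \<le> circle_max u (norm z)"
proof -
  let ?c = "\<lambda>t. complex_of_real (norm z) * cis t"
  have inb: "?c t \<in> ball 0 1" for t using z by (simp add: norm_mult)
  have "continuous_on {0..2 * pi} (\<lambda>t. Re (f (?c t)))"
    by (intro continuous_intros continuous_on_compose2[OF holomorphic_on_imp_continuous_on[OF f]]) (use inb in auto)
  then have "bounded ((\<lambda>t. Re (f (?c t))) ` {0..2 * pi})"
    by (intro compact_imp_bounded compact_continuous_image) auto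
  then have "bdd_above ((\<lambda>t. Re (f (?c t))) ` {0..2 * pi})" by (rule bounded_imp_bdd_above)
  then have "bdd_above ((\<lambda>t. u (?c t)) ` {0..2 * pi})" using u[OF inb] by simp
  moreover have "Arg2pi z \<in> {0..2 * pi}" using Arg2pi_ge_0[of z] Arg2pi_lt_2pi[of z] by simp
  ultimately have "u (?c (Arg2pi z)) \<le> circle_max u (norm z)"
    unfolding circle_max_def by (intro cSUP_upper)
  moreover have "?c (Arg2pi z) = z" using Arg2pi_eq[of z] by (simp add: cis_conv_exp)
  ultimately show ?thesis using u[OF z] by simp
qed

text \<open>Harnack's inequality for \<open>N + 1 - f\<close> on the disc whose radius
  \<open>R\<close> is halfway between \<open>norm z\<close> and 1: a one sided bound becomes two
  sided at the cost of \<open>1 / (1 - norm z)\<close>. The constant 4 combines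
  \<open>R + norm z \<le> 2\<close> with \<open>R - norm z = (1 - norm z) / 2\<close>.\<close>

lemma two_sided_bound:
  assumes f: "f holomorphic_on ball 0 1" and z: "z \<in> ball 0 1" and R: "R = (1 + norm z) / 2"
    and N: "N \<ge> 1" "\<And>w. norm w = R \<Longrightarrow> Re (f w) \<le> N"
  shows "\<bar>Re (f z)\<bar> \<le> 4 * (N + 1 + \<bar>Re (f 0)\<bar>) / (1 - norm z)"
proof -
  define A where "A = \<bar>Re (f 0)\<bar>"
  have zR: "norm z < R" "R < 1" "R > 0" using z by (auto simp: R field_simps add_pos_nonneg)
  have fR: "f holomorphic_on ball 0 R" using f zR by (elim holomorphic_on_subset) auto
  have le: "Re (f w) \<le> N" if w: "w \<in> ball 0 R" for w
  proof (rule Re_le_if_limsup_frontier_le[OF open_ball bounded_ball fR _ w])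
    fix \<xi> and e :: real assume "\<xi> \<in> frontier (ball (0::complex) R)" and e: "e > 0"
    then have n: "norm \<xi> = R" using zR by (simp add: frontier_ball)
    then have "isCont f \<xi>"
      using holomorphic_on_imp_continuous_on[OF f] zR by (auto simp: continuous_on_eq_continuous_at)
    then show "\<forall>\<^sub>F z in at \<xi> within ball 0 R. Re (f z) \<le> N + e"
      by (intro eventually_Re_le_of_isCont N(2) n e)
  qed
  have "Re (of_real (N + 1) - f z) * (R - dist 0 z) \<le> Re (of_real (N + 1) - f 0) * (R + dist 0 z)"
  proof (rule Harnack)
    show "(\<lambda>w. of_real (N + 1) - f w) holomorphic_on ball 0 R" by (intro holomorphic_intros fR)
    show "Re (of_real (N + 1) - f w) > 0" if "w \<in> ball 0 R" for w using le[OF that] by simp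
  qed (use zR in auto)
  then have "(N + 1 - Re (f z)) * (R - norm z) \<le> (N + 1 - Re (f 0)) * (R + norm z)" by simp
  also have "\<dots> \<le> (N + 1 + A) * 2" using zR N by (intro mult_mono) (auto simp: A_def)
  finally have "(N + 1 - Re (f z)) * (1 - norm z) \<le> 4 * (N + 1 + A)" by (simp add: R algebra_simps)
  then have h: "N + 1 - Re (f z) \<le> 4 * (N + 1 + A) / (1 - norm z)" using z by (simp add: pos_le_divide_eq)
  moreover have "N \<le> 4 * (N + 1 + A) / (1 - norm z)"
  proof -
    have "N * (1 - norm z) \<le> N * 1" using N by (intro mult_left_mono) auto
    also have "\<dots> \<le> 4 * (N + 1 + A)" using N by (simp add: A_def)
    finally show ?thesis using z by (simp add: pos_le_divide_eq)
  qed
  moreover have "Re (f z) \<le> N" using zR by (intro le) simp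
  ultimately show ?thesis unfolding A_def[symmetric] using N by (auto simp: abs_le_iff)
qed

text \<open>\<open>N (y / 2)\<close> appears because the circle of radius
  \<open>(1 + norm z) / 2\<close> has distance \<open>y / 2\<close> from the unit circle. \<Psi>
  absorbs the loss \<open>1 / y\<close>, which is negligible against exponential rates.\<close>

lemma disc_growth:
  assumes f: "f holomorphic_on ball 0 1" and u: "\<And>z. z \<in> ball 0 1 \<Longrightarrow> u z = Re (f z)"
    and N: "\<forall>\<^sub>F r in at_left 1. circle_max u r \<le> N (1 - r)" "\<And>y. N y \<ge> 1"
    and ev: "\<forall>\<^sub>F y in at_right 0. 4 * (N (y / 2) + 1 + \<bar>Re (f 0)\<bar>) / y \<le> \<Psi> y"
  shows "\<exists>d>0. \<forall>z\<in>ball 0 1. 1 - norm z < d \<longrightarrow> \<bar>Re (f z)\<bar> \<le> \<Psi> (1 - norm z)"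
proof -
  obtain b where b: "b < 1" "\<And>r. b < r \<Longrightarrow> r < 1 \<Longrightarrow> circle_max u r \<le> N (1 - r)"
    using N(1) by (auto simp: eventually_at_left_field)
  obtain c where c: "c > 0" "\<And>y. 0 < y \<Longrightarrow> y < c \<Longrightarrow> 4 * (N (y / 2) + 1 + \<bar>Re (f 0)\<bar>) / y \<le> \<Psi> y"
    using ev by (auto simp: eventually_at_right_field)
  have "\<bar>Re (f z)\<bar> \<le> \<Psi> (1 - norm z)" if z: "z \<in> ball 0 1" "1 - norm z < min (1 - b) c" for z
  proof -
    define y where "y = 1 - norm z"
    have y: "0 < y" "y < c" "y < 1 - b" using z by (auto simp: y_def)
    have R: "1 - (1 + norm z) / 2 = y / 2" by (simp add: y_def field_simps)
    have "\<bar>Re (f z)\<bar> \<le> 4 * (N (y / 2) + 1 + \<bar>Re (f 0)\<bar>) / (1 - norm z)"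
    proof (rule two_sided_bound[OF f z(1) refl N(2)])
      fix w :: complex assume w: "norm w = (1 + norm z) / 2"
      then have "w \<in> ball 0 1" using z by simp
      then have "Re (f w) \<le> circle_max u (norm w)" using u by (intro le_circle_max[OF f]) auto
      also have "\<dots> \<le> N (1 - norm w)" using y w by (intro b) (auto simp: y_def field_simps)
      finally show "Re (f w) \<le> N (y / 2)" using w R by simp
    qed
    also have "\<dots> \<le> \<Psi> y" using c(2)[OF y(1,2)] by (simp add: y_def)
    finally show ?thesis by (simp add: y_def)
  qed
  then show ?thesis using b(1) c(1) by (intro exI[of _ "min (1 - b) c"]) auto
qed

lemma chart_growth:
  assumes G: "\<exists>d>0. \<forall>z\<in>ball 0 1. 1 - norm z < d \<longrightarrow> \<bar>Re (f z)\<bar> \<le> \<Psi> (1 - norm z)"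
    and anti: "\<And>x y. 0 < x \<Longrightarrow> x \<le> y \<Longrightarrow> \<Psi> y \<le> \<Psi> x"
  shows "\<exists>d>0. \<forall>z. 0 < Im z \<and> norm z < d \<longrightarrow> \<bar>Re (f (half_plane_to_disc \<phi> z))\<bar> \<le> \<Psi> (Im z / 2)"
proof -
  obtain d where d: "d > 0" "\<And>z. z \<in> ball 0 1 \<Longrightarrow> 1 - norm z < d \<Longrightarrow> \<bar>Re (f z)\<bar> \<le> \<Psi> (1 - norm z)"
    using G by blast
  have "isCont (\<lambda>z. 1 - norm (half_plane_to_disc \<phi> z)) 0"
    by (intro continuous_intros isCont_half_plane_to_disc) simp
  then have "((\<lambda>z. 1 - norm (half_plane_to_disc \<phi> z)) \<longlongrightarrow> 0) (at 0)"
    by (simp add: isCont_def half_plane_to_disc_0)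
  then have "\<forall>\<^sub>F z in at 0. 1 - norm (half_plane_to_disc \<phi> z) < d" by (rule order_tendstoD(2)) (rule d)
  then obtain \<delta> where \<delta>: "\<delta> > 0" "\<And>z. z \<noteq> 0 \<Longrightarrow> norm z < \<delta> \<Longrightarrow> 1 - norm (half_plane_to_disc \<phi> z) < d"
    unfolding eventually_at by (auto simp: dist_norm)
  have "\<bar>Re (f (half_plane_to_disc \<phi> z))\<bar> \<le> \<Psi> (Im z / 2)" if z: "0 < Im z" "norm z < min \<delta> 1" for z
  proof -
    define w where "w = half_plane_to_disc \<phi> z"
    have w: "norm w < 1" "norm w \<le> 1 - Im z / 2" unfolding w_def using z by (auto intro!: half_plane_to_disc_norm)
    have "z \<noteq> 0" using z by auto
    then have "1 - norm w < d" using \<delta>(2)[of z] z by (simp add: w_def)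
    then have "\<bar>Re (f w)\<bar> \<le> \<Psi> (1 - norm w)" using w by (intro d) auto
    also have "\<dots> \<le> \<Psi> (Im z / 2)" using w z by (intro anti) auto
    finally show ?thesis by (simp add: w_def)
  qed
  then show ?thesis using \<delta>(1) by (intro exI[of _ "min \<delta> 1"]) auto
qed

section \<open>Two sided growth classes and their transfer to charts\<close>

definition power_growth :: "real \<Rightarrow> (complex \<Rightarrow> complex) \<Rightarrow> bool" where
  "power_growth \<rho> f \<longleftrightarrow> (\<forall>e>0. \<exists>d>0. \<forall>z\<in>ball 0 1. 1 - norm z < d \<longrightarrow>
    \<bar>Re (f z)\<bar> \<le> exp (e * (1 - norm z) powr (- \<rho>)))"

definition exp_growth :: "real \<Rightarrow> (complex \<Rightarrow> complex) \<Rightarrow> bool" where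
  "exp_growth \<gamma> f \<longleftrightarrow> (\<forall>e>0. \<exists>d>0. \<forall>z\<in>ball 0 1. 1 - norm z < d \<longrightarrow>
    \<bar>Re (f z)\<bar> \<le> exp (exp (e * (1 - norm z) powr (\<gamma> - 1))))"

lemma power_growth_cnj_fun: "power_growth \<rho> f \<Longrightarrow> power_growth \<rho> (cnj_fun f)"
  unfolding power_growth_def cnj_fun_def
  by (metis (no_types, lifting) complex_cnj(1) complex_mod_cnj mem_ball_0 complex.collapse complex.sel(1))

lemma exp_growth_cnj_fun: "exp_growth \<gamma> f \<Longrightarrow> exp_growth \<gamma> (cnj_fun f)"
  unfolding exp_growth_def cnj_fun_def
  by (metis (no_types, lifting) complex_cnj(1) complex_mod_cnj mem_ball_0 complex.collapse complex.sel(1))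

lemma power_growth_of_circle_max:
  assumes f: "f holomorphic_on ball 0 1" and u: "\<And>z. z \<in> ball 0 1 \<Longrightarrow> u z = Re (f z)" and \<rho>: "\<rho> > 0"
    and o: "(\<lambda>r. log_plus (circle_max u r)) \<in> o[at_left 1](\<lambda>r. (1 - r) powr (- \<rho>))"
  shows "power_growth \<rho> f"
  unfolding power_growth_def
proof (intro allI impI)
  fix e :: real assume e: "e > 0"
  \<comment> \<open>The power of \<open>1 / 2\<close> undoes the argument \<open>y / 2\<close>, and
    half of \<open>e\<close> is kept for the factor \<open>4 / y\<close>.\<close>
  define e1 where "e1 = e / 2 * (1 / 2) powr \<rho>"
  have e1: "e1 > 0" using e by (simp add: e1_def)
  show "\<exists>d>0. \<forall>z\<in>ball 0 1. 1 - norm z < d \<longrightarrow> \<bar>Re (f z)\<bar> \<le> exp (e * (1 - norm z) powr (- \<rho>))"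
  proof (rule disc_growth[OF f u, where N = "\<lambda>y. exp (e1 * y powr (- \<rho>))"])
    show "\<forall>\<^sub>F r in at_left 1. circle_max u r \<le> exp (e1 * (1 - r) powr (- \<rho>))"
      using landau_o.smallD[OF o e1]
    proof eventually_elim
      case (elim r)
      then have "log_plus (circle_max u r) \<le> e1 * (1 - r) powr (- \<rho>)" by simp
      then show ?case by (rule le_exp_of_log_plus_le)
    qed
    show "1 \<le> exp (e1 * y powr (- \<rho>))" for y using e1 by simp
    have eq: "\<forall>\<^sub>F y in at_right 0. e1 * (y / 2) powr (- \<rho>) = e / 2 * y powr (- \<rho>)"
      using eventually_at_right_less[of 0]
    proof eventually_elim
      case (elim y)
      then show ?case using powr_quotient[of "1 / 2" "y / 2" \<rho>] by (simp add: e1_def)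
    qed
    have "\<forall>\<^sub>F y in at_right (0::real). 4 * (exp (e / 2 * y powr (- \<rho>)) + 1 + \<bar>Re (f 0)\<bar>) / y \<le> exp (e * y powr (- \<rho>))"
      using e \<rho> by real_asymp
    with eq show "\<forall>\<^sub>F y in at_right 0. 4 * (exp (e1 * (y / 2) powr (- \<rho>)) + 1 + \<bar>Re (f 0)\<bar>) / y \<le> exp (e * y powr (- \<rho>))"
      by eventually_elim (simp only:)
  qed
qed

lemma exp_growth_of_circle_max:
  assumes f: "f holomorphic_on ball 0 1" and u: "\<And>z. z \<in> ball 0 1 \<Longrightarrow> u z = Re (f z)" and \<gamma>: "\<gamma> < 1"
    and o: "(\<lambda>r. log_plus (log_plus (circle_max u r))) \<in> o[at_left 1](\<lambda>r. (1 - r) powr (\<gamma> - 1))"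
  shows "exp_growth \<gamma> f"
  unfolding exp_growth_def
proof (intro allI impI)
  fix e :: real assume e: "e > 0"
  define e1 where "e1 = e / 2 * (1 / 2) powr (1 - \<gamma>)"
  have e1: "e1 > 0" using e by (simp add: e1_def)
  show "\<exists>d>0. \<forall>z\<in>ball 0 1. 1 - norm z < d \<longrightarrow> \<bar>Re (f z)\<bar> \<le> exp (exp (e * (1 - norm z) powr (\<gamma> - 1)))"
  proof (rule disc_growth[OF f u, where N = "\<lambda>y. exp (exp (e1 * y powr (\<gamma> - 1)))"])
    show "\<forall>\<^sub>F r in at_left 1. circle_max u r \<le> exp (exp (e1 * (1 - r) powr (\<gamma> - 1)))"
      using landau_o.smallD[OF o e1]
    proof eventually_elim
      case (elim r)
      then have "log_plus (log_plus (circle_max u r)) \<le> e1 * (1 - r) powr (\<gamma> - 1)" by simp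
      then show ?case by (intro le_exp_of_log_plus_le)
    qed
    show "1 \<le> exp (exp (e1 * y powr (\<gamma> - 1)))" for y by simp
    have eq: "\<forall>\<^sub>F y in at_right 0. e1 * (y / 2) powr (\<gamma> - 1) = e / 2 * y powr (\<gamma> - 1)"
      using eventually_at_right_less[of 0]
    proof eventually_elim
      case (elim y)
      then show ?case using powr_quotient[of "1 / 2" "y / 2" "1 - \<gamma>"] by (simp add: e1_def)
    qed
    have "\<forall>\<^sub>F y in at_right (0::real). 4 * (exp (exp (e / 2 * y powr (\<gamma> - 1))) + 1 + \<bar>Re (f 0)\<bar>) / y \<le> exp (exp (e * y powr (\<gamma> - 1)))"
      using e \<gamma> by real_asymp
    with eq show "\<forall>\<^sub>F y in at_right 0. 4 * (exp (exp (e1 * (y / 2) powr (\<gamma> - 1))) + 1 + \<bar>Re (f 0)\<bar>) / y \<le> exp (exp (e * y powr (\<gamma> - 1)))"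
      by eventually_elim (simp only:)
  qed
qed

lemma chart_power_growth:
  assumes G: "power_growth \<rho> f" and \<rho>: "\<rho> > 0" and e: "e > 0"
  shows "\<exists>d>0. \<forall>z. 0 < Im z \<and> norm z < d \<longrightarrow> \<bar>Re (f (half_plane_to_disc \<phi> z))\<bar> \<le> exp (e * Im z powr (- \<rho>))"
proof -
  define e1 where "e1 = e * (1 / 2) powr \<rho>"
  have e1: "e1 > 0" using e by (simp add: e1_def)
  have "\<exists>d>0. \<forall>z. 0 < Im z \<and> norm z < d \<longrightarrow> \<bar>Re (f (half_plane_to_disc \<phi> z))\<bar> \<le> exp (e1 * (Im z / 2) powr (- \<rho>))"
  proof (rule chart_growth[where \<Psi> = "\<lambda>y. exp (e1 * y powr (- \<rho>))"])
    show "\<exists>d>0. \<forall>z\<in>ball 0 1. 1 - norm z < d \<longrightarrow> \<bar>Re (f z)\<bar> \<le> exp (e1 * (1 - norm z) powr (- \<rho>))"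
      using G e1 unfolding power_growth_def by blast
    show "exp (e1 * y powr (- \<rho>)) \<le> exp (e1 * x powr (- \<rho>))" if "0 < x" "x \<le> y" for x y
      using that e1 \<rho> by (simp add: powr_mono2')
  qed
  moreover have "e1 * (y / 2) powr (- \<rho>) = e * y powr (- \<rho>)" if "y > 0" for y
    using powr_quotient[of "1 / 2" "y / 2" \<rho>] that by (simp add: e1_def)
  ultimately show ?thesis by (metis (no_types, lifting))
qed

lemma chart_exp_growth:
  assumes G: "exp_growth \<gamma> f" and \<gamma>: "\<gamma> < 1" and e: "e > 0"
  shows "\<exists>d>0. \<forall>z. 0 < Im z \<and> norm z < d \<longrightarrow> \<bar>Re (f (half_plane_to_disc \<phi> z))\<bar> \<le> exp (exp (e * Im z powr (\<gamma> - 1)))"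
proof -
  define e1 where "e1 = e * (1 / 2) powr (1 - \<gamma>)"
  have e1: "e1 > 0" using e by (simp add: e1_def)
  have "\<exists>d>0. \<forall>z. 0 < Im z \<and> norm z < d \<longrightarrow> \<bar>Re (f (half_plane_to_disc \<phi> z))\<bar> \<le> exp (exp (e1 * (Im z / 2) powr (\<gamma> - 1)))"
  proof (rule chart_growth[where \<Psi> = "\<lambda>y. exp (exp (e1 * y powr (\<gamma> - 1)))"])
    show "\<exists>d>0. \<forall>z\<in>ball 0 1. 1 - norm z < d \<longrightarrow> \<bar>Re (f z)\<bar> \<le> exp (exp (e1 * (1 - norm z) powr (\<gamma> - 1)))"
      using G e1 unfolding exp_growth_def by blast
    show "exp (exp (e1 * y powr (\<gamma> - 1))) \<le> exp (exp (e1 * x powr (\<gamma> - 1)))" if "0 < x" "x \<le> y" for x y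
      using that e1 \<gamma> by (simp add: powr_mono2')
  qed
  moreover have "e1 * (y / 2) powr (\<gamma> - 1) = e * y powr (\<gamma> - 1)" if "y > 0" for y
    using powr_quotient[of "1 / 2" "y / 2" "1 - \<gamma>"] that by (simp add: e1_def)
  ultimately show ?thesis by (metis (no_types, lifting))
qed

section \<open>The corner estimate for the three kinds of regions\<close>

lemma corner_decayI:
  assumes "\<And>a \<eta>. \<eta> > 0 \<Longrightarrow> (\<And>t. 0 < t \<Longrightarrow> t < \<eta> \<Longrightarrow> boundary_zero (\<lambda>z. Re (f (half_plane_to_disc a z))) t) \<Longrightarrow>
    (\<And>e. e > 0 \<Longrightarrow> \<exists>d>0. \<forall>z. 0 < Re z \<and> 0 < Im z \<and> norm z < d \<longrightarrow>
      \<bar>Re (f (half_plane_to_disc a z))\<bar> \<le> e / (norm z)\<^sup>2)"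
  shows "corner_decay f"
  unfolding corner_decay_def
proof (intro allI impI)
  fix a b e :: real
  assume ab: "a < b" and e: "e > 0"
    and z: "\<forall>t. a < t \<and> t < b \<longrightarrow> boundary_zero (\<lambda>z. Re (f (exp (\<i> * z)))) t"
  show "\<exists>d>0. \<forall>z. 0 < Re z \<and> 0 < Im z \<and> norm z < d \<longrightarrow> \<bar>Re (f (half_plane_to_disc a z))\<bar> \<le> e / (norm z)\<^sup>2"
  \<comment> \<open>The bound 1 keeps \<open>t\<close> where the chart is
    \<open>cis (a + 2 * arctan t)\<close>, and \<open>2 * arctan t \<le> 2 * t\<close> keeps the
    image between \<open>a\<close> and \<open>b\<close>.\<close>
  proof (rule assms[where \<eta> = "min 1 ((b - a) / 2)", OF _ _ e])
    show "min 1 ((b - a) / 2) > 0" using ab by simp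
    show "boundary_zero (\<lambda>z. Re (f (half_plane_to_disc a z))) t" if "0 < t" "t < min 1 ((b - a) / 2)" for t
      by (rule chart_boundary_zero[where b = b]) (use z that in auto)
  qed
qed

lemma corner_decay_cubic:
  assumes f: "f holomorphic_on ball 0 1" and H: "disc_zero_limits (\<lambda>t. c * t ^ 3) f" and c: "c > 0"
    and G: "power_growth 1 f"
  shows "corner_decay f"
proof (rule corner_decayI)
  fix a \<eta> e :: real
  assume \<eta>: "\<eta> > 0" and e: "e > 0"
    and z: "\<And>t. 0 < t \<Longrightarrow> t < \<eta> \<Longrightarrow> boundary_zero (\<lambda>z. Re (f (half_plane_to_disc a z))) t"
  show "\<exists>d>0. \<forall>z. 0 < Re z \<and> 0 < Im z \<and> norm z < d \<longrightarrow> \<bar>Re (f (half_plane_to_disc a z))\<bar> \<le> e / (norm z)\<^sup>2"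
    by (rule corner_bound_cubic[OF chart_holomorphic[OF f] \<eta> z c chart_approach_bound[OF H] chart_power_growth[OF G zero_less_one] e])
qed

lemma corner_decay_sector:
  assumes f: "f holomorphic_on ball 0 1" and H: "disc_zero_limits (\<lambda>t. c * t) f" and c: "c > 0"
    and G: "power_growth (pi / (2 * arctan (1 / c))) f"
  shows "corner_decay f"
proof (rule corner_decayI)
  fix a \<eta> e :: real
  assume \<eta>: "\<eta> > 0" and e: "e > 0"
    and z: "\<And>t. 0 < t \<Longrightarrow> t < \<eta> \<Longrightarrow> boundary_zero (\<lambda>z. Re (f (half_plane_to_disc a z))) t"
  have "pi / (2 * arctan (1 / c)) > 0" using c by simp
  then show "\<exists>d>0. \<forall>z. 0 < Re z \<and> 0 < Im z \<and> norm z < d \<longrightarrow> \<bar>Re (f (half_plane_to_disc a z))\<bar> \<le> e / (norm z)\<^sup>2"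
    by (intro corner_bound_sector[OF chart_holomorphic[OF f] \<eta> z c chart_approach_bound[OF H] refl chart_power_growth[OF G] e])
qed

lemma corner_decay_cusp:
  assumes f: "f holomorphic_on ball 0 1" and H: "disc_zero_limits (\<lambda>t. t powr \<gamma>) f" and \<gamma>: "0 < \<gamma>" "\<gamma> < 1"
    and G: "exp_growth \<gamma> f"
  shows "corner_decay f"
proof (rule corner_decayI)
  fix a \<eta> e :: real
  assume \<eta>: "\<eta> > 0" and e: "e > 0"
    and z: "\<And>t. 0 < t \<Longrightarrow> t < \<eta> \<Longrightarrow> boundary_zero (\<lambda>z. Re (f (half_plane_to_disc a z))) t"
  show "\<exists>d>0. \<forall>z. 0 < Re z \<and> 0 < Im z \<and> norm z < d \<longrightarrow> \<bar>Re (f (half_plane_to_disc a z))\<bar> \<le> e / (norm z)\<^sup>2"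
    by (rule corner_bound_cusp[OF chart_holomorphic[OF f] \<eta> z \<gamma> chart_approach_bound[OF H] chart_exp_growth[OF G \<gamma>(2)] e])
qed

text \<open>The growth condition is uniform along the circle, so it can be read off in the lifted
  coordinate: height \<open>y\<close> corresponds to the radius \<open>exp (- y)\<close>, whose
  distance from 1 is asymptotic to \<open>y\<close>.\<close>

lemma zero_of_radial_limits:
  assumes f: "f holomorphic_on ball 0 1" and u: "\<And>z. z \<in> ball 0 1 \<Longrightarrow> u z = Re (f z)"
    and H: "disc_zero_limits (\<lambda>t. 0) f"
    and o: "circle_max u \<in> o[at_left 1](\<lambda>r. (1 - r) powr (-2))" and w: "w \<in> ball 0 1"
  shows "Re (f w) = 0"
proof (rule boundary_zero_imp_zero[OF f _ w])
  fix t
  show "boundary_zero (\<lambda>z. Re (f (exp (\<i> * z)))) t"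
  proof (rule vanishing_everywhere_one_sided[OF strip_holomorphic[OF f]])
    show "((\<lambda>y. Re (f (exp (\<i> * Complex x y)))) \<longlongrightarrow> 0) (at_right 0)" for x
      by (rule disc_zero_limits_vertical[OF H]) simp
    fix e :: real assume e: "e > 0"
    \<comment> \<open>The remaining factor 2 absorbs the difference between
      \<open>1 - exp (- y)\<close> and \<open>y\<close>.\<close>
    then have "e / 2 > 0" by simp
    have "\<forall>\<^sub>F r in at_left 1. circle_max u r \<le> e / 2 * (1 - r) powr (- 2)"
      using landau_o.smallD[OF o \<open>e / 2 > 0\<close>] by eventually_elim simp
    then obtain b where b: "b < 1" "\<And>r. b < r \<Longrightarrow> r < 1 \<Longrightarrow> circle_max u r \<le> e / 2 * (1 - r) powr (- 2)"
      by (auto simp: eventually_at_left_field)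
    have "\<forall>\<^sub>F y in at_right (0::real). (1 - exp (- y)) powr (- 2) \<le> 2 / y\<^sup>2" by real_asymp
    moreover have "\<forall>\<^sub>F y in at_right (0::real). b < exp (- y)" using b(1) by real_asymp
    ultimately have "\<forall>\<^sub>F y in at_right (0::real). (1 - exp (- y)) powr (- 2) \<le> 2 / y\<^sup>2 \<and> b < exp (- y)"
      by (rule eventually_conj)
    then obtain d where d: "d > 0" "\<And>y. 0 < y \<Longrightarrow> y < d \<Longrightarrow> (1 - exp (- y)) powr (- 2) \<le> 2 / y\<^sup>2 \<and> b < exp (- y)"
      by (auto simp: eventually_at_right_field)
    have "Re (f (exp (\<i> * z))) \<le> e / (Im z)\<^sup>2" if z: "0 < Im z" "Im z < d" for z
    proof -
      have "Re (f (exp (\<i> * z))) \<le> circle_max u (norm (exp (\<i> * z)))"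
        using z u by (intro le_circle_max[OF f]) (auto simp: norm_exp_ii)
      also have "norm (exp (\<i> * z)) = exp (- Im z)" by (rule norm_exp_ii)
      also have "circle_max u (exp (- Im z)) \<le> e / 2 * (1 - exp (- Im z)) powr (- 2)"
        using d(2)[OF z] z by (intro b) auto
      also have "\<dots> \<le> e / 2 * (2 / (Im z)\<^sup>2)" using d(2)[OF z] e by (intro mult_left_mono) auto
      finally show ?thesis by simp
    qed
    then show "\<exists>d>0. \<forall>z. 0 < Im z \<and> Im z < d \<longrightarrow> Re (f (exp (\<i> * z))) \<le> e / (Im z)\<^sup>2" using d(1) by blast
  qed
qed

theorem theorem1p3:
  fixes u :: "complex \<Rightarrow> real"
  assumes "u harmonic_on ball 0 1"
  shows
    "(zero_limits_along (\<lambda>t. 0) u \<longrightarrow>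
        circle_max u \<in> o[at_left 1](\<lambda>r. (1 - r) powr (-2)) \<longrightarrow>
        (\<forall>z\<in>ball 0 1. u z = 0)) \<and>
     (\<forall>c>0. zero_limits_along (\<lambda>t. c * t ^ 3) u \<longrightarrow>
        (\<lambda>r. log_plus (circle_max u r)) \<in> o[at_left 1](\<lambda>r. (1 - r) powr (-1)) \<longrightarrow>
        (\<forall>z\<in>ball 0 1. u z = 0)) \<and>
     (\<forall>c>0. zero_limits_along (\<lambda>t. c * t) u \<longrightarrow>
        (\<lambda>r. log_plus (circle_max u r))
          \<in> o[at_left 1](\<lambda>r. (1 - r) powr (- (pi / (2 * arctan (1 / c))))) \<longrightarrow>
        (\<forall>z\<in>ball 0 1. u z = 0)) \<and>
     (\<forall>\<gamma>. 0 < \<gamma> \<longrightarrow> \<gamma> < 1 \<longrightarrow> zero_limits_along (\<lambda>t. t powr \<gamma>) u \<longrightarrow>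
        (\<lambda>r. log_plus (log_plus (circle_max u r)))
          \<in> o[at_left 1](\<lambda>r. (1 - r) powr (\<gamma> - 1)) \<longrightarrow>
        (\<forall>z\<in>ball 0 1. u z = 0))"
proof -
  obtain f where f: "f holomorphic_on ball 0 1" and u: "\<And>z. z \<in> ball 0 1 \<Longrightarrow> u z = Re (f z)"
    using harmonic_on_ball_imp_Re_holomorphic[OF assms] by blast
  note f' = cnj_fun_holomorphic[OF f]
  show ?thesis
  proof (intro conjI allI impI ballI)
    fix w :: complex assume w: "w \<in> ball 0 1"
    show "u w = 0" if "zero_limits_along (\<lambda>t. 0) u" "circle_max u \<in> o[at_left 1](\<lambda>r. (1 - r) powr (-2))"
      unfolding u[OF w] by (rule zero_of_radial_limits[OF f u disc_zero_limitsI[OF that(1) u] that(2) w])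
    show "u w = 0" if c: "c > 0" and z: "zero_limits_along (\<lambda>t. c * t ^ 3) u"
      and o: "(\<lambda>r. log_plus (circle_max u r)) \<in> o[at_left 1](\<lambda>r. (1 - r) powr (-1))" for c
    proof -
      have H: "disc_zero_limits (\<lambda>t. c * t ^ 3) f" by (rule disc_zero_limitsI[OF z u])
      have G: "power_growth 1 f" by (rule power_growth_of_circle_max[OF f u zero_less_one o])
      show ?thesis unfolding u[OF w]
      proof (rule zero_of_corner_decay[OF f H _ _ _ w])
        show "corner_decay f" by (rule corner_decay_cubic[OF f H c G])
        show "corner_decay (cnj_fun f)"
          by (rule corner_decay_cubic[OF f' disc_zero_limits_cnj_fun[OF H] c power_growth_cnj_fun[OF G]])
      qed (use c in simp)
    qed
    show "u w = 0" if c: "c > 0" and z: "zero_limits_along (\<lambda>t. c * t) u"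
      and o: "(\<lambda>r. log_plus (circle_max u r)) \<in> o[at_left 1](\<lambda>r. (1 - r) powr (- (pi / (2 * arctan (1 / c)))))" for c
    proof -
      have H: "disc_zero_limits (\<lambda>t. c * t) f" by (rule disc_zero_limitsI[OF z u])
      have "pi / (2 * arctan (1 / c)) > 0" using c by simp
      from power_growth_of_circle_max[OF f u this o]
      have G: "power_growth (pi / (2 * arctan (1 / c))) f" .
      show ?thesis unfolding u[OF w]
      proof (rule zero_of_corner_decay[OF f H _ _ _ w])
        show "corner_decay f" by (rule corner_decay_sector[OF f H c G])
        show "corner_decay (cnj_fun f)"
          by (rule corner_decay_sector[OF f' disc_zero_limits_cnj_fun[OF H] c power_growth_cnj_fun[OF G]])
      qed (use c in simp)
    qed
    show "u w = 0" if \<gamma>: "0 < \<gamma>" "\<gamma> < 1" and z: "zero_limits_along (\<lambda>t. t powr \<gamma>) u"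
      and o: "(\<lambda>r. log_plus (log_plus (circle_max u r))) \<in> o[at_left 1](\<lambda>r. (1 - r) powr (\<gamma> - 1))" for \<gamma>
    proof -
      have H: "disc_zero_limits (\<lambda>t. t powr \<gamma>) f" by (rule disc_zero_limitsI[OF z u])
      have G: "exp_growth \<gamma> f" by (rule exp_growth_of_circle_max[OF f u \<gamma>(2) o])
      show ?thesis unfolding u[OF w]
      proof (rule zero_of_corner_decay[OF f H _ _ _ w])
        show "corner_decay f" by (rule corner_decay_cusp[OF f H \<gamma> G])
        show "corner_decay (cnj_fun f)"
          by (rule corner_decay_cusp[OF f' disc_zero_limits_cnj_fun[OF H] \<gamma> exp_growth_cnj_fun[OF G]])
      qed simp
    qed
  qed
qed

end
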